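(* Let $(R,\mathfrak m)$ be a Cohen-Macaulay local ring, let $M$ be a maximal Cohen-Macaulay $R$-module and let $A=R\ltimes M$. Then $$r_R(M)\le r(A)\le r(R)+r_R(M).$$ Let $\mathfrak q$ be a parameter ideal of $R$ and set $\overline R=R/\mathfrak q$, $\overline M=M/\mathfrak qM$. Then the following hold. (1) $r(A)=r_R(M)$ if and only if $\overline M$ is a faithful $\overline R$-module. (2) $r(A)=r(R)+r_R(M)$ if and only if $(\mathfrak q:_R\mathfrak m)M=\mathfrak qM$.
   Context: All rings are commutative. For a ring $R$ and an $R$-module $M$, the idealization $R\ltimes M$ is the ring with additive group $R\oplus M$ and multiplication $(a,x)(b,y)=(ab,ay+bx)$. If $(R,\mathfrak m)$ is local, $R\ltimes M$ is local with maximal ideal $\mathfrak m\times M$. For a Cohen-Macaulay (Noetherian) local ring $(R,\mathfrak m)$ of dimension $d\ge 0$, a maximal Cohen-Macaulay (MCM) $R$-module is a finitely generated $R$-module $M$ with $\operatorname{depth}_R M=d$ (in this case $R\ltimes M$ is again a Cohen-Macaulay local ring of dimension $d$). The Cohen-Macaulay type of $M$ is $r_R(M)=\ell_R(\operatorname{Ext}^d_R(R/\mathfrak m,M))$, where $\ell_R$ denotes length, and $r(R)=r_R(R)$. A parameter ideal of $R$ is an ideal generated by a system of parameters of $R$. For ideals $I,J$ of $R$, $I:_RJ=\{a\in R\mid aJ\subseteq I\}$. *)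

theory Defs
  imports "HOL-Library.Extended_Nat" "HOL-Algebra.Algebra"
begin

text \<open>
  In HOL-Algebra a module record extends the ring record. The fields \<open>mult\<close> and \<open>one\<close> play
  no role for modules and are left \<open>undefined\<close> in the module constructions below.
\<close>

section \<open>Modules\<close>

definition self_module :: "('a, 'r) ring_scheme \<Rightarrow> ('a, 'a) module" where
  "self_module R = \<lparr>carrier = carrier R, monoid.mult = (\<otimes>\<^bsub>R\<^esub>), one = \<one>\<^bsub>R\<^esub>, ring.zero = \<zero>\<^bsub>R\<^esub>,
     add = (\<oplus>\<^bsub>R\<^esub>), smult = (\<otimes>\<^bsub>R\<^esub>)\<rparr>"

definition submodule_span ::
    "('a, 'r) ring_scheme \<Rightarrow> ('a, 'b, 'm) module_scheme \<Rightarrow> 'b set \<Rightarrow> 'b set" where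
  "submodule_span R M S = \<Inter>{N. submodule N R M \<and> S \<subseteq> N}"

definition fin_gen_module :: "('a, 'r) ring_scheme \<Rightarrow> ('a, 'b, 'm) module_scheme \<Rightarrow> bool" where
  "fin_gen_module R M \<longleftrightarrow> module R M \<and>
     (\<exists>S. finite S \<and> S \<subseteq> carrier M \<and> submodule_span R M S = carrier M)"

definition ideal_times_module ::
    "('a, 'r) ring_scheme \<Rightarrow> 'a set \<Rightarrow> ('a, 'b, 'm) module_scheme \<Rightarrow> 'b set" where
  "ideal_times_module R I M = submodule_span R M {a \<odot>\<^bsub>M\<^esub> x | a x. a \<in> I \<and> x \<in> carrier M}"

definition quot_module ::
    "('a, 'b, 'm) module_scheme \<Rightarrow> 'b set \<Rightarrow> ('a, 'b set) module" where
  "quot_module M N = \<lparr>carrier = a_rcosets\<^bsub>M\<^esub> N, monoid.mult = undefined, one = undefined, ring.zero = N,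
     add = set_add M, smult = (\<lambda>a T. \<Union>x\<in>T. N +>\<^bsub>M\<^esub> (a \<odot>\<^bsub>M\<^esub> x))\<rparr>"

text \<open>\<open>M/IM\<close> as a module over \<open>R Quot I\<close>, so that scalars are themselves cosets.\<close>

definition reduced_module ::
    "('a, 'r) ring_scheme \<Rightarrow> 'a set \<Rightarrow> ('a, 'b, 'm) module_scheme \<Rightarrow> ('a set, 'b set) module" where
  "reduced_module R I M = (let N = ideal_times_module R I M in
     \<lparr>carrier = a_rcosets\<^bsub>M\<^esub> N, monoid.mult = undefined, one = undefined, ring.zero = N,
      add = set_add M, smult = (\<lambda>S T. \<Union>a\<in>S. \<Union>x\<in>T. N +>\<^bsub>M\<^esub> (a \<odot>\<^bsub>M\<^esub> x))\<rparr>)"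

definition annihilator :: "('a, 'r) ring_scheme \<Rightarrow> ('a, 'b, 'm) module_scheme \<Rightarrow> 'a set" where
  "annihilator R M = {a \<in> carrier R. \<forall>x\<in>carrier M. a \<odot>\<^bsub>M\<^esub> x = \<zero>\<^bsub>M\<^esub>}"

definition faithful_module :: "('a, 'r) ring_scheme \<Rightarrow> ('a, 'b, 'm) module_scheme \<Rightarrow> bool" where
  "faithful_module R M \<longleftrightarrow> module R M \<and> annihilator R M = {\<zero>\<^bsub>R\<^esub>}"

definition module_length :: "('a, 'r) ring_scheme \<Rightarrow> ('a, 'b, 'm) module_scheme \<Rightarrow> enat" where
  "module_length R M = Sup {enat n | n. \<exists>N :: nat \<Rightarrow> 'b set.
     (\<forall>i\<le>n. submodule (N i) R M) \<and> (\<forall>i<n. N i \<subset> N (Suc i))}"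

definition linear_maps ::
    "('a, 'r) ring_scheme \<Rightarrow> ('a, 'b, 'm) module_scheme \<Rightarrow> ('a, 'c, 'n) module_scheme \<Rightarrow> ('b \<Rightarrow> 'c) set"
  where
  "linear_maps R N M = {f \<in> carrier N \<rightarrow> carrier M.
     (\<forall>x\<in>carrier N. \<forall>y\<in>carrier N. f (x \<oplus>\<^bsub>N\<^esub> y) = f x \<oplus>\<^bsub>M\<^esub> f y) \<and>
     (\<forall>a\<in>carrier R. \<forall>x\<in>carrier N. f (a \<odot>\<^bsub>N\<^esub> x) = a \<odot>\<^bsub>M\<^esub> f x)}"

text \<open>Extensionality makes two linear maps equal as soon as they agree on the carrier.\<close>

definition Hom_module ::
    "('a, 'r) ring_scheme \<Rightarrow> ('a, 'b, 'm) module_scheme \<Rightarrow> ('a, 'c, 'n) module_scheme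
      \<Rightarrow> ('a, 'b \<Rightarrow> 'c) module" where
  "Hom_module R N M = \<lparr>carrier = linear_maps R N M \<inter> extensional (carrier N),
     monoid.mult = undefined, one = undefined, ring.zero = (\<lambda>x\<in>carrier N. \<zero>\<^bsub>M\<^esub>),
     add = (\<lambda>f g. \<lambda>x\<in>carrier N. f x \<oplus>\<^bsub>M\<^esub> g x), smult = (\<lambda>a f. \<lambda>x\<in>carrier N. a \<odot>\<^bsub>M\<^esub> f x)\<rparr>"

definition free_module :: "('a, 'r) ring_scheme \<Rightarrow> nat \<Rightarrow> ('a, nat \<Rightarrow> 'a) module" where
  "free_module R n = \<lparr>carrier = {..<n} \<rightarrow>\<^sub>E carrier R, monoid.mult = undefined, one = undefined,
     ring.zero = (\<lambda>i\<in>{..<n}. \<zero>\<^bsub>R\<^esub>), add = (\<lambda>u v. \<lambda>i\<in>{..<n}. u i \<oplus>\<^bsub>R\<^esub> v i),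
     smult = (\<lambda>a v. \<lambda>i\<in>{..<n}. a \<otimes>\<^bsub>R\<^esub> v i)\<rparr>"

section \<open>Ext\<close>

text \<open>
  A resolution \<open>\<dots> \<rightarrow> R\<^sup>n\<^sup>2 \<rightarrow> R\<^sup>n\<^sup>1 \<rightarrow> R\<^sup>n\<^sup>0 \<rightarrow> N \<rightarrow> 0\<close> by free modules of finite rank exists whenever
  \<open>R\<close> is Noetherian and \<open>N\<close> is finitely generated; \<open>Ext\<close> below is meant for that situation only.
  As usual, it is computed from a chosen resolution, and different choices give isomorphic modules.
\<close>

record ('a, 'c) free_res =
  res_rank :: "nat \<Rightarrow> nat"
  res_diff :: "nat \<Rightarrow> (nat \<Rightarrow> 'a) \<Rightarrow> (nat \<Rightarrow> 'a)" \<comment> \<open>from degree \<open>i + 1\<close> to degree \<open>i\<close>\<close>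
  res_aug :: "(nat \<Rightarrow> 'a) \<Rightarrow> 'c"

definition res_module ::
    "('a, 'r) ring_scheme \<Rightarrow> ('a, 'c) free_res \<Rightarrow> nat \<Rightarrow> ('a, nat \<Rightarrow> 'a) module" where
  "res_module R C i = free_module R (res_rank C i)"

definition is_free_resolution ::
    "('a, 'r) ring_scheme \<Rightarrow> ('a, 'c, 'n) module_scheme \<Rightarrow> ('a, 'c) free_res \<Rightarrow> bool" where
  "is_free_resolution R N C \<longleftrightarrow>
     res_aug C \<in> linear_maps R (res_module R C 0) N \<and>
     (\<forall>i. res_diff C i \<in> linear_maps R (res_module R C (Suc i)) (res_module R C i)) \<and>
     res_aug C ` carrier (res_module R C 0) = carrier N \<and>
     {v \<in> carrier (res_module R C 0). res_aug C v = \<zero>\<^bsub>N\<^esub>}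
       = res_diff C 0 ` carrier (res_module R C 1) \<and>
     (\<forall>i. {v \<in> carrier (res_module R C (Suc i)). res_diff C i v = \<zero>\<^bsub>res_module R C i\<^esub>}
       = res_diff C (Suc i) ` carrier (res_module R C (Suc (Suc i))))"

definition Hom_cocycles ::
    "('a, 'r) ring_scheme \<Rightarrow> ('a, 'c) free_res \<Rightarrow> ('a, 'b, 'm) module_scheme \<Rightarrow> nat
      \<Rightarrow> ((nat \<Rightarrow> 'a) \<Rightarrow> 'b) set" where
  "Hom_cocycles R C M i = {f \<in> carrier (Hom_module R (res_module R C i) M).
     \<forall>v\<in>carrier (res_module R C (Suc i)). f (res_diff C i v) = \<zero>\<^bsub>M\<^esub>}"

definition Hom_coboundaries ::
    "('a, 'r) ring_scheme \<Rightarrow> ('a, 'c) free_res \<Rightarrow> ('a, 'b, 'm) module_scheme \<Rightarrow> nat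
      \<Rightarrow> ((nat \<Rightarrow> 'a) \<Rightarrow> 'b) set" where
  "Hom_coboundaries R C M i = (case i of
       0 \<Rightarrow> {\<zero>\<^bsub>Hom_module R (res_module R C 0) M\<^esub>}
     | Suc j \<Rightarrow> (\<lambda>g. compose (carrier (res_module R C (Suc j))) g (res_diff C j)) `
                 carrier (Hom_module R (res_module R C j) M))"

definition Ext_of_resolution ::
    "('a, 'r) ring_scheme \<Rightarrow> ('a, 'c) free_res \<Rightarrow> nat \<Rightarrow> ('a, 'b, 'm) module_scheme
      \<Rightarrow> ('a, ((nat \<Rightarrow> 'a) \<Rightarrow> 'b) set) module" where
  "Ext_of_resolution R C i M =
     quot_module ((Hom_module R (res_module R C i) M)\<lparr>carrier := Hom_cocycles R C M i\<rparr>)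
       (Hom_coboundaries R C M i)"

definition Ext ::
    "('a, 'r) ring_scheme \<Rightarrow> nat \<Rightarrow> ('a, 'c, 'n) module_scheme \<Rightarrow> ('a, 'b, 'm) module_scheme
      \<Rightarrow> ('a, ((nat \<Rightarrow> 'a) \<Rightarrow> 'b) set) module" where
  "Ext R i N M = Ext_of_resolution R (SOME C. is_free_resolution R N C) i M"

section \<open>Local rings, dimension and depth\<close>

definition local_ring :: "('a, 'r) ring_scheme \<Rightarrow> bool" where
  "local_ring R \<longleftrightarrow> cring R \<and> (\<exists>!I. maximalideal I R)"

definition the_max_ideal :: "('a, 'r) ring_scheme \<Rightarrow> 'a set" where
  "the_max_ideal R = (THE I. maximalideal I R)"

definition krull_dim :: "('a, 'r) ring_scheme \<Rightarrow> enat" where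
  "krull_dim R = Sup {enat n | n. \<exists>P :: nat \<Rightarrow> 'a set.
     (\<forall>i\<le>n. primeideal (P i) R) \<and> (\<forall>i<n. P i \<subset> P (Suc i))}"

definition regular_sequence ::
    "('a, 'r) ring_scheme \<Rightarrow> ('a, 'b, 'm) module_scheme \<Rightarrow> 'a list \<Rightarrow> bool" where
  "regular_sequence R M xs \<longleftrightarrow> set xs \<subseteq> carrier R \<and>
     (\<forall>i<length xs.
        let Q = quot_module M (ideal_times_module R (Idl\<^bsub>R\<^esub> (set (take i xs))) M)
        in \<forall>v\<in>carrier Q. (xs ! i) \<odot>\<^bsub>Q\<^esub> v = \<zero>\<^bsub>Q\<^esub> \<longrightarrow> v = \<zero>\<^bsub>Q\<^esub>) \<and>
     ideal_times_module R (Idl\<^bsub>R\<^esub> (set xs)) M \<noteq> carrier M"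

text \<open>
  The depth of a module over a local ring. The zero module has depth \<open>\<infinity>\<close> by convention;
  in particular it is not maximal Cohen-Macaulay, not even in dimension \<open>0\<close>.
\<close>

definition depth :: "('a, 'r) ring_scheme \<Rightarrow> ('a, 'b, 'm) module_scheme \<Rightarrow> enat" where
  "depth R M = (if carrier M = {\<zero>\<^bsub>M\<^esub>} then \<infinity> else
     Sup {enat (length xs) | xs. set xs \<subseteq> the_max_ideal R \<and> regular_sequence R M xs})"

definition cohen_macaulay_local :: "('a, 'r) ring_scheme \<Rightarrow> bool" where
  "cohen_macaulay_local R \<longleftrightarrow>
     local_ring R \<and> noetherian_ring R \<and> depth R (self_module R) = krull_dim R"

definition maximal_cohen_macaulay ::
    "('a, 'r) ring_scheme \<Rightarrow> ('a, 'b, 'm) module_scheme \<Rightarrow> bool" where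
  "maximal_cohen_macaulay R M \<longleftrightarrow> fin_gen_module R M \<and> depth R M = krull_dim R"

text \<open>
  Noetherian local rings have finite Krull dimension, so \<open>the_enat\<close> is harmless here.
\<close>

definition cm_type :: "('a, 'r) ring_scheme \<Rightarrow> ('a, 'b, 'm) module_scheme \<Rightarrow> enat" where
  "cm_type R M = module_length R
     (Ext R (the_enat (krull_dim R)) (quot_module (self_module R) (the_max_ideal R)) M)"

abbreviation ring_cm_type :: "('a, 'r) ring_scheme \<Rightarrow> enat" where
  "ring_cm_type R \<equiv> cm_type R (self_module R)"

definition ideal_radical :: "('a, 'r) ring_scheme \<Rightarrow> 'a set \<Rightarrow> 'a set" where
  "ideal_radical R I = {a \<in> carrier R. \<exists>n::nat. a [^]\<^bsub>R\<^esub> n \<in> I}"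

definition system_of_parameters :: "('a, 'r) ring_scheme \<Rightarrow> 'a list \<Rightarrow> bool" where
  "system_of_parameters R xs \<longleftrightarrow> set xs \<subseteq> the_max_ideal R \<and> enat (length xs) = krull_dim R \<and>
     ideal_radical R (Idl\<^bsub>R\<^esub> (set xs)) = the_max_ideal R"

definition parameter_ideal :: "('a, 'r) ring_scheme \<Rightarrow> 'a set \<Rightarrow> bool" where
  "parameter_ideal R q \<longleftrightarrow> (\<exists>xs. system_of_parameters R xs \<and> q = Idl\<^bsub>R\<^esub> (set xs))"

definition colon_ideal :: "('a, 'r) ring_scheme \<Rightarrow> 'a set \<Rightarrow> 'a set \<Rightarrow> 'a set" where
  "colon_ideal R I J = {a \<in> carrier R. \<forall>b\<in>J. a \<otimes>\<^bsub>R\<^esub> b \<in> I}"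

section \<open>Idealization\<close>

definition idealization ::
    "('a, 'r) ring_scheme \<Rightarrow> ('a, 'b, 'm) module_scheme \<Rightarrow> ('a \<times> 'b) ring" where
  "idealization R M = \<lparr>carrier = carrier R \<times> carrier M,
     monoid.mult = (\<lambda>(a, x) (b, y). (a \<otimes>\<^bsub>R\<^esub> b, a \<odot>\<^bsub>M\<^esub> y \<oplus>\<^bsub>M\<^esub> b \<odot>\<^bsub>M\<^esub> x)),
     one = (\<one>\<^bsub>R\<^esub>, \<zero>\<^bsub>M\<^esub>), ring.zero = (\<zero>\<^bsub>R\<^esub>, \<zero>\<^bsub>M\<^esub>),
     add = (\<lambda>(a, x) (b, y). (a \<oplus>\<^bsub>R\<^esub> b, x \<oplus>\<^bsub>M\<^esub> y))\<rparr>"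

end

theory Submission
  imports Defs
begin

text \<open>
  If \<open>xs\<close> is an \<open>N\<close>-regular sequence of length \<open>d\<close> in \<open>\<mm>\<close>, dimension shifting identifies
  \<open>Ext\<^sup>d(R/\<mm>, N)\<close> with the socle of \<open>N/xsN\<close>. A system of parameters is regular on every maximal
  Cohen-Macaulay module \<open>N\<close>: its Koszul cohomology with values in \<open>N\<close> vanishes in all degrees below
  the depth \<open>d\<close>, and by Nakayama's lemma the vanishing in degree \<open>d - 1\<close> already forces regularity.
  So every type is the length of a socle modulo \<open>\<qq>\<close>, and the socle of \<open>A/\<qq>A\<close> is
  \<open>(Soc(R/\<qq>) \<inter> Ann(M/\<qq>M)) \<times> Soc(M/\<qq>M)\<close>. Hence \<open>r(A) - r(M)\<close> is the length of the first factor.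
  This factor is zero iff \<open>M/\<qq>M\<close> is faithful, since a nonzero ideal of \<open>R/\<qq>\<close> meets the socle, and it
  is all of \<open>Soc(R/\<qq>)\<close> iff \<open>(\<qq> : \<mm>)M = \<qq>M\<close>.
\<close>

section \<open>Lengths of intervals of submodules\<close>

text \<open>Two facts shape the development. \<open>Ext\<close> is computed from a resolution fixed
  by \<open>SOME\<close>, of which only exactness is known, so its length has to be found for an
  arbitrary resolution. And the depth hypotheses provide some regular sequence of length
  \<open>d\<close>, while the claims concern prescribed parameters; the Koszul complex serves to
  pass from one to the other. Both complexes rest on the same long exact sequence, proved once in
  the locale \<open>cochains\<close>. To allow induction along a sequence, the coefficient module
  \<open>N\<close> stays fixed and a submodule \<open>L\<close> varies, so that \<open>N/L\<close>
  is seen only through congruence modulo \<open>L\<close>. Accordingly a length belongs to an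
  interval of submodules, and isomorphisms of subquotients are given by additive relations. For
  \<open>A\<close> a regular sequence is exhibited directly: the pairs \<open>(y, 0)\<close> act
  componentwise on \<open>R \<times> M\<close>. Lengths live in \<open>enat\<close>, where
  cancellation requires finiteness. The dimension is finite because the depth of \<open>R\<close>,
  equal to it, is bounded by the number of generators of the maximal ideal.\<close>

inductive chain_to :: "('s set \<Rightarrow> bool) \<Rightarrow> nat \<Rightarrow> 's set \<Rightarrow> bool" for P where
  zero: "P T \<Longrightarrow> chain_to P 0 T"
| Suc: "chain_to P n T \<Longrightarrow> T \<subset> T' \<Longrightarrow> P T' \<Longrightarrow> chain_to P (Suc n) T'"

definition chain_len :: "('s set \<Rightarrow> bool) \<Rightarrow> enat" where
  "chain_len P = Sup {enat n | n. \<exists>T. chain_to P n T}"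

lemma chain_to_holds: "chain_to P n T \<Longrightarrow> P T"
  by (induction rule: chain_to.induct) auto

text \<open>Connects the recursive form, which suits induction on the top member, with the indexed
  chains in the definitions of \<open>module_length\<close> and \<open>krull_dim\<close>.\<close>

lemma chain_to_iff:
  "chain_to P n T \<longleftrightarrow> (\<exists>N :: nat \<Rightarrow> 's set. (\<forall>i\<le>n. P (N i)) \<and> (\<forall>i<n. N i \<subset> N (Suc i)) \<and> N n = T)"
proof
  assume "chain_to P n T"
  then show "\<exists>N. (\<forall>i\<le>n. P (N i)) \<and> (\<forall>i<n. N i \<subset> N (Suc i)) \<and> N n = T"
  proof (induction rule: chain_to.induct)
    case (zero T) then show ?case by (intro exI[of _ "\<lambda>_. T"]) auto
  next
    case (Suc n T T')
    then obtain N where N: "\<forall>i\<le>n. P (N i)" "\<forall>i<n. N i \<subset> N (Suc i)" "N n = T" by blast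
    show ?case using N Suc
      by (intro exI[of _ "N(Suc n := T')"]) (auto simp: less_Suc_eq le_Suc_eq)
  qed
next
  assume "\<exists>N. (\<forall>i\<le>n. P (N i)) \<and> (\<forall>i<n. N i \<subset> N (Suc i)) \<and> N n = T"
  then obtain N where N: "\<forall>i\<le>n. P (N i)" "\<forall>i<n. N i \<subset> N (Suc i)" "N n = T" by blast
  have "k \<le> n \<Longrightarrow> chain_to P k (N k)" for k
  proof (induction k)
    case 0 then show ?case using N by (auto intro: chain_to.zero)
  next
    case (Suc k)
    then show ?case using N by (intro chain_to.Suc[of P k "N k"]) auto
  qed
  then show "chain_to P n T" using N by auto
qed

lemma chain_len_alt:
  "chain_len P = Sup {enat n | n. \<exists>N :: nat \<Rightarrow> 's set. (\<forall>i\<le>n. P (N i)) \<and> (\<forall>i<n. N i \<subset> N (Suc i))}"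
  unfolding chain_len_def chain_to_iff by auto

lemma chain_to_shorten: "chain_to P n T \<Longrightarrow> m \<le> n \<Longrightarrow> \<exists>T'. chain_to P m T'"
proof (induction rule: chain_to.induct)
  case (zero T) then show ?case by (auto intro: chain_to.zero)
next
  case (Suc n T T')
  then show ?case by (metis chain_to.Suc le_Suc_eq)
qed

text \<open>A supremum in \<open>enat\<close> may be infinite and then not attained, but every
  finite lower bound is realised by an actual chain, since longer chains can be shortened. The
  assumption that \<open>P\<close> has a member covers \<open>n = 0\<close>. Estimates of lengths
  thereby become statements about finite chains.\<close>

lemma enat_le_chain_len_iff:
  assumes "\<exists>T. P T"
  shows "enat n \<le> chain_len P \<longleftrightarrow> (\<exists>T. chain_to P n T)"
proof
  assume le: "enat n \<le> chain_len P"
  show "\<exists>T. chain_to P n T"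
  proof (cases n)
    case 0 then show ?thesis using assms by (auto intro: chain_to.zero)
  next
    case (Suc m)
    then have "enat m < chain_len P" using le by (metis Suc_ile_eq)
    then obtain k T where "enat m < enat k" "chain_to P k T"
      unfolding chain_len_def less_Sup_iff by auto
    then show ?thesis using Suc by (auto dest: chain_to_shorten[where m=n])
  qed
next
  assume "\<exists>T. chain_to P n T"
  then show "enat n \<le> chain_len P" unfolding chain_len_def by (auto intro: Sup_upper)
qed

lemma chain_to_map:
  assumes "chain_to P n T"
    and "\<And>N. P N \<Longrightarrow> P' (\<phi> N)"
    and "\<And>N N'. P N \<Longrightarrow> P N' \<Longrightarrow> N \<subset> N' \<Longrightarrow> \<phi> N \<subset> \<phi> N'"
  shows "chain_to P' n (\<phi> T)"
  using assms(1)
proof (induction rule: chain_to.induct)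
  case (zero T) then show ?case using assms by (auto intro: chain_to.zero)
next
  case (Suc n T T')
  have "P T" using Suc(1) by (rule chain_to_holds)
  from chain_to.Suc[of P' n "\<phi> T" "\<phi> T'", OF Suc(4) assms(3)[OF this Suc(3,2)] assms(2)[OF Suc(3)]]
  show ?case .
qed

lemma chain_len_mono_map:
  assumes "\<And>N. P N \<Longrightarrow> P' (\<phi> N)"
    and "\<And>N N'. P N \<Longrightarrow> P N' \<Longrightarrow> N \<subset> N' \<Longrightarrow> \<phi> N \<subset> \<phi> N'"
  shows "chain_len P \<le> chain_len P'"
  unfolding chain_len_def using chain_to_map[of P _ _ P' \<phi>, OF _ assms]
  by (intro Sup_subset_mono) blast

lemma chain_to_raise:
  assumes "chain_to P n T" "P T'" "T \<subseteq> T'"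
  shows "chain_to P n T'"
  using assms(1)
proof cases
  case zero then show ?thesis using assms by (auto intro: chain_to.zero)
next
  case (Suc m S) then show ?thesis using assms by (auto intro!: chain_to.Suc[of P m S])
qed

lemma enat_eqI: "(\<And>n. enat n \<le> a \<longleftrightarrow> enat n \<le> b) \<Longrightarrow> a = b"
  by (metis enat_ord_code(3) le_cases not_infinity_eq order_antisym linorder_not_less
      Suc_ile_eq enat_ord_simps(4))

text \<open>Reduces additivity of lengths, infinite ones included, to splitting and concatenating
  finite chains.\<close>

lemma enat_le_add_iff: "enat n \<le> a + b \<longleftrightarrow> (\<exists>i j. n = i + j \<and> enat i \<le> a \<and> enat j \<le> b)"
proof
  assume le: "enat n \<le> a + b"
  consider "a = \<infinity>" | "b = \<infinity>" | k l where "a = enat k" "b = enat l" by (cases a; cases b) auto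
  then show "\<exists>i j. n = i + j \<and> enat i \<le> a \<and> enat j \<le> b"
  proof cases
    case 1 then show ?thesis by (intro exI[of _ n] exI[of _ 0]) (auto simp: zero_enat_def[symmetric])
  next
    case 2 then show ?thesis by (intro exI[of _ 0] exI[of _ n]) (auto simp: zero_enat_def[symmetric])
  next
    case 3
    then have "n \<le> k + l" using le by simp
    then show ?thesis using 3 by (intro exI[of _ "min n k"] exI[of _ "n - min n k"]) auto
  qed
next
  show "\<exists>i j. n = i + j \<and> enat i \<le> a \<and> enat j \<le> b \<Longrightarrow> enat n \<le> a + b"
    by (metis add_mono plus_enat_simps(1))
qed

text \<open>The length of \<open>Z/B\<close>, formed inside \<open>M\<close> so that no coset types
  appear and both ends of the interval can vary.\<close>

definition rlen :: "('a, 'r) ring_scheme \<Rightarrow> ('a, 'b, 'm) module_scheme \<Rightarrow> 'b set \<Rightarrow> 'b set \<Rightarrow> enat"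
  where "rlen R M B Z = chain_len (\<lambda>N. submodule N R M \<and> B \<subseteq> N \<and> N \<subseteq> Z)"

lemma module_length_eq_chain_len: "module_length R M = chain_len (\<lambda>N. submodule N R M)"
  unfolding module_length_def chain_len_alt ..

context module
begin

lemma submodule_if_closed:
  assumes "H \<subseteq> carrier M" "\<zero>\<^bsub>M\<^esub> \<in> H"
    and "\<And>a b. a \<in> H \<Longrightarrow> b \<in> H \<Longrightarrow> a \<oplus>\<^bsub>M\<^esub> b \<in> H"
    and "\<And>a x. a \<in> carrier R \<Longrightarrow> x \<in> H \<Longrightarrow> a \<odot>\<^bsub>M\<^esub> x \<in> H"
  shows "submodule H R M"
proof (rule submoduleI)
  fix a assume "a \<in> H"
  then have "(\<ominus> \<one>) \<odot>\<^bsub>M\<^esub> a \<in> H" "a \<in> carrier M" using assms by auto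
  then show "\<ominus>\<^bsub>M\<^esub> a \<in> H" by (simp add: smult_l_minus)
qed (use assms in auto)

lemma submodule_carrier: "submodule L R M \<Longrightarrow> x \<in> L \<Longrightarrow> x \<in> carrier M"
  using submoduleE(1) by blast

lemma submodule_zero: "submodule L R M \<Longrightarrow> \<zero>\<^bsub>M\<^esub> \<in> L"
  using subgroup.one_closed[of L "add_monoid M"] submodule.axioms(1) by fastforce

lemma submodule_minus: "submodule L R M \<Longrightarrow> x \<in> L \<Longrightarrow> y \<in> L \<Longrightarrow> x \<ominus>\<^bsub>M\<^esub> y \<in> L"
  unfolding a_minus_def by (intro submoduleE(3,5))

lemmas submodule_simps = submodule_carrier submodule_zero submodule_minus
  submoduleE(3-5)

lemma zero_submodule: "submodule {\<zero>\<^bsub>M\<^esub>} R M"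
  by (rule submodule_if_closed) auto

lemma submodule_Int: "submodule K R M \<Longrightarrow> submodule L R M \<Longrightarrow> submodule (K \<inter> L) R M"
  by (rule submodule_if_closed) (auto intro: submodule_simps)

definition sum_sub :: "'c set \<Rightarrow> 'c set \<Rightarrow> 'c set" where
  "sum_sub K L = {x \<oplus>\<^bsub>M\<^esub> y | x y. x \<in> K \<and> y \<in> L}"

lemma sum_sub_submodule:
  assumes "submodule K R M" "submodule L R M"
  shows "submodule (sum_sub K L) R M"
proof (rule submodule_if_closed)
  note s = assms[THEN submodule_carrier] assms[THEN submoduleE(4)] assms[THEN submoduleE(5)]
  show "sum_sub K L \<subseteq> carrier M" using s unfolding sum_sub_def by auto
  show "\<zero>\<^bsub>M\<^esub> \<in> sum_sub K L" using assms[THEN submodule_zero] unfolding sum_sub_def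
    by (intro CollectI exI[of _ "\<zero>\<^bsub>M\<^esub>"]) auto
  fix a b assume "a \<in> sum_sub K L" "b \<in> sum_sub K L"
  then obtain x y x' y' where *: "x \<in> K" "y \<in> L" "x' \<in> K" "y' \<in> L" "a = x \<oplus>\<^bsub>M\<^esub> y" "b = x' \<oplus>\<^bsub>M\<^esub> y'"
    unfolding sum_sub_def by blast
  then have "a \<oplus>\<^bsub>M\<^esub> b = (x \<oplus>\<^bsub>M\<^esub> x') \<oplus>\<^bsub>M\<^esub> (y \<oplus>\<^bsub>M\<^esub> y')"
    using s by (simp add: M.a_ac)
  moreover have "x \<oplus>\<^bsub>M\<^esub> x' \<in> K" "y \<oplus>\<^bsub>M\<^esub> y' \<in> L" using * s by auto
  ultimately show "a \<oplus>\<^bsub>M\<^esub> b \<in> sum_sub K L" unfolding sum_sub_def by blast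
next
  note s = assms[THEN submodule_carrier] assms[THEN submoduleE(4)] assms[THEN submoduleE(5)]
  fix r a assume r: "r \<in> carrier R" "a \<in> sum_sub K L"
  then obtain x y where *: "x \<in> K" "y \<in> L" "a = x \<oplus>\<^bsub>M\<^esub> y"
    unfolding sum_sub_def by blast
  then have "r \<odot>\<^bsub>M\<^esub> a = r \<odot>\<^bsub>M\<^esub> x \<oplus>\<^bsub>M\<^esub> r \<odot>\<^bsub>M\<^esub> y"
    using s r by (simp add: smult_r_distr)
  moreover have "r \<odot>\<^bsub>M\<^esub> x \<in> K" "r \<odot>\<^bsub>M\<^esub> y \<in> L" using * s r by auto
  ultimately show "r \<odot>\<^bsub>M\<^esub> a \<in> sum_sub K L" unfolding sum_sub_def by blast
qed

lemma sum_sub_upper: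
  assumes "submodule K R M" "submodule L R M"
  shows "K \<subseteq> sum_sub K L" "L \<subseteq> sum_sub K L"
proof -
  note s = assms[THEN submodule_carrier] assms[THEN submodule_zero]
  show "K \<subseteq> sum_sub K L"
  proof
    fix x assume "x \<in> K"
    then show "x \<in> sum_sub K L" using s unfolding sum_sub_def
      by (intro CollectI exI[of _ x] exI[of _ "\<zero>\<^bsub>M\<^esub>"]) auto
  qed
  show "L \<subseteq> sum_sub K L"
  proof
    fix x assume "x \<in> L"
    then show "x \<in> sum_sub K L" using s unfolding sum_sub_def
      by (intro CollectI exI[of _ "\<zero>\<^bsub>M\<^esub>"] exI[of _ x]) auto
  qed
qed

lemma sum_sub_least:
  "submodule H R M \<Longrightarrow> K \<subseteq> H \<Longrightarrow> L \<subseteq> H \<Longrightarrow> sum_sub K L \<subseteq> H"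
  unfolding sum_sub_def by (auto intro: submoduleE(5))

lemma sum_sub_mono: "K \<subseteq> K' \<Longrightarrow> sum_sub K L \<subseteq> sum_sub K' L"
  unfolding sum_sub_def by blast

text \<open>The modular law: write \<open>x\<close> in \<open>L\<close> as the sum of
  \<open>k\<close> in \<open>K\<close> and \<open>y\<close> in \<open>Y\<close>; then
  \<open>y\<close>, the difference of \<open>x\<close> and \<open>k\<close>, lies in
  \<open>L \<inter> Y\<close>, hence in \<open>K\<close>. For chains it says that a proper inclusion
  stays proper after intersecting with \<open>Y\<close> or after adding \<open>Y\<close>.\<close>

lemma submodule_eq_if_Int_sum_eq:
  assumes "submodule K R M" "submodule L R M" "submodule Y R M" "K \<subseteq> L"
    and "K \<inter> Y = L \<inter> Y" "sum_sub K Y = sum_sub L Y"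
  shows "K = L"
proof (rule antisym[OF assms(4)], rule subsetI)
  fix x assume x: "x \<in> L"
  then have "x \<in> sum_sub K Y" using sum_sub_upper assms by blast
  then obtain k y where ky: "k \<in> K" "y \<in> Y" "x = k \<oplus>\<^bsub>M\<^esub> y" unfolding sum_sub_def by blast
  then have c: "k \<in> carrier M" "y \<in> carrier M" using assms submodule_carrier by blast+
  then have "y = x \<ominus>\<^bsub>M\<^esub> k" using ky(3) M.a_lcomm[of k y "\<ominus>\<^bsub>M\<^esub> k"]
    by (simp add: a_minus_def M.a_assoc M.r_neg)
  then have "y \<in> L" using submodule_minus[OF assms(2) x] ky assms(4) by blast
  then have "y \<in> K" using ky assms(5) by blast
  then show "x \<in> K" using ky submoduleE(5)[OF assms(1)] by blast
qed

lemma rlen_le_iff: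
  assumes "submodule B R M" "B \<subseteq> Z"
  shows "enat n \<le> rlen R M B Z \<longleftrightarrow> (\<exists>T. chain_to (\<lambda>N. submodule N R M \<and> B \<subseteq> N \<and> N \<subseteq> Z) n T)"
  unfolding rlen_def by (rule enat_le_chain_len_iff) (use assms in blast)

text \<open>A chain from \<open>B\<close> to \<open>Z\<close> is projected to the two intervals by
  intersecting with \<open>Y\<close> and by adding \<open>Y\<close>. No step is lost in both
  projections, so chains whose lengths add up to \<open>n\<close> can be extracted from them.
  Conversely, a chain below \<open>Y\<close> and one above \<open>Y\<close> are
  concatenated.\<close>

lemma rlen_additive:
  assumes B: "submodule B R M" and Y: "submodule Y R M" and Z: "submodule Z R M"
    and BY: "B \<subseteq> Y" and YZ: "Y \<subseteq> Z"
  shows "rlen R M B Z = rlen R M B Y + rlen R M Y Z"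
proof (rule enat_eqI)
  fix n
  let ?P = "\<lambda>B Z N. submodule N R M \<and> B \<subseteq> N \<and> N \<subseteq> Z"
  have BZ: "B \<subseteq> Z" using BY YZ by blast
  have down: "\<exists>i j. i + j = n \<and> chain_to (?P B Y) i (T \<inter> Y) \<and> chain_to (?P Y Z) j (sum_sub T Y)"
    if "chain_to (?P B Z) n T" for n T
    using that
  proof (induction rule: chain_to.induct)
    case (zero T)
    then have T: "submodule T R M" "B \<subseteq> T" "T \<subseteq> Z" by auto
    have "?P B Y (T \<inter> Y)" using T BY submodule_Int[OF T(1) Y] by blast
    moreover have "?P Y Z (sum_sub T Y)"
      using T YZ sum_sub_submodule[OF T(1) Y] sum_sub_upper[OF T(1) Y] sum_sub_least[OF Z T(3) YZ] by blast
    ultimately show ?case by (intro exI[of _ 0]) (auto intro: chain_to.zero)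
  next
    case (Suc n T T')
    then obtain i j where ij: "i + j = n" "chain_to (?P B Y) i (T \<inter> Y)"
      "chain_to (?P Y Z) j (sum_sub T Y)" by blast
    have T: "?P B Z T" using chain_to_holds[OF Suc(1)] .
    have P1: "?P B Y (T' \<inter> Y)" using Suc(2-3) BY Y submodule_Int[of T' Y] by blast
    have P2: "?P Y Z (sum_sub T' Y)" using Suc(3) Y Z YZ sum_sub_upper[of T' Y] sum_sub_submodule[of T' Y] sum_sub_least[of Z T' Y]
      by blast
    have le: "T \<inter> Y \<subseteq> T' \<inter> Y" "sum_sub T Y \<subseteq> sum_sub T' Y" using Suc sum_sub_mono[of T T'] by auto
    \<comment> \<open>The step is counted in one of the two chains; the other only has its top
      raised, even when it grows as well.\<close>
    have "T \<inter> Y \<subset> T' \<inter> Y \<or> sum_sub T Y \<subset> sum_sub T' Y"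
      using submodule_eq_if_Int_sum_eq[of T T' Y] T Suc Y le by blast
    then show ?case
    proof
      assume "T \<inter> Y \<subset> T' \<inter> Y"
      from chain_to.Suc[OF ij(2) this P1] chain_to_raise[OF ij(3) P2 le(2)] ij(1)
      show ?case by (intro exI[of _ "Suc i"] exI[of _ j]) auto
    next
      assume "sum_sub T Y \<subset> sum_sub T' Y"
      from chain_to.Suc[OF ij(3) this P2] chain_to_raise[OF ij(2) P1 le(1)] ij(1)
      show ?case by (intro exI[of _ i] exI[of _ "Suc j"]) auto
    qed
  qed
  have up: "chain_to (?P B Z) (i + j) T" if "chain_to (?P B Y) i S" "chain_to (?P Y Z) j T" for i j S T
  proof -
    have S: "chain_to (?P B Z) i S" using chain_to_map[OF that(1), of "?P B Z" "\<lambda>x. x"] YZ by auto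
    show ?thesis using that(2)
    proof (induction rule: chain_to.induct[consumes 1, case_names zero Suc])
      case (zero T)
      have "S \<subseteq> T" using zero chain_to_holds[OF that(1)] by auto
      then show ?case using zero BY chain_to_raise[OF S] by auto
    next
      case (Suc n T T')
      have "?P B Z T'" using Suc BY by blast
      with Suc show ?case using chain_to.Suc[of "?P B Z" "i + n" T T'] by simp
    qed
  qed
  show "enat n \<le> rlen R M B Z \<longleftrightarrow> enat n \<le> rlen R M B Y + rlen R M Y Z"
    unfolding enat_le_add_iff rlen_le_iff[OF B BZ] rlen_le_iff[OF B BY] rlen_le_iff[OF Y YZ]
    using up down by blast
qed

end

section \<open>Zero, small and finite lengths\<close>

lemma enat_le_if_not_Suc_le: "\<not> enat (Suc n) \<le> x \<Longrightarrow> x \<le> enat n"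
  by (cases x) auto

context module
begin

lemma submodule_iff:
  "submodule H R M \<longleftrightarrow> H \<subseteq> carrier M \<and> \<zero>\<^bsub>M\<^esub> \<in> H \<and> (\<forall>a\<in>H. \<forall>b\<in>H. a \<oplus>\<^bsub>M\<^esub> b \<in> H) \<and>
     (\<forall>a\<in>carrier R. \<forall>x\<in>H. a \<odot>\<^bsub>M\<^esub> x \<in> H)"
  using submodule_if_closed[of H] submoduleE[of H] submodule_zero[of H] by metis

lemma rlen_refl: 
  assumes "submodule B R M"
  shows "rlen R M B B = 0"
proof -
  have "\<not> enat (Suc 0) \<le> rlen R M B B"
  proof
    assume "enat (Suc 0) \<le> rlen R M B B"
    then obtain T where "chain_to (\<lambda>N. submodule N R M \<and> B \<subseteq> N \<and> N \<subseteq> B) (Suc 0) T"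
      using rlen_le_iff[OF assms order_refl] by auto
    then obtain T' where "chain_to (\<lambda>N. submodule N R M \<and> B \<subseteq> N \<and> N \<subseteq> B) 0 T'" "T' \<subset> T" "T \<subseteq> B"
      by cases auto
    then show False using chain_to_holds by blast
  qed
  from enat_le_if_not_Suc_le[OF this] show ?thesis by (simp add: zero_enat_def[symmetric])
qed

lemma rlen_eq_0_iff:
  assumes "submodule B R M" "submodule Z R M" "B \<subseteq> Z"
  shows "rlen R M B Z = 0 \<longleftrightarrow> B = Z"
proof
  assume 0: "rlen R M B Z = 0"
  show "B = Z"
  proof (rule ccontr)
    assume "B \<noteq> Z"
    then have "chain_to (\<lambda>N. submodule N R M \<and> B \<subseteq> N \<and> N \<subseteq> Z) (Suc 0) Z"
      using assms by (intro chain_to.Suc[of _ 0 B] chain_to.zero) auto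
    then have "enat 1 \<le> rlen R M B Z" using rlen_le_iff[OF assms(1,3)] by auto
    then show False using 0 by (simp add: zero_enat_def)
  qed
qed (use rlen_refl assms in auto)

definition cyclic :: "'c \<Rightarrow> 'c set" where
  "cyclic u = (\<lambda>a. a \<odot>\<^bsub>M\<^esub> u) ` carrier R"

lemma cyclic_submodule: "u \<in> carrier M \<Longrightarrow> submodule (cyclic u) R M"
proof (rule submodule_if_closed)
  assume u: "u \<in> carrier M"
  show "cyclic u \<subseteq> carrier M" using u unfolding cyclic_def by auto
  show "\<zero>\<^bsub>M\<^esub> \<in> cyclic u" using u unfolding cyclic_def by (intro image_eqI[of _ _ \<zero>]) auto
  show "a \<oplus>\<^bsub>M\<^esub> b \<in> cyclic u" if ab: "a \<in> cyclic u" "b \<in> cyclic u" for a b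
  proof -
    obtain c d where "c \<in> carrier R" "d \<in> carrier R" "a = c \<odot>\<^bsub>M\<^esub> u" "b = d \<odot>\<^bsub>M\<^esub> u"
      using ab unfolding cyclic_def by blast
    then show ?thesis using u unfolding cyclic_def
      by (intro image_eqI[of _ _ "c \<oplus> d"]) (auto simp: smult_l_distr)
  qed
  show "r \<odot>\<^bsub>M\<^esub> a \<in> cyclic u" if r: "r \<in> carrier R" "a \<in> cyclic u" for r a
  proof -
    obtain c where "c \<in> carrier R" "a = c \<odot>\<^bsub>M\<^esub> u" using r unfolding cyclic_def by blast
    then show ?thesis using u r unfolding cyclic_def
      by (intro image_eqI[of _ _ "r \<otimes> c"]) (auto simp: smult_assoc1)
  qed
qed

lemma cyclic_self: "u \<in> carrier M \<Longrightarrow> u \<in> cyclic u"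
  unfolding cyclic_def by (intro image_eqI[of _ _ \<one>]) auto

lemma cyclic_least: "submodule H R M \<Longrightarrow> u \<in> H \<Longrightarrow> cyclic u \<subseteq> H"
  unfolding cyclic_def by (auto intro: submoduleE(4))

text \<open>The quotient is generated by the class of \<open>u\<close>, which \<open>I\<close>
  kills, and scalars outside \<open>I\<close> are units; so the quotient is zero or simple.\<close>

lemma rlen_add_cyclic_le_1:
  assumes B: "submodule B R M" and u: "u \<in> carrier M"
    and unit: "\<And>a. a \<in> carrier R \<Longrightarrow> a \<notin> I \<Longrightarrow> a \<in> Units R"
    and kill: "\<And>a. a \<in> I \<Longrightarrow> a \<odot>\<^bsub>M\<^esub> u \<in> B"
  shows "rlen R M B (sum_sub B (cyclic u)) \<le> 1"
proof -
  let ?Z = "sum_sub B (cyclic u)"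
  let ?P = "\<lambda>N. submodule N R M \<and> B \<subseteq> N \<and> N \<subseteq> ?Z"
  note cs = cyclic_submodule[OF u]
  have BZ: "B \<subseteq> ?Z" using sum_sub_upper[OF B cs] by blast
  have top: "N = ?Z" if N: "?P N" "N \<noteq> B" for N
  proof -
    have Ns: "submodule N R M" using N by blast
    obtain v where v: "v \<in> N" "v \<notin> B" using N by blast
    then have "v \<in> ?Z" using N by blast
    then obtain b a where ba: "b \<in> B" "a \<in> carrier R" "v = b \<oplus>\<^bsub>M\<^esub> a \<odot>\<^bsub>M\<^esub> u"
      unfolding sum_sub_def cyclic_def by blast
    have "a \<notin> I" using kill[of a] v ba submoduleE(5)[OF B] by blast
    then have inv: "a \<in> Units R" using unit ba by blast
    have c: "b \<in> carrier M" "a \<odot>\<^bsub>M\<^esub> u \<in> carrier M" using submodule_carrier[OF B] ba u by auto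
    have "v \<ominus>\<^bsub>M\<^esub> b = a \<odot>\<^bsub>M\<^esub> u" using ba c M.a_lcomm[of b "a \<odot>\<^bsub>M\<^esub> u" "\<ominus>\<^bsub>M\<^esub> b"]
      by (simp add: a_minus_def M.a_assoc M.r_neg)
    then have "a \<odot>\<^bsub>M\<^esub> u \<in> N" using submodule_minus[OF Ns v(1), of b] ba N by auto
    then have "(inv a) \<odot>\<^bsub>M\<^esub> (a \<odot>\<^bsub>M\<^esub> u) \<in> N" using submoduleE(4)[OF Ns] inv by auto
    then have "u \<in> N" using inv u ba smult_assoc1[of "inv a" a u] by auto
    then have "?Z \<subseteq> N" using cyclic_least[OF Ns] N by (intro sum_sub_least[OF Ns]) auto
    then show ?thesis using N by blast
  qed
  have "\<not> enat (Suc 1) \<le> rlen R M B ?Z"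
  proof
    assume "enat (Suc 1) \<le> rlen R M B ?Z"
    then obtain T where "chain_to ?P (Suc (Suc 0)) T"
      using rlen_le_iff[OF B BZ] by auto
    then obtain T' where T: "chain_to ?P (Suc 0) T'" "T' \<subset> T" "?P T" by (cases) auto
    then obtain T'' where T': "chain_to ?P 0 T''" "T'' \<subset> T'" "?P T'" by (cases) auto
    have "?P T''" using chain_to_holds[OF T'(1)] .
    then have "T' \<noteq> B" using T' by blast
    then have "T' = ?Z" using top T' by blast
    then show False using T by blast
  qed
  from enat_le_if_not_Suc_le[OF this] show ?thesis by (simp add: one_enat_def)
qed

lemma rlen_mono:
  assumes "submodule B R M" "submodule Y R M" "submodule Z R M" "B \<subseteq> Y" "Y \<subseteq> Z"
  shows "rlen R M B Y \<le> rlen R M B Z"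
  using rlen_additive[OF assms] by simp

text \<open>Generators are adjoined one at a time, and each raises the length by at most
  one.\<close>

lemma finite_rlen_cover:
  assumes "finite S" "S \<subseteq> carrier M" and B: "submodule B R M"
    and unit: "\<And>a. a \<in> carrier R \<Longrightarrow> a \<notin> I \<Longrightarrow> a \<in> Units R"
    and kill: "\<And>a u. a \<in> I \<Longrightarrow> u \<in> S \<Longrightarrow> a \<odot>\<^bsub>M\<^esub> u \<in> B"
  shows "\<exists>Z. submodule Z R M \<and> B \<subseteq> Z \<and> S \<subseteq> Z \<and> rlen R M B Z \<noteq> \<infinity>"
  using assms(1,2,5)
proof (induction S)
  case empty
  then show ?case using B rlen_refl[OF B] by (intro exI[of _ B]) auto
next
  case (insert u S)
  then obtain Z where Z: "submodule Z R M" "B \<subseteq> Z" "S \<subseteq> Z" "rlen R M B Z \<noteq> \<infinity>" by auto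
  have u: "u \<in> carrier M" using insert by auto
  let ?Z = "sum_sub Z (cyclic u)"
  have "rlen R M Z ?Z \<le> 1" using rlen_add_cyclic_le_1[OF Z(1) u unit] insert Z by blast
  then have fin: "rlen R M Z ?Z \<noteq> \<infinity>" by (auto simp: one_enat_def dest: enat_ile)
  have Zs: "submodule ?Z R M" "Z \<subseteq> ?Z" "cyclic u \<subseteq> ?Z"
    using sum_sub_submodule[OF Z(1) cyclic_submodule[OF u]] sum_sub_upper[OF Z(1) cyclic_submodule[OF u]] by auto
  have "rlen R M B ?Z \<noteq> \<infinity>" using rlen_additive[OF B Z(1) Zs(1) Z(2) Zs(2)] Z(4) fin by auto
  then show ?case using Zs Z cyclic_self[OF u] by (intro exI[of _ ?Z]) auto
qed

lemma span_submodule: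
  assumes "S \<subseteq> carrier M"
  shows "submodule (submodule_span R M S) R M"
proof (rule submodule_if_closed)
  show "submodule_span R M S \<subseteq> carrier M" unfolding submodule_span_def
    using carrier_is_submodule assms by blast
qed (auto simp: submodule_span_def intro: submodule_simps)

lemma span_upper: "S \<subseteq> submodule_span R M S"
  unfolding submodule_span_def by blast

lemma span_least: "submodule H R M \<Longrightarrow> S \<subseteq> H \<Longrightarrow> submodule_span R M S \<subseteq> H"
  unfolding submodule_span_def by blast

definition noeth :: bool where
  "noeth \<longleftrightarrow> (\<forall>K. submodule K R M \<longrightarrow> (\<exists>S. finite S \<and> S \<subseteq> K \<and> submodule_span R M S = K))"

text \<open>Applied to socles, which the maximal ideal kills, this makes the types finite.\<close>

lemma noeth_rlen_finite:
  assumes "noeth" and B: "submodule B R M" "submodule Z R M" "B \<subseteq> Z"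
    and unit: "\<And>a. a \<in> carrier R \<Longrightarrow> a \<notin> I \<Longrightarrow> a \<in> Units R"
    and kill: "\<And>a u. a \<in> I \<Longrightarrow> u \<in> Z \<Longrightarrow> a \<odot>\<^bsub>M\<^esub> u \<in> B"
  shows "rlen R M B Z \<noteq> \<infinity>"
proof -
  obtain S where S: "finite S" "S \<subseteq> Z" "submodule_span R M S = Z" using assms(1) B(2) unfolding noeth_def by blast
  have "S \<subseteq> carrier M" using S B submodule_carrier by blast
  moreover have "a \<odot>\<^bsub>M\<^esub> u \<in> B" if "a \<in> I" "u \<in> S" for a u using kill[OF that(1)] that(2) S(2) by auto
  ultimately have "\<exists>Z'. submodule Z' R M \<and> B \<subseteq> Z' \<and> S \<subseteq> Z' \<and> rlen R M B Z' \<noteq> \<infinity>"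
    by (intro finite_rlen_cover[OF S(1) _ B(1), of I] unit)
  then obtain Z' where Z': "submodule Z' R M" "B \<subseteq> Z'" "S \<subseteq> Z'" "rlen R M B Z' \<noteq> \<infinity>" by blast
  have "Z \<subseteq> Z'" using span_least[OF Z'(1,3)] S by blast
  then show ?thesis using rlen_mono[OF B(1,2) Z'(1) B(3)] Z'(4) by (auto dest: enat_ile)
qed

end

text \<open>The relation \<open>P\<close> plays the part of an isomorphism between the quotients of
  the two intervals: it is total on both sides, additive, and by the last assumption matches
  \<open>B1\<close> with \<open>B2\<close>. A relation is used because connecting maps and
  evaluation maps involve choices that are unique only up to the lower ends. Submodules are
  transported by taking images under \<open>P\<close>.\<close>

lemma rlen_rel_le:
  assumes M1: "module R M1" and M2: "module R M2"
    and sub: "submodule B1 R M1" "submodule Z1 R M1" "submodule B2 R M2" "submodule Z2 R M2" "B2 \<subseteq> Z2"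
    and dom: "\<And>x y. P x y \<Longrightarrow> x \<in> Z1 \<and> y \<in> Z2"
    and add: "\<And>x y x' y'. P x y \<Longrightarrow> P x' y' \<Longrightarrow> P (x \<oplus>\<^bsub>M1\<^esub> x') (y \<oplus>\<^bsub>M2\<^esub> y')"
    and smult: "\<And>a x y. a \<in> carrier R \<Longrightarrow> P x y \<Longrightarrow> P (a \<odot>\<^bsub>M1\<^esub> x) (a \<odot>\<^bsub>M2\<^esub> y)"
    and left: "\<And>x. x \<in> Z1 \<Longrightarrow> \<exists>y. P x y" and right: "\<And>y. y \<in> Z2 \<Longrightarrow> \<exists>x. P x y"
    and B: "\<And>x y. P x y \<Longrightarrow> x \<in> B1 \<longleftrightarrow> y \<in> B2"
  shows "rlen R M1 B1 Z1 \<le> rlen R M2 B2 Z2"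
proof -
  interpret M1: module R M1 by (rule M1)
  interpret M2: module R M2 by (rule M2)
  \<comment> \<open>Any partner of zero is scaled by the zero scalar.\<close>
  have zero: "P \<zero>\<^bsub>M1\<^esub> \<zero>\<^bsub>M2\<^esub>"
  proof -
    obtain y where y: "P \<zero>\<^bsub>M1\<^esub> y" using left M1.submodule_zero[OF sub(2)] by blast
    then have "y \<in> carrier M2" using dom M2.submodule_carrier[OF sub(4)] by blast
    then show ?thesis using smult[OF M1.R.zero_closed y] by simp
  qed
  define \<phi> where "\<phi> N = {y. \<exists>x\<in>N. P x y}" for N
  show ?thesis unfolding rlen_def
  proof (rule chain_len_mono_map[where \<phi> = \<phi>])
    fix N assume N: "submodule N R M1 \<and> B1 \<subseteq> N \<and> N \<subseteq> Z1"
    have "submodule (\<phi> N) R M2"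
    proof (rule M2.submodule_if_closed)
      show "\<phi> N \<subseteq> carrier M2" using dom M2.submodule_carrier[OF sub(4)] unfolding \<phi>_def by blast
      show "\<zero>\<^bsub>M2\<^esub> \<in> \<phi> N" using zero N M1.submodule_zero unfolding \<phi>_def by blast
      show "a \<oplus>\<^bsub>M2\<^esub> b \<in> \<phi> N" if "a \<in> \<phi> N" "b \<in> \<phi> N" for a b
      proof -
        from that obtain x y where "x \<in> N" "y \<in> N" "P x a" "P y b" unfolding \<phi>_def by blast
        then show ?thesis using add[of x a y b] N M1.submoduleE(5) unfolding \<phi>_def by blast
      qed
      show "r \<odot>\<^bsub>M2\<^esub> a \<in> \<phi> N" if "r \<in> carrier R" "a \<in> \<phi> N" for r a
      proof -
        from that obtain x where "x \<in> N" "P x a" unfolding \<phi>_def by blast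
        then show ?thesis using smult[of r x a] that N M1.submoduleE(4) unfolding \<phi>_def by blast
      qed
    qed
    moreover have "B2 \<subseteq> \<phi> N" using right sub(5) B N unfolding \<phi>_def by blast
    moreover have "\<phi> N \<subseteq> Z2" using dom unfolding \<phi>_def by blast
    ultimately show "submodule (\<phi> N) R M2 \<and> B2 \<subseteq> \<phi> N \<and> \<phi> N \<subseteq> Z2" by blast
  next
    fix N N' assume N: "submodule N R M1 \<and> B1 \<subseteq> N \<and> N \<subseteq> Z1" "submodule N' R M1 \<and> B1 \<subseteq> N' \<and> N' \<subseteq> Z1" "N \<subset> N'"
    then obtain z where z: "z \<in> N'" "z \<notin> N" by blast
    then have "z \<in> Z1" using N by blast
    then obtain w where w: "P z w" using left[of z] by auto
    have "w \<notin> \<phi> N"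
    proof
      assume "w \<in> \<phi> N"
      then obtain x where x: "x \<in> N" "P x w" unfolding \<phi>_def by blast
      have c: "x \<in> carrier M1" "z \<in> carrier M1" "w \<in> carrier M2"
        using dom[OF x(2)] dom[OF w] M1.submodule_carrier[OF sub(2)] M2.submodule_carrier[OF sub(4)] by auto
      \<comment> \<open>Subtraction is expressed through the scalar minus one, because
        \<open>P\<close> is closed under sums and scalar multiples.\<close>
      have "P (z \<oplus>\<^bsub>M1\<^esub> (\<ominus>\<^bsub>R\<^esub> \<one>\<^bsub>R\<^esub>) \<odot>\<^bsub>M1\<^esub> x) (w \<oplus>\<^bsub>M2\<^esub> (\<ominus>\<^bsub>R\<^esub> \<one>\<^bsub>R\<^esub>) \<odot>\<^bsub>M2\<^esub> w)"
        using add[OF w smult[OF _ x(2)]] by simp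
      then have "P (z \<ominus>\<^bsub>M1\<^esub> x) \<zero>\<^bsub>M2\<^esub>"
        using c by (simp add: M1.smult_l_minus M2.smult_l_minus a_minus_def M2.M.r_neg)
      then have "z \<ominus>\<^bsub>M1\<^esub> x \<in> B1" using B[of "z \<ominus>\<^bsub>M1\<^esub> x" "\<zero>\<^bsub>M2\<^esub>"] M2.submodule_zero[OF sub(3)] by simp
      then have "z \<ominus>\<^bsub>M1\<^esub> x \<in> N" using N by blast
      then have "(z \<ominus>\<^bsub>M1\<^esub> x) \<oplus>\<^bsub>M1\<^esub> x \<in> N" using x N M1.submoduleE(5) by blast
      then show False using z c by (simp add: a_minus_def M1.M.a_assoc M1.M.l_neg)
    qed
    moreover have "w \<in> \<phi> N'" using z w unfolding \<phi>_def by blast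
    moreover have "\<phi> N \<subseteq> \<phi> N'" using N unfolding \<phi>_def by blast
    ultimately show "\<phi> N \<subset> \<phi> N'" by blast
  qed
qed

lemma rlen_rel_eq:
  assumes M1: "module R M1" and M2: "module R M2"
    and sub: "submodule B1 R M1" "submodule Z1 R M1" "B1 \<subseteq> Z1" "submodule B2 R M2" "submodule Z2 R M2" "B2 \<subseteq> Z2"
    and dom: "\<And>x y. P x y \<Longrightarrow> x \<in> Z1 \<and> y \<in> Z2"
    and add: "\<And>x y x' y'. P x y \<Longrightarrow> P x' y' \<Longrightarrow> P (x \<oplus>\<^bsub>M1\<^esub> x') (y \<oplus>\<^bsub>M2\<^esub> y')"
    and smult: "\<And>a x y. a \<in> carrier R \<Longrightarrow> P x y \<Longrightarrow> P (a \<odot>\<^bsub>M1\<^esub> x) (a \<odot>\<^bsub>M2\<^esub> y)"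
    and left: "\<And>x. x \<in> Z1 \<Longrightarrow> \<exists>y. P x y" and right: "\<And>y. y \<in> Z2 \<Longrightarrow> \<exists>x. P x y"
    and B: "\<And>x y. P x y \<Longrightarrow> x \<in> B1 \<longleftrightarrow> y \<in> B2"
  shows "rlen R M1 B1 Z1 = rlen R M2 B2 Z2"
proof (rule antisym)
  show "rlen R M1 B1 Z1 \<le> rlen R M2 B2 Z2"
    by (rule rlen_rel_le[of R M1 M2 B1 Z1 B2 Z2 P]; fact)
  show "rlen R M2 B2 Z2 \<le> rlen R M1 B1 Z1"
    by (rule rlen_rel_le[of R M2 M1 B2 Z2 B1 Z1 "\<lambda>y x. P x y"]) (use assms in auto)
qed

section \<open>Quotient modules\<close>

text \<open>The module axioms pass along a surjection \<open>\<phi>\<close> that is compatible with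
  a surjection \<open>h\<close> of scalars. With \<open>h\<close> the identity this serves
  \<open>quot_module\<close>; with \<open>h\<close> the projection to \<open>R Quot q\<close> it
  serves \<open>reduced_module\<close>.\<close>

lemma module_image:
  assumes M: "module R M" and R': "cring R'"
    and h: "h ` carrier R = carrier R'"
    and h_add: "\<And>a b. a \<in> carrier R \<Longrightarrow> b \<in> carrier R \<Longrightarrow> h a \<oplus>\<^bsub>R'\<^esub> h b = h (a \<oplus>\<^bsub>R\<^esub> b)"
    and h_mult: "\<And>a b. a \<in> carrier R \<Longrightarrow> b \<in> carrier R \<Longrightarrow> h a \<otimes>\<^bsub>R'\<^esub> h b = h (a \<otimes>\<^bsub>R\<^esub> b)"
    and h_one: "h \<one>\<^bsub>R\<^esub> = \<one>\<^bsub>R'\<^esub>"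
    and \<phi>: "\<phi> ` carrier M = carrier Q"
    and \<phi>_add: "\<And>x y. x \<in> carrier M \<Longrightarrow> y \<in> carrier M \<Longrightarrow> \<phi> x \<oplus>\<^bsub>Q\<^esub> \<phi> y = \<phi> (x \<oplus>\<^bsub>M\<^esub> y)"
    and \<phi>_zero: "\<phi> \<zero>\<^bsub>M\<^esub> = \<zero>\<^bsub>Q\<^esub>"
    and \<phi>_smult: "\<And>a x. a \<in> carrier R \<Longrightarrow> x \<in> carrier M \<Longrightarrow> h a \<odot>\<^bsub>Q\<^esub> \<phi> x = \<phi> (a \<odot>\<^bsub>M\<^esub> x)"
  shows "module R' Q"
proof -
  interpret module R M by (rule M)
  have \<phi>c: "x \<in> carrier M \<Longrightarrow> \<phi> x \<in> carrier Q" for x using \<phi> by blast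
  show ?thesis
  proof (rule moduleI[OF R' abelian_groupI])
    show "\<zero>\<^bsub>Q\<^esub> \<in> carrier Q" using \<phi>c \<phi>_zero by (metis M.zero_closed)
    show "x \<oplus>\<^bsub>Q\<^esub> y \<in> carrier Q" if "x \<in> carrier Q" "y \<in> carrier Q" for x y
      using that unfolding \<phi>[symmetric] h[symmetric] by (auto simp: \<phi>_add \<phi>c)
    show "x \<oplus>\<^bsub>Q\<^esub> y = y \<oplus>\<^bsub>Q\<^esub> x" if "x \<in> carrier Q" "y \<in> carrier Q" for x y
      using that unfolding \<phi>[symmetric] h[symmetric] by (auto simp: \<phi>_add \<phi>c M.a_comm)
    show "x \<oplus>\<^bsub>Q\<^esub> y \<oplus>\<^bsub>Q\<^esub> z = x \<oplus>\<^bsub>Q\<^esub> (y \<oplus>\<^bsub>Q\<^esub> z)" if "x \<in> carrier Q" "y \<in> carrier Q" "z \<in> carrier Q" for x y z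
      using that unfolding \<phi>[symmetric] h[symmetric] by (auto simp: \<phi>_add \<phi>c M.a_assoc)
    show "\<zero>\<^bsub>Q\<^esub> \<oplus>\<^bsub>Q\<^esub> x = x" if "x \<in> carrier Q" for x
      using that unfolding \<phi>[symmetric] h[symmetric] by (auto simp: \<phi>_add \<phi>_zero[symmetric])
    show "\<exists>y\<in>carrier Q. y \<oplus>\<^bsub>Q\<^esub> x = \<zero>\<^bsub>Q\<^esub>" if "x \<in> carrier Q" for x
      proof -
      from that obtain x' where x': "x' \<in> carrier M" "x = \<phi> x'" using \<phi> by blast
      then have "\<phi> (\<ominus>\<^bsub>M\<^esub> x') \<oplus>\<^bsub>Q\<^esub> x = \<zero>\<^bsub>Q\<^esub>" by (simp add: \<phi>_add \<phi>_zero M.l_neg)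
      then show ?thesis using \<phi> x' by blast
    qed
    show "a \<odot>\<^bsub>Q\<^esub> x \<in> carrier Q" if "a \<in> carrier R'" "x \<in> carrier Q" for a x
      using that unfolding \<phi>[symmetric] h[symmetric] by (auto simp: \<phi>_smult \<phi>c)
    show "(a \<oplus>\<^bsub>R'\<^esub> b) \<odot>\<^bsub>Q\<^esub> x = a \<odot>\<^bsub>Q\<^esub> x \<oplus>\<^bsub>Q\<^esub> b \<odot>\<^bsub>Q\<^esub> x" if "a \<in> carrier R'" "b \<in> carrier R'" "x \<in> carrier Q" for a b x
      using that unfolding \<phi>[symmetric] h[symmetric] by (auto simp: \<phi>_smult \<phi>_add h_add smult_l_distr)
    show "a \<odot>\<^bsub>Q\<^esub> (x \<oplus>\<^bsub>Q\<^esub> y) = a \<odot>\<^bsub>Q\<^esub> x \<oplus>\<^bsub>Q\<^esub> a \<odot>\<^bsub>Q\<^esub> y" if "a \<in> carrier R'" "x \<in> carrier Q" "y \<in> carrier Q" for a x y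
      using that unfolding \<phi>[symmetric] h[symmetric] by (auto simp: \<phi>_smult \<phi>_add smult_r_distr)
    show "(a \<otimes>\<^bsub>R'\<^esub> b) \<odot>\<^bsub>Q\<^esub> x = a \<odot>\<^bsub>Q\<^esub> (b \<odot>\<^bsub>Q\<^esub> x)" if "a \<in> carrier R'" "b \<in> carrier R'" "x \<in> carrier Q" for a b x
      using that unfolding \<phi>[symmetric] h[symmetric] by (auto simp: \<phi>_smult h_mult smult_assoc1)
    show "\<one>\<^bsub>R'\<^esub> \<odot>\<^bsub>Q\<^esub> x = x" if "x \<in> carrier Q" for x
      using that unfolding \<phi>[symmetric] h[symmetric] by (auto simp: \<phi>_smult h_one[symmetric])
  qed
qed

context module
begin

lemma submodule_abelian_subgroup: "submodule N R M \<Longrightarrow> abelian_subgroup N M"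
  by (intro abelian_subgroupI3 additive_subgroup.intro submodule.axioms(1) M.abelian_group_axioms)

lemma minus_zero_right [simp]: "x \<in> carrier M \<Longrightarrow> x \<ominus>\<^bsub>M\<^esub> \<zero>\<^bsub>M\<^esub> = x"
  using M.l_neg[of "\<zero>\<^bsub>M\<^esub>"] by (simp add: a_minus_def)

lemma coset_eq_iff:
  assumes "submodule N R M" "x \<in> carrier M" "y \<in> carrier M"
  shows "N +>\<^bsub>M\<^esub> x = N +>\<^bsub>M\<^esub> y \<longleftrightarrow> x \<ominus>\<^bsub>M\<^esub> y \<in> N"
proof -
  interpret abelian_subgroup N M using assms by (intro submodule_abelian_subgroup)
  have "x \<ominus>\<^bsub>M\<^esub> y \<in> N \<longleftrightarrow> x \<in> N +>\<^bsub>M\<^esub> y" using a_rcos_module[of y x] assms by (simp add: a_minus_def)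
  also have "\<dots> \<longleftrightarrow> N +>\<^bsub>M\<^esub> x = N +>\<^bsub>M\<^esub> y"
    using assms a_repr_independence'[of x y] a_rcos_self[of x] by auto
  finally show ?thesis ..
qed

lemma mem_coset_iff:
  assumes "submodule N R M" "x \<in> carrier M" "y \<in> carrier M"
  shows "x \<in> N +>\<^bsub>M\<^esub> y \<longleftrightarrow> x \<ominus>\<^bsub>M\<^esub> y \<in> N"
proof -
  interpret abelian_subgroup N M using assms by (intro submodule_abelian_subgroup)
  show ?thesis using a_rcos_module[of y x] assms by (simp add: a_minus_def)
qed

lemma coset_eq_self_iff:
  assumes "submodule N R M" "x \<in> carrier M"
  shows "N +>\<^bsub>M\<^esub> x = N \<longleftrightarrow> x \<in> N"
proof -
  have "N +>\<^bsub>M\<^esub> \<zero>\<^bsub>M\<^esub> = N" using assms by (simp add: submoduleE(1))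
  then show ?thesis using coset_eq_iff[OF assms, of "\<zero>\<^bsub>M\<^esub>"] assms by simp
qed

lemma coset_mem_carrier:
  assumes "submodule N R M" "x \<in> carrier M" "z \<in> N +>\<^bsub>M\<^esub> x"
  shows "z \<in> carrier M"
  using assms M.a_r_coset_subset_G submoduleE(1) by blast

text \<open>All cosets in the union coincide, since the members of the coset of \<open>x\<close>
  differ from \<open>x\<close> by elements of \<open>N\<close>. This evaluates the scalar
  multiplication of \<open>quot_module\<close> on representatives.\<close>

lemma coset_smult:
  assumes N: "submodule N R M" and x: "x \<in> carrier M" and a: "a \<in> carrier R"
  shows "(\<Union>z\<in>N +>\<^bsub>M\<^esub> x. N +>\<^bsub>M\<^esub> (a \<odot>\<^bsub>M\<^esub> z)) = N +>\<^bsub>M\<^esub> (a \<odot>\<^bsub>M\<^esub> x)"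
proof -
  interpret S: abelian_subgroup N M using N by (intro submodule_abelian_subgroup)
  have "N +>\<^bsub>M\<^esub> (a \<odot>\<^bsub>M\<^esub> z) = N +>\<^bsub>M\<^esub> (a \<odot>\<^bsub>M\<^esub> x)" if z: "z \<in> N +>\<^bsub>M\<^esub> x" for z
  proof -
    have zc: "z \<in> carrier M" using coset_mem_carrier[OF N x z] .
    have "z \<ominus>\<^bsub>M\<^esub> x \<in> N" using mem_coset_iff[OF N zc x] z by blast
    then have "a \<odot>\<^bsub>M\<^esub> (z \<ominus>\<^bsub>M\<^esub> x) \<in> N" using submoduleE(4)[OF N a] by blast
    then show ?thesis using coset_eq_iff[OF N, of "a \<odot>\<^bsub>M\<^esub> z" "a \<odot>\<^bsub>M\<^esub> x"] a zc x
      by (simp add: a_minus_def smult_r_distr smult_r_minus)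
  qed
  moreover have "x \<in> N +>\<^bsub>M\<^esub> x" using S.a_rcos_self[OF x] .
  ultimately show ?thesis by blast
qed

lemma quot_module_simps:
  assumes N: "submodule N R M"
  shows "carrier (quot_module M N) = (\<lambda>x. N +>\<^bsub>M\<^esub> x) ` carrier M"
    and "\<zero>\<^bsub>quot_module M N\<^esub> = N"
    and "x \<in> carrier M \<Longrightarrow> y \<in> carrier M \<Longrightarrow>
      (N +>\<^bsub>M\<^esub> x) \<oplus>\<^bsub>quot_module M N\<^esub> (N +>\<^bsub>M\<^esub> y) = N +>\<^bsub>M\<^esub> (x \<oplus>\<^bsub>M\<^esub> y)"
    and "a \<in> carrier R \<Longrightarrow> x \<in> carrier M \<Longrightarrow>
      a \<odot>\<^bsub>quot_module M N\<^esub> (N +>\<^bsub>M\<^esub> x) = N +>\<^bsub>M\<^esub> (a \<odot>\<^bsub>M\<^esub> x)"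
proof -
  interpret S: abelian_subgroup N M using N by (intro submodule_abelian_subgroup)
  show "carrier (quot_module M N) = (\<lambda>x. N +>\<^bsub>M\<^esub> x) ` carrier M"
    unfolding quot_module_def A_RCOSETS_def RCOSETS_def a_r_coset_def by auto
  show "\<zero>\<^bsub>quot_module M N\<^esub> = N" by (simp add: quot_module_def)
  show "x \<in> carrier M \<Longrightarrow> y \<in> carrier M \<Longrightarrow>
      (N +>\<^bsub>M\<^esub> x) \<oplus>\<^bsub>quot_module M N\<^esub> (N +>\<^bsub>M\<^esub> y) = N +>\<^bsub>M\<^esub> (x \<oplus>\<^bsub>M\<^esub> y)"
    by (simp add: quot_module_def S.a_rcos_sum)
  show "a \<in> carrier R \<Longrightarrow> x \<in> carrier M \<Longrightarrow>
      a \<odot>\<^bsub>quot_module M N\<^esub> (N +>\<^bsub>M\<^esub> x) = N +>\<^bsub>M\<^esub> (a \<odot>\<^bsub>M\<^esub> x)"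
    by (simp add: quot_module_def coset_smult[OF N])
qed

lemma quot_module_module:
  assumes N: "submodule N R M"
  shows "module R (quot_module M N)"
proof (rule module_image[where h = "\<lambda>x. x" and \<phi> = "\<lambda>x. N +>\<^bsub>M\<^esub> x" and M = M and R = R])
  show "module R M" by (rule module_axioms)
  show "N +>\<^bsub>M\<^esub> \<zero>\<^bsub>M\<^esub> = \<zero>\<^bsub>quot_module M N\<^esub>"
    using coset_eq_self_iff[OF N, of "\<zero>\<^bsub>M\<^esub>"] submodule_zero[OF N] quot_module_simps[OF N] by simp
qed (use quot_module_simps[OF N] R.is_cring in auto)

lemma module_length_quot:
  assumes N: "submodule N R M"
  shows "module_length R (quot_module M N) = rlen R M N (carrier M)"
proof -
  let ?Q = "quot_module M N"
  interpret Q: module R ?Q by (rule quot_module_module[OF N])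
  note simps = quot_module_simps[OF N]
  have "module_length R ?Q = rlen R ?Q {\<zero>\<^bsub>?Q\<^esub>} (carrier ?Q)"
    unfolding module_length_eq_chain_len rlen_def
    by (rule arg_cong[of _ _ chain_len]) (auto simp: fun_eq_iff Q.submodule_zero Q.submodule_carrier)
  also have "\<dots> = rlen R M N (carrier M)"
  proof (rule rlen_rel_eq[of R ?Q M _ _ _ _ "\<lambda>T x. x \<in> carrier M \<and> T = N +>\<^bsub>M\<^esub> x"])
    show "N \<subseteq> carrier M" using submodule_carrier[OF N] by blast
    show "{\<zero>\<^bsub>?Q\<^esub>} \<subseteq> carrier ?Q" by auto
  qed (auto simp: simps coset_eq_self_iff[OF N] Q.module_axioms module_axioms N
      intro: Q.zero_submodule[unfolded simps] Q.carrier_is_submodule[unfolded simps] carrier_is_submodule)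
  finally show ?thesis .
qed

lemma submodule_restrict_iff:
  assumes "submodule Z R M" "H \<subseteq> Z"
  shows "submodule H R (M\<lparr>carrier := Z\<rparr>) \<longleftrightarrow> submodule H R M"
proof -
  interpret Z: module R "M\<lparr>carrier := Z\<rparr>"
    using submodule.submodule_is_module[OF assms(1) module_axioms] .
  show ?thesis unfolding submodule_iff Z.submodule_iff using assms submodule_carrier by auto
qed

text \<open>\<open>Ext_of_resolution\<close> has this shape: cocycles form a record with changed
  carrier, and coboundaries are divided out.\<close>

lemma module_length_subquot:
  assumes "submodule Z R M" "submodule B R M" "B \<subseteq> Z"
  shows "module_length R (quot_module (M\<lparr>carrier := Z\<rparr>) B) = rlen R M B Z"
proof -
  interpret Z: module R "M\<lparr>carrier := Z\<rparr>"
    using submodule.submodule_is_module[OF assms(1) module_axioms] .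
  have "submodule B R (M\<lparr>carrier := Z\<rparr>)" using submodule_restrict_iff assms by blast
  from Z.module_length_quot[OF this]
  have "module_length R (quot_module (M\<lparr>carrier := Z\<rparr>) B) = rlen R (M\<lparr>carrier := Z\<rparr>) B Z" by simp
  also have "\<dots> = rlen R M B Z" unfolding rlen_def
    by (rule arg_cong[of _ _ chain_len]) (auto simp: fun_eq_iff submodule_restrict_iff[OF assms(1)])
  finally show ?thesis .
qed

end

section \<open>Congruence modulo a submodule\<close>

definition cong_mod :: "('b, 'm) ring_scheme \<Rightarrow> 'b set \<Rightarrow> 'b \<Rightarrow> 'b \<Rightarrow> bool" where
  "cong_mod M L x y \<longleftrightarrow> x \<in> carrier M \<and> y \<in> carrier M \<and> x \<ominus>\<^bsub>M\<^esub> y \<in> L"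

context module
begin

lemma minus_add_minus:
  assumes "x \<in> carrier M" "y \<in> carrier M" "z \<in> carrier M"
  shows "(x \<ominus>\<^bsub>M\<^esub> y) \<oplus>\<^bsub>M\<^esub> (y \<ominus>\<^bsub>M\<^esub> z) = x \<ominus>\<^bsub>M\<^esub> z"
proof -
  have "(x \<ominus>\<^bsub>M\<^esub> y) \<oplus>\<^bsub>M\<^esub> (y \<ominus>\<^bsub>M\<^esub> z) = x \<oplus>\<^bsub>M\<^esub> (\<ominus>\<^bsub>M\<^esub> y \<oplus>\<^bsub>M\<^esub> (y \<oplus>\<^bsub>M\<^esub> \<ominus>\<^bsub>M\<^esub> z))"
    using assms by (simp add: a_minus_def M.a_assoc)
  also have "\<ominus>\<^bsub>M\<^esub> y \<oplus>\<^bsub>M\<^esub> (y \<oplus>\<^bsub>M\<^esub> \<ominus>\<^bsub>M\<^esub> z) = \<ominus>\<^bsub>M\<^esub> z"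
    using assms by (simp add: M.a_assoc[symmetric] M.l_neg)
  finally show ?thesis by (simp add: a_minus_def)
qed

lemma minus_swap:
  assumes "x \<in> carrier M" "y \<in> carrier M"
  shows "\<ominus>\<^bsub>M\<^esub> (x \<ominus>\<^bsub>M\<^esub> y) = y \<ominus>\<^bsub>M\<^esub> x"
  using assms by (simp add: a_minus_def M.minus_add M.a_comm)

lemma add_minus_add:
  assumes "x \<in> carrier M" "y \<in> carrier M" "z \<in> carrier M" "w \<in> carrier M"
  shows "(x \<oplus>\<^bsub>M\<^esub> z) \<ominus>\<^bsub>M\<^esub> (y \<oplus>\<^bsub>M\<^esub> w) = (x \<ominus>\<^bsub>M\<^esub> y) \<oplus>\<^bsub>M\<^esub> (z \<ominus>\<^bsub>M\<^esub> w)"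
  using assms by (simp add: a_minus_def M.minus_add M.a_ac)

lemma add_minus_cancel:
  assumes "x \<in> carrier M" "y \<in> carrier M"
  shows "(x \<oplus>\<^bsub>M\<^esub> y) \<ominus>\<^bsub>M\<^esub> y = x" "(x \<ominus>\<^bsub>M\<^esub> y) \<oplus>\<^bsub>M\<^esub> y = x"
  using assms by (simp_all add: a_minus_def M.a_assoc M.r_neg M.l_neg)

lemma smult_minus_distr:
  assumes "a \<in> carrier R" "x \<in> carrier M" "y \<in> carrier M"
  shows "a \<odot>\<^bsub>M\<^esub> (x \<ominus>\<^bsub>M\<^esub> y) = a \<odot>\<^bsub>M\<^esub> x \<ominus>\<^bsub>M\<^esub> a \<odot>\<^bsub>M\<^esub> y"
  using assms by (simp add: a_minus_def smult_r_distr smult_r_minus)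

lemma cong_mod_refl: "submodule L R M \<Longrightarrow> x \<in> carrier M \<Longrightarrow> cong_mod M L x x"
  by (simp add: cong_mod_def submodule_zero a_minus_def M.r_neg)

lemma cong_mod_sym: "submodule L R M \<Longrightarrow> cong_mod M L x y \<Longrightarrow> cong_mod M L y x"
  unfolding cong_mod_def using minus_swap[of x y] submoduleE(3)[of L] by metis

lemma cong_mod_trans:
  "submodule L R M \<Longrightarrow> cong_mod M L x y \<Longrightarrow> cong_mod M L y z \<Longrightarrow> cong_mod M L x z"
  unfolding cong_mod_def using minus_add_minus[of x y z] submoduleE(5)[of L] by metis

lemma cong_mod_add:
  assumes "submodule L R M" "cong_mod M L x y" "cong_mod M L z w"
  shows "cong_mod M L (x \<oplus>\<^bsub>M\<^esub> z) (y \<oplus>\<^bsub>M\<^esub> w)"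
  using assms add_minus_add[of x y z w] submoduleE(5)[OF assms(1)] unfolding cong_mod_def by auto

lemma cong_mod_smult:
  assumes "submodule L R M" "a \<in> carrier R" "cong_mod M L x y"
  shows "cong_mod M L (a \<odot>\<^bsub>M\<^esub> x) (a \<odot>\<^bsub>M\<^esub> y)"
  using assms smult_minus_distr[of a x y] submoduleE(4)[OF assms(1,2), of "x \<ominus>\<^bsub>M\<^esub> y"]
  unfolding cong_mod_def by auto

lemma cong_mod_mem:
  assumes "submodule L R M" "cong_mod M L x y"
  shows "x \<in> L \<longleftrightarrow> y \<in> L"
proof -
  have *: "y \<in> L \<Longrightarrow> x \<in> L" if "cong_mod M L x y" for x y
    using that add_minus_cancel(2)[of x y] submoduleE(5)[OF assms(1), of "x \<ominus>\<^bsub>M\<^esub> y" y]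
    unfolding cong_mod_def by auto
  show ?thesis using *[OF assms(2)] *[OF cong_mod_sym[OF assms]] by blast
qed

lemma cong_mod_zero: "x \<in> L \<Longrightarrow> submodule L R M \<Longrightarrow> cong_mod M L x \<zero>\<^bsub>M\<^esub>"
  using submodule_carrier[of L x] by (simp add: cong_mod_def)

lemma cong_mod_minus_left:
  assumes "submodule L R M" "x \<in> carrier M" "y \<in> carrier M" "z \<in> carrier M"
  shows "cong_mod M L (x \<ominus>\<^bsub>M\<^esub> y) z \<longleftrightarrow> cong_mod M L x (z \<oplus>\<^bsub>M\<^esub> y)"
proof -
  have "(x \<ominus>\<^bsub>M\<^esub> y) \<ominus>\<^bsub>M\<^esub> z = x \<ominus>\<^bsub>M\<^esub> (z \<oplus>\<^bsub>M\<^esub> y)"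
    using assms by (simp add: a_minus_def M.minus_add M.a_ac)
  then show ?thesis using assms unfolding cong_mod_def by simp
qed

text \<open>The submodule \<open>L + yM\<close>. Folding it along a list \<open>ys\<close> gives
  \<open>L + (ys)M\<close>, so that the successive quotients of a regular sequence are all described
  inside \<open>M\<close>.\<close>

definition add_mult :: "'a \<Rightarrow> 'c set \<Rightarrow> 'c set" where
  "add_mult y L = {x \<in> carrier M. \<exists>u\<in>carrier M. cong_mod M L x (y \<odot>\<^bsub>M\<^esub> u)}"

lemma add_mult_submodule:
  assumes L: "submodule L R M" and y: "y \<in> carrier R"
  shows "submodule (add_mult y L) R M"
proof (rule submodule_if_closed)
  show "add_mult y L \<subseteq> carrier M" by (auto simp: add_mult_def)
  show "\<zero>\<^bsub>M\<^esub> \<in> add_mult y L" using y L cong_mod_refl[OF L, of "\<zero>\<^bsub>M\<^esub>"]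
    by (auto simp: add_mult_def intro!: bexI[of _ "\<zero>\<^bsub>M\<^esub>"])
  show "a \<oplus>\<^bsub>M\<^esub> b \<in> add_mult y L" if a: "a \<in> add_mult y L" and b: "b \<in> add_mult y L" for a b
  proof -
    from a obtain u where u: "u \<in> carrier M" "cong_mod M L a (y \<odot>\<^bsub>M\<^esub> u)" by (auto simp: add_mult_def)
    from b obtain v where v: "v \<in> carrier M" "cong_mod M L b (y \<odot>\<^bsub>M\<^esub> v)" by (auto simp: add_mult_def)
    have "cong_mod M L (a \<oplus>\<^bsub>M\<^esub> b) (y \<odot>\<^bsub>M\<^esub> (u \<oplus>\<^bsub>M\<^esub> v))"
      using cong_mod_add[OF L u(2) v(2)] u v y by (simp add: smult_r_distr)
    then show ?thesis using u v a b by (auto simp: add_mult_def)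
  qed
  show "r \<odot>\<^bsub>M\<^esub> a \<in> add_mult y L" if r: "r \<in> carrier R" and a: "a \<in> add_mult y L" for r a
  proof -
    from a obtain u where u: "u \<in> carrier M" "cong_mod M L a (y \<odot>\<^bsub>M\<^esub> u)" by (auto simp: add_mult_def)
    have "r \<odot>\<^bsub>M\<^esub> (y \<odot>\<^bsub>M\<^esub> u) = y \<odot>\<^bsub>M\<^esub> (r \<odot>\<^bsub>M\<^esub> u)"
      using r y u by (simp add: smult_assoc1[symmetric] R.m_comm)
    then have "cong_mod M L (r \<odot>\<^bsub>M\<^esub> a) (y \<odot>\<^bsub>M\<^esub> (r \<odot>\<^bsub>M\<^esub> u))"
      using cong_mod_smult[OF L r u(2)] by simp
    then show ?thesis using u r a by (auto simp: add_mult_def)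
  qed
qed

lemma add_mult_upper:
  assumes "submodule L R M" "y \<in> carrier R"
  shows "L \<subseteq> add_mult y L"
proof
  fix x assume "x \<in> L"
  then have "x \<in> carrier M" "cong_mod M L x (y \<odot>\<^bsub>M\<^esub> \<zero>\<^bsub>M\<^esub>)"
    using assms submodule_carrier cong_mod_zero by auto
  then show "x \<in> add_mult y L" unfolding add_mult_def by blast
qed

lemma smult_mem_add_mult:
  assumes "submodule L R M" "y \<in> carrier R" "x \<in> carrier M"
  shows "y \<odot>\<^bsub>M\<^esub> x \<in> add_mult y L"
  using assms cong_mod_refl[OF assms(1), of "y \<odot>\<^bsub>M\<^esub> x"] unfolding add_mult_def by auto

lemma add_mult_least:
  assumes "submodule H R M" "L \<subseteq> H" "\<And>u. u \<in> carrier M \<Longrightarrow> y \<odot>\<^bsub>M\<^esub> u \<in> H"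
  shows "add_mult y L \<subseteq> H"
proof
  fix x assume "x \<in> add_mult y L"
  then obtain u where u: "x \<in> carrier M" "u \<in> carrier M" "cong_mod M L x (y \<odot>\<^bsub>M\<^esub> u)"
    by (auto simp: add_mult_def)
  then have "cong_mod M H x (y \<odot>\<^bsub>M\<^esub> u)" using assms(2) by (auto simp: cong_mod_def)
  then show "x \<in> H" using cong_mod_mem[OF assms(1)] assms(3)[OF u(2)] by blast
qed

definition regular_mod :: "'c set \<Rightarrow> 'a \<Rightarrow> bool" where
  "regular_mod L y \<longleftrightarrow> (\<forall>u\<in>carrier M. y \<odot>\<^bsub>M\<^esub> u \<in> L \<longrightarrow> u \<in> L)"

text \<open>Weak regularity does not ask for a nonzero final quotient, which keeps the notion stable
  under the inductions below; \<open>regular_sequence_iff\<close> adds that demand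
  separately.\<close>

primrec weakly_regular :: "'c set \<Rightarrow> 'a list \<Rightarrow> bool" where
  "weakly_regular L [] \<longleftrightarrow> True"
| "weakly_regular L (y # ys) \<longleftrightarrow> regular_mod L y \<and> weakly_regular (add_mult y L) ys"

end

lemma (in module) fold_add_mult_submodule:
  "set ys \<subseteq> carrier R \<Longrightarrow> submodule L R M \<Longrightarrow> submodule (fold add_mult ys L) R M"
  by (induction ys arbitrary: L) (auto intro: add_mult_submodule)

lemma linear_mapsD:
  assumes "f \<in> linear_maps R M N"
  shows "x \<in> carrier M \<Longrightarrow> f x \<in> carrier N"
    and "x \<in> carrier M \<Longrightarrow> y \<in> carrier M \<Longrightarrow> f (x \<oplus>\<^bsub>M\<^esub> y) = f x \<oplus>\<^bsub>N\<^esub> f y"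
    and "a \<in> carrier R \<Longrightarrow> x \<in> carrier M \<Longrightarrow> f (a \<odot>\<^bsub>M\<^esub> x) = a \<odot>\<^bsub>N\<^esub> f x"
  using assms unfolding linear_maps_def by auto

lemma linear_maps_zero:
  assumes "module R M" "module R N" "f \<in> linear_maps R M N"
  shows "f \<zero>\<^bsub>M\<^esub> = \<zero>\<^bsub>N\<^esub>"
proof -
  interpret M: module R M by fact
  interpret N: module R N by fact
  have "f \<zero>\<^bsub>M\<^esub> = f (\<zero>\<^bsub>R\<^esub> \<odot>\<^bsub>M\<^esub> \<zero>\<^bsub>M\<^esub>)" by simp
  also have "\<dots> = \<zero>\<^bsub>R\<^esub> \<odot>\<^bsub>N\<^esub> f \<zero>\<^bsub>M\<^esub>" using linear_mapsD(3)[OF assms(3), of "\<zero>\<^bsub>R\<^esub>" "\<zero>\<^bsub>M\<^esub>"] by simp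
  also have "\<dots> = \<zero>\<^bsub>N\<^esub>" using linear_mapsD(1)[OF assms(3)] by simp
  finally show ?thesis .
qed

lemma linear_maps_minus:
  assumes "module R M" "module R N" "f \<in> linear_maps R M N" "x \<in> carrier M" "y \<in> carrier M"
  shows "f (x \<ominus>\<^bsub>M\<^esub> y) = f x \<ominus>\<^bsub>N\<^esub> f y"
proof -
  interpret M: module R M by fact
  interpret N: module R N by fact
  have *: "x \<ominus>\<^bsub>M\<^esub> y = x \<oplus>\<^bsub>M\<^esub> (\<ominus>\<^bsub>R\<^esub> \<one>\<^bsub>R\<^esub>) \<odot>\<^bsub>M\<^esub> y" using assms by (simp add: M.smult_l_minus a_minus_def)
  show ?thesis unfolding *
    using assms linear_mapsD[OF assms(3)] by (simp add: N.smult_l_minus a_minus_def)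
qed

section \<open>Cochain complexes relative to a submodule\<close>

text \<open>
  \<^term>\<open>C i\<close> is the module of \<^term>\<open>N\<close>-valued cochains of degree \<^term>\<open>i\<close>, and \<^term>\<open>V i L\<close>
  consists of those with values in \<^term>\<open>L\<close>. The quotients \<open>Z i L / B i L\<close> then are the cohomology
  with values in \<open>N/L\<close>.
\<close>

locale cochains =
  fixes R (structure) and N :: "('a, 'b, 'm) module_scheme"
    and C :: "nat \<Rightarrow> ('a, 'c) module" and \<delta> :: "nat \<Rightarrow> 'c \<Rightarrow> 'c" and V :: "nat \<Rightarrow> 'b set \<Rightarrow> 'c set"
  assumes N: "module R N" and C: "\<And>i. module R (C i)"
    and \<delta>: "\<And>i. \<delta> i \<in> linear_maps R (C i) (C (Suc i))"
    and V: "\<And>i L. submodule L R N \<Longrightarrow> submodule (V i L) R (C i)"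
    and \<delta>_V: "\<And>i L f. submodule L R N \<Longrightarrow> f \<in> V i L \<Longrightarrow> \<delta> i f \<in> V (Suc i) L"
    and \<delta>\<delta>: "\<And>i L f. submodule L R N \<Longrightarrow> f \<in> carrier (C i) \<Longrightarrow> \<delta> (Suc i) (\<delta> i f) \<in> V (Suc (Suc i)) L"
    and V_add_mult: "\<And>i L y f. submodule L R N \<Longrightarrow> y \<in> carrier R \<Longrightarrow> f \<in> carrier (C i) \<Longrightarrow>
      f \<in> V i (module.add_mult N y L) \<longleftrightarrow> (\<exists>g\<in>carrier (C i). cong_mod (C i) (V i L) f (y \<odot>\<^bsub>C i\<^esub> g))"
    and V_regular: "\<And>i L y g. submodule L R N \<Longrightarrow> y \<in> carrier R \<Longrightarrow> module.regular_mod N L y \<Longrightarrow>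
      g \<in> carrier (C i) \<Longrightarrow> y \<odot>\<^bsub>C i\<^esub> g \<in> V i L \<Longrightarrow> g \<in> V i L"
begin

sublocale N: module R N by (rule N)
sublocale C: module R "C i" for i by (rule C)

definition Z :: "nat \<Rightarrow> 'b set \<Rightarrow> 'c set" where
  "Z i L = {f \<in> carrier (C i). \<delta> i f \<in> V (Suc i) L}"

text \<open>\<open>L\<close>-valued cochains are counted as coboundaries, so that a condition modulo
  \<open>L\<close> on \<open>N\<close>-valued cochains describes the coboundaries over
  \<open>N/L\<close>. In degree \<open>0\<close> there is no incoming differential and only these
  remain.\<close>

definition B :: "nat \<Rightarrow> 'b set \<Rightarrow> 'c set" where
  "B i L = (case i of 0 \<Rightarrow> V 0 L
     | Suc j \<Rightarrow> {f \<in> carrier (C (Suc j)). \<exists>g\<in>carrier (C j). cong_mod (C (Suc j)) (V (Suc j) L) f (\<delta> j g)})"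

lemma B_0: "B 0 L = V 0 L" by (simp add: B_def)

lemma B_Suc: "B (Suc j) L =
    {f \<in> carrier (C (Suc j)). \<exists>g\<in>carrier (C j). cong_mod (C (Suc j)) (V (Suc j) L) f (\<delta> j g)}"
  by (simp add: B_def)

lemmas \<delta>_simps = linear_mapsD[OF \<delta>]

lemma \<delta>_minus: "f \<in> carrier (C i) \<Longrightarrow> g \<in> carrier (C i) \<Longrightarrow> \<delta> i (f \<ominus>\<^bsub>C i\<^esub> g) = \<delta> i f \<ominus>\<^bsub>C (Suc i)\<^esub> \<delta> i g"
  using linear_maps_minus[OF C C \<delta>] by blast

lemma \<delta>_cong:
  assumes "submodule L R N" "cong_mod (C i) (V i L) f g"
  shows "cong_mod (C (Suc i)) (V (Suc i) L) (\<delta> i f) (\<delta> i g)"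
  using assms \<delta>_V[OF assms(1), of "f \<ominus>\<^bsub>C i\<^esub> g" i] \<delta>_simps(1) unfolding cong_mod_def by (auto simp: \<delta>_minus)

lemma Z_submodule:
  assumes "submodule L R N" shows "submodule (Z i L) R (C i)"
proof (rule C.submodule_if_closed)
  note v = C.submoduleE(4,5)[OF V[OF assms]]
  show "Z i L \<subseteq> carrier (C i)" by (auto simp: Z_def)
  show "\<zero>\<^bsub>C i\<^esub> \<in> Z i L" using C.submodule_zero[OF V[OF assms]] linear_maps_zero[OF C C \<delta>]
    by (simp add: Z_def)
  show "a \<oplus>\<^bsub>C i\<^esub> b \<in> Z i L" if "a \<in> Z i L" "b \<in> Z i L" for a b
    using that v by (auto simp: Z_def \<delta>_simps)
  show "r \<odot>\<^bsub>C i\<^esub> a \<in> Z i L" if "r \<in> carrier R" "a \<in> Z i L" for r a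
    using that v by (auto simp: Z_def \<delta>_simps)
qed

lemma B_submodule:
  assumes L: "submodule L R N" shows "submodule (B i L) R (C i)"
proof (cases i)
  case 0 then show ?thesis using V[OF L] by (simp add: B_0)
next
  case (Suc j)
  note v = V[OF L, of "Suc j"]
  have "submodule (B (Suc j) L) R (C (Suc j))"
  proof (rule C.submodule_if_closed)
    show "B (Suc j) L \<subseteq> carrier (C (Suc j))" by (auto simp: B_Suc)
    show "\<zero>\<^bsub>C (Suc j)\<^esub> \<in> B (Suc j) L" using C.cong_mod_refl[OF v] linear_maps_zero[OF C C \<delta>, of j]
      unfolding B_Suc by (auto intro!: bexI[of _ "\<zero>\<^bsub>C j\<^esub>"])
    show "a \<oplus>\<^bsub>C (Suc j)\<^esub> b \<in> B (Suc j) L" if a: "a \<in> B (Suc j) L" and b: "b \<in> B (Suc j) L" for a b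
    proof -
      from a obtain g where g: "g \<in> carrier (C j)" "cong_mod (C (Suc j)) (V (Suc j) L) a (\<delta> j g)"
        by (auto simp: B_Suc)
      from b obtain h where h: "h \<in> carrier (C j)" "cong_mod (C (Suc j)) (V (Suc j) L) b (\<delta> j h)"
        by (auto simp: B_Suc)
      show ?thesis using C.cong_mod_add[OF v g(2) h(2)] g h a b
        by (auto simp: B_Suc \<delta>_simps intro!: bexI[of _ "g \<oplus>\<^bsub>C j\<^esub> h"])
    qed
    show "r \<odot>\<^bsub>C (Suc j)\<^esub> a \<in> B (Suc j) L" if r: "r \<in> carrier R" and a: "a \<in> B (Suc j) L" for r a
    proof -
      from a obtain g where g: "g \<in> carrier (C j)" "cong_mod (C (Suc j)) (V (Suc j) L) a (\<delta> j g)"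
        by (auto simp: B_Suc)
      show ?thesis using C.cong_mod_smult[OF v r g(2)] g r a
        by (auto simp: B_Suc \<delta>_simps intro!: bexI[of _ "r \<odot>\<^bsub>C j\<^esub> g"])
    qed
  qed
  then show ?thesis by (simp add: Suc)
qed

lemma B_le_Z:
  assumes L: "submodule L R N" shows "B i L \<subseteq> Z i L"
proof
  fix f assume f: "f \<in> B i L"
  show "f \<in> Z i L"
  proof (cases i)
    case 0
    then show ?thesis using f C.submodule_carrier[OF V[OF L, of 0]] \<delta>_V[OF L, of f 0] by (auto simp: B_0 Z_def)
  next
    case (Suc j)
    with f obtain g where g: "f \<in> carrier (C (Suc j))" "g \<in> carrier (C j)" "cong_mod (C (Suc j)) (V (Suc j) L) f (\<delta> j g)"
      by (auto simp: B_Suc)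
    from C.cong_mod_mem[OF V[OF L] \<delta>_cong[OF L g(3)]] \<delta>\<delta>[OF L g(2)] g(1) Suc show ?thesis
      by (auto simp: Z_def)
  qed
qed

text \<open>The connecting homomorphism from degree \<open>i\<close> over \<open>N/(L + yN)\<close>
  to degree \<open>Suc i\<close> over \<open>N/L\<close>, for the sequence \<open>0 \<rightarrow>
  N/L \<rightarrow> N/L \<rightarrow> N/(L + yN) \<rightarrow> 0\<close> whose first map is
  multiplication by \<open>y\<close>: lift a cocycle, differentiate, divide by \<open>y\<close>. It
  is kept as a relation since the quotient \<open>g\<close> involves a choice.\<close>

definition connects :: "'b set \<Rightarrow> 'a \<Rightarrow> nat \<Rightarrow> 'c \<Rightarrow> 'c \<Rightarrow> bool" where
  "connects L y i f g \<longleftrightarrow> f \<in> Z i (N.add_mult y L) \<and> g \<in> Z (Suc i) L \<and>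
     cong_mod (C (Suc i)) (V (Suc i) L) (\<delta> i f) (y \<odot>\<^bsub>C (Suc i)\<^esub> g)"

context
  fixes L y and i :: nat
  assumes L: "submodule L R N" and y: "y \<in> carrier R" and reg: "N.regular_mod L y"
begin

text \<open>Both cocycle conditions follow from the congruence: it says directly that the
  differential of \<open>f\<close> has values in \<open>L + yN\<close>, and \<open>y\<close> times
  the differential of \<open>g\<close> is congruent to a double differential, where \<open>y\<close>
  can be cancelled by regularity.\<close>

lemma connectsI:
  assumes f: "f \<in> carrier (C i)" and g: "g \<in> carrier (C (Suc i))"
    and fg: "cong_mod (C (Suc i)) (V (Suc i) L) (\<delta> i f) (y \<odot>\<^bsub>C (Suc i)\<^esub> g)"
  shows "connects L y i f g"
proof -
  have "f \<in> Z i (N.add_mult y L)"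
    using V_add_mult[OF L y, of "\<delta> i f" "Suc i"] f g fg by (auto simp: Z_def \<delta>_simps)
  moreover have "y \<odot>\<^bsub>C (Suc (Suc i))\<^esub> \<delta> (Suc i) g \<in> V (Suc (Suc i)) L"
    using C.cong_mod_mem[OF V[OF L] \<delta>_cong[OF L fg]] \<delta>\<delta>[OF L f] y g by (simp add: \<delta>_simps)
  then have "g \<in> Z (Suc i) L" using V_regular[OF L y reg, of "\<delta> (Suc i) g"] g by (simp add: Z_def \<delta>_simps)
  ultimately show ?thesis using fg by (simp add: connects_def)
qed

lemma connects_left_total:
  assumes "f \<in> Z i (N.add_mult y L)" shows "\<exists>g. connects L y i f g"
proof -
  have f: "f \<in> carrier (C i)" "\<delta> i f \<in> V (Suc i) (N.add_mult y L)" using assms by (auto simp: Z_def)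
  then obtain g where "g \<in> carrier (C (Suc i))" "cong_mod (C (Suc i)) (V (Suc i) L) (\<delta> i f) (y \<odot>\<^bsub>C (Suc i)\<^esub> g)"
    using V_add_mult[OF L y, of "\<delta> i f" "Suc i"] by (auto simp: \<delta>_simps)
  then show ?thesis using connectsI[OF f(1)] by blast
qed

text \<open>Exactness at degree \<open>Suc i\<close>: a class annihilated by \<open>y\<close> comes
  from the connecting map.\<close>

lemma connects_right:
  assumes "g \<in> carrier (C (Suc i))" "y \<odot>\<^bsub>C (Suc i)\<^esub> g \<in> B (Suc i) L" shows "\<exists>f. connects L y i f g"
proof -
  from assms obtain f where f: "f \<in> carrier (C i)" "cong_mod (C (Suc i)) (V (Suc i) L) (y \<odot>\<^bsub>C (Suc i)\<^esub> g) (\<delta> i f)"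
    by (auto simp: B_Suc)
  then show ?thesis using connectsI[OF f(1) assms(1)] C.cong_mod_sym[OF V[OF L]] by blast
qed

text \<open>The connecting map is well defined: if \<open>f\<close> is a coboundary modulo
  \<open>L + yN\<close>, then its differential is congruent to that of \<open>y\<close> times some
  \<open>h\<close>, and cancelling \<open>y\<close> makes \<open>g\<close> congruent to the
  differential of \<open>h\<close>.\<close>

lemma B_right_if_connects:
  assumes fg: "connects L y i f g" and f: "f \<in> B i (N.add_mult y L)"
  shows "g \<in> B (Suc i) L"
proof -
  have fc: "f \<in> carrier (C i)" and gc: "g \<in> carrier (C (Suc i))"
    and dfg: "cong_mod (C (Suc i)) (V (Suc i) L) (\<delta> i f) (y \<odot>\<^bsub>C (Suc i)\<^esub> g)"
    using fg by (auto simp: connects_def Z_def)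
  \<comment> \<open>In positive degree \<open>f\<close> is first corrected by the differential of
    some \<open>k\<close>, whose own differential is \<open>L\<close>-valued and drops out.\<close>
  have "\<exists>h\<in>carrier (C i). cong_mod (C (Suc i)) (V (Suc i) L) (\<delta> i f) (\<delta> i (y \<odot>\<^bsub>C i\<^esub> h))"
  proof (cases i)
    case 0
    then obtain h where "h \<in> carrier (C i)" "cong_mod (C i) (V i L) f (y \<odot>\<^bsub>C i\<^esub> h)"
      using f fc V_add_mult[OF L y, of f 0] by (auto simp: B_0)
    then show ?thesis using \<delta>_cong[OF L] by blast
  next
    case (Suc j)
    then obtain k where k: "k \<in> carrier (C j)" "cong_mod (C i) (V i (N.add_mult y L)) f (\<delta> j k)"
      using f by (auto simp: B_Suc)
    have dk: "\<delta> j k \<in> carrier (C i)" using k Suc by (simp add: \<delta>_simps)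
    have "f \<ominus>\<^bsub>C i\<^esub> \<delta> j k \<in> V i (N.add_mult y L)" using k by (simp add: cong_mod_def)
    then obtain h where h: "h \<in> carrier (C i)" "cong_mod (C i) (V i L) (f \<ominus>\<^bsub>C i\<^esub> \<delta> j k) (y \<odot>\<^bsub>C i\<^esub> h)"
      using V_add_mult[OF L y, of "f \<ominus>\<^bsub>C i\<^esub> \<delta> j k" i] fc dk by auto
    have yh: "y \<odot>\<^bsub>C i\<^esub> h \<in> carrier (C i)" using y h by simp
    from h have "cong_mod (C i) (V i L) f (y \<odot>\<^bsub>C i\<^esub> h \<oplus>\<^bsub>C i\<^esub> \<delta> j k)"
      using C.cong_mod_minus_left[OF V[OF L] fc dk yh] by blast
    from \<delta>_cong[OF L this]
    have 1: "cong_mod (C (Suc i)) (V (Suc i) L) (\<delta> i f) (\<delta> i (y \<odot>\<^bsub>C i\<^esub> h) \<oplus>\<^bsub>C (Suc i)\<^esub> \<delta> i (\<delta> j k))"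
      using \<delta>_simps(2)[OF yh dk] by simp
    have "\<delta> i (\<delta> j k) \<in> V (Suc i) L" using \<delta>\<delta>[OF L k(1)] Suc by simp
    then have "cong_mod (C (Suc i)) (V (Suc i) L) (\<delta> i (\<delta> j k)) \<zero>\<^bsub>C (Suc i)\<^esub>"
      using C.cong_mod_zero V[OF L] by blast
    from C.cong_mod_add[OF V[OF L] C.cong_mod_refl[OF V[OF L]] this, of "\<delta> i (y \<odot>\<^bsub>C i\<^esub> h)"] yh
    have "cong_mod (C (Suc i)) (V (Suc i) L) (\<delta> i (y \<odot>\<^bsub>C i\<^esub> h) \<oplus>\<^bsub>C (Suc i)\<^esub> \<delta> i (\<delta> j k)) (\<delta> i (y \<odot>\<^bsub>C i\<^esub> h))"
      by (simp add: \<delta>_simps(1))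
    from C.cong_mod_trans[OF V[OF L] 1 this] h show ?thesis by blast
  qed
  then obtain h where h: "h \<in> carrier (C i)"
    and dh: "cong_mod (C (Suc i)) (V (Suc i) L) (\<delta> i f) (y \<odot>\<^bsub>C (Suc i)\<^esub> \<delta> i h)"
    using y by (auto simp: \<delta>_simps)
  from C.cong_mod_trans[OF V[OF L] C.cong_mod_sym[OF V[OF L] dfg] dh]
  have "y \<odot>\<^bsub>C (Suc i)\<^esub> (g \<ominus>\<^bsub>C (Suc i)\<^esub> \<delta> i h) \<in> V (Suc i) L"
    using y gc h by (simp add: C.smult_minus_distr \<delta>_simps cong_mod_def)
  from V_regular[OF L y reg _ this] have "g \<ominus>\<^bsub>C (Suc i)\<^esub> \<delta> i h \<in> V (Suc i) L"
    using gc h by (simp add: \<delta>_simps)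
  then show ?thesis using gc h by (auto simp: B_Suc cong_mod_def \<delta>_simps)
qed

text \<open>Injectivity of the connecting map on classes. If \<open>g\<close> is congruent to the
  differential of \<open>h\<close>, then \<open>f\<close> minus \<open>y\<close> times
  \<open>h\<close> is a cocycle modulo \<open>L\<close>, hence a coboundary by the vanishing in
  degree \<open>i\<close>; modulo \<open>L + yN\<close> the term with \<open>h\<close>
  disappears.\<close>

lemma B_left_if_connects:
  assumes van: "Z i L \<subseteq> B i L" and fg: "connects L y i f g" and g: "g \<in> B (Suc i) L"
  shows "f \<in> B i (N.add_mult y L)"
proof -
  have fc: "f \<in> carrier (C i)" and gc: "g \<in> carrier (C (Suc i))"
    and dfg: "cong_mod (C (Suc i)) (V (Suc i) L) (\<delta> i f) (y \<odot>\<^bsub>C (Suc i)\<^esub> g)"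
    using fg by (auto simp: connects_def Z_def)
  from g obtain h where h: "h \<in> carrier (C i)" "cong_mod (C (Suc i)) (V (Suc i) L) g (\<delta> i h)"
    by (auto simp: B_Suc)
  have yh: "y \<odot>\<^bsub>C i\<^esub> h \<in> carrier (C i)" using y h by simp
  have "cong_mod (C (Suc i)) (V (Suc i) L) (\<delta> i f) (\<delta> i (y \<odot>\<^bsub>C i\<^esub> h))"
    using C.cong_mod_trans[OF V[OF L] dfg C.cong_mod_smult[OF V[OF L] y h(2)]] h y by (simp add: \<delta>_simps)
  then have "f \<ominus>\<^bsub>C i\<^esub> y \<odot>\<^bsub>C i\<^esub> h \<in> Z i L"
    using fc yh by (simp add: Z_def \<delta>_minus cong_mod_def)
  then have k: "f \<ominus>\<^bsub>C i\<^esub> y \<odot>\<^bsub>C i\<^esub> h \<in> B i L" using van by blast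
  show ?thesis
  proof (cases i)
    case 0
    then have "cong_mod (C i) (V i L) f (y \<odot>\<^bsub>C i\<^esub> h)" using k fc yh by (simp add: B_0 cong_mod_def)
    then show ?thesis using 0 V_add_mult[OF L y fc] h by (auto simp: B_0)
  next
    case (Suc j)
    with k obtain k where k: "k \<in> carrier (C j)" "cong_mod (C i) (V i L) (f \<ominus>\<^bsub>C i\<^esub> y \<odot>\<^bsub>C i\<^esub> h) (\<delta> j k)"
      by (auto simp: B_Suc)
    have dk: "\<delta> j k \<in> carrier (C i)" using k Suc by (simp add: \<delta>_simps)
    from k have "cong_mod (C i) (V i L) f (\<delta> j k \<oplus>\<^bsub>C i\<^esub> y \<odot>\<^bsub>C i\<^esub> h)"
      using C.cong_mod_minus_left[OF V[OF L] fc yh dk] by blast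
    then have "cong_mod (C i) (V i L) f (y \<odot>\<^bsub>C i\<^esub> h \<oplus>\<^bsub>C i\<^esub> \<delta> j k)"
      using dk yh by (simp add: C.M.a_comm)
    then have "cong_mod (C i) (V i L) (f \<ominus>\<^bsub>C i\<^esub> \<delta> j k) (y \<odot>\<^bsub>C i\<^esub> h)"
      using C.cong_mod_minus_left[OF V[OF L] fc dk yh] by blast
    then have "f \<ominus>\<^bsub>C i\<^esub> \<delta> j k \<in> V i (N.add_mult y L)"
      using V_add_mult[OF L y, of "f \<ominus>\<^bsub>C i\<^esub> \<delta> j k" i] fc dk h by auto
    then show ?thesis using Suc fc dk k by (auto simp: B_Suc cong_mod_def)
  qed
qed

end

text \<open>Induction along \<open>ys\<close>: a class over \<open>N/L\<close> killed by
  \<open>y\<close> comes from one degree lower over \<open>N/(L + yN)\<close>, where the cohomology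
  vanishes by induction; so \<open>y\<close> acts injectively. As some power of \<open>y\<close>
  kills each class, every class is zero. In degree \<open>0\<close> regularity itself gives the
  injectivity.\<close>

lemma cohomology_vanishes:
  assumes L: "submodule L R N" and ys: "set ys \<subseteq> carrier R" "N.weakly_regular L ys" and i: "i < length ys"
    and kill: "\<And>y i L g. y \<in> set ys \<Longrightarrow> submodule L R N \<Longrightarrow> g \<in> Z i L \<Longrightarrow> \<exists>k::nat. (y [^] k) \<odot>\<^bsub>C i\<^esub> g \<in> B i L"
  shows "Z i L \<subseteq> B i L"
  using assms
proof (induction ys arbitrary: L i)
  case (Cons y ys)
  note L = Cons.prems(1)
  have y: "y \<in> carrier R" and reg: "N.regular_mod L y" using Cons.prems by auto
  note L' = N.add_mult_submodule[OF L y]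
  have cancel: "g \<in> B i L" if g: "g \<in> Z i L" "y \<odot>\<^bsub>C i\<^esub> g \<in> B i L" for g
  proof (cases i)
    case 0
    then show ?thesis using g V_regular[OF L y reg] by (auto simp: B_0 Z_def)
  next
    case (Suc j)
    have "Z j (N.add_mult y L) \<subseteq> B j (N.add_mult y L)"
      using Cons.IH[OF L', of j] Cons.prems Suc by auto
    moreover obtain f where "connects L y j f g"
      using connects_right[OF L y reg, of g j] g Suc by (auto simp: Z_def)
    ultimately show ?thesis using B_right_if_connects[OF L y reg] Suc
      unfolding connects_def by blast
  qed
  have "g \<in> Z i L \<Longrightarrow> (y [^] (k::nat)) \<odot>\<^bsub>C i\<^esub> g \<in> B i L \<Longrightarrow> g \<in> B i L" for g k
  proof (induction k arbitrary: g)
    case 0 then show ?case by (simp add: Z_def)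
  next
    case (Suc k)
    have gc: "g \<in> carrier (C i)" using Suc by (simp add: Z_def)
    have "(y [^] k) \<odot>\<^bsub>C i\<^esub> (y \<odot>\<^bsub>C i\<^esub> g) \<in> B i L"
      using Suc.prems y gc by (simp add: C.smult_assoc1)
    then have "y \<odot>\<^bsub>C i\<^esub> g \<in> B i L" using Suc C.submoduleE(4)[OF Z_submodule[OF L] y] by blast
    then show ?case using cancel Suc by blast
  qed
  moreover have "\<exists>k::nat. (y [^] k) \<odot>\<^bsub>C i\<^esub> g \<in> B i L" if "g \<in> Z i L" for g
    using Cons.prems(5)[OF _ L that, of y] by auto
  ultimately show ?case by blast
qed simp

text \<open>Every element of \<open>ys\<close> lowers the degree by one and enlarges
  \<open>L\<close>: as \<open>y\<close> kills the cohomology over \<open>N/L\<close>, the connecting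
  map is onto, and the vanishing one degree lower makes it injective.\<close>

lemma rlen_cohomology_shift:
  assumes L: "submodule L R N" and ys: "set ys \<subseteq> carrier R" "N.weakly_regular L ys"
    and kill: "\<And>y i L g. y \<in> set ys \<Longrightarrow> submodule L R N \<Longrightarrow> g \<in> Z i L \<Longrightarrow> y \<odot>\<^bsub>C i\<^esub> g \<in> B i L"
  shows "rlen R (C (length ys)) (B (length ys) L) (Z (length ys) L) =
    rlen R (C 0) (B 0 (fold N.add_mult ys L)) (Z 0 (fold N.add_mult ys L))"
  using assms
proof (induction ys arbitrary: L)
  case (Cons y ys)
  note L = Cons.prems(1)
  have y: "y \<in> carrier R" and reg: "N.regular_mod L y" using Cons.prems by auto
  note L' = N.add_mult_submodule[OF L y]
  let ?r = "length ys"
  have kill': "\<exists>k::nat. (z [^] k) \<odot>\<^bsub>C i\<^esub> g \<in> B i L"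
    if "z \<in> set (y # ys)" "submodule L R N" "g \<in> Z i L" for z i L g
  proof -
    have "z \<in> carrier R" using that Cons.prems by auto
    then have "(z [^] (1::nat)) \<odot>\<^bsub>C i\<^esub> g \<in> B i L" using Cons.prems(4)[OF that] by simp
    then show ?thesis ..
  qed
  \<comment> \<open>The sequence \<open>y # ys\<close> is one longer than \<open>?r\<close>, so the
    vanishing reaches degree \<open>?r\<close>.\<close>
  have van: "Z ?r L \<subseteq> B ?r L"
    by (rule cohomology_vanishes[OF L Cons.prems(2,3) _ kill']) auto
  have "rlen R (C ?r) (B ?r (N.add_mult y L)) (Z ?r (N.add_mult y L)) =
    rlen R (C (Suc ?r)) (B (Suc ?r) L) (Z (Suc ?r) L)"
  proof (rule rlen_rel_eq[of R _ _ _ _ _ _ "connects L y ?r"])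
    show "x \<in> B ?r (N.add_mult y L) \<longleftrightarrow> z \<in> B (Suc ?r) L" if "connects L y ?r x z" for x z
      using B_right_if_connects[OF L y reg that] B_left_if_connects[OF L y reg van that] by blast
    show "\<exists>z. connects L y ?r x z" if "x \<in> Z ?r (N.add_mult y L)" for x
      using connects_left_total[OF L y reg that] .
    show "\<exists>x. connects L y ?r x z" if "z \<in> Z (Suc ?r) L" for z
      using connects_right[OF L y reg, of z ?r] that Cons.prems(4)[OF _ L that, of y] by (auto simp: Z_def)
    show "x \<in> Z ?r (N.add_mult y L) \<and> z \<in> Z (Suc ?r) L" if "connects L y ?r x z" for x z
      using that unfolding connects_def by blast
    show "connects L y ?r (x \<oplus>\<^bsub>C ?r\<^esub> x') (z \<oplus>\<^bsub>C (Suc ?r)\<^esub> z')"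
      if xz: "connects L y ?r x z" "connects L y ?r x' z'" for x z x' z'
    proof -
      have c: "x \<in> carrier (C ?r)" "x' \<in> carrier (C ?r)" "z \<in> carrier (C (Suc ?r))" "z' \<in> carrier (C (Suc ?r))"
        using xz unfolding connects_def by (auto simp: Z_def)
      show ?thesis using xz C.cong_mod_add[OF V[OF L], of "Suc ?r"] c y
        by (intro connectsI[OF L y reg]) (auto simp: connects_def \<delta>_simps C.smult_r_distr)
    qed
    show "connects L y ?r (r \<odot>\<^bsub>C ?r\<^esub> x) (r \<odot>\<^bsub>C (Suc ?r)\<^esub> z)"
      if r: "r \<in> carrier R" and xz: "connects L y ?r x z" for r x z
    proof -
      have c: "x \<in> carrier (C ?r)" "z \<in> carrier (C (Suc ?r))"
        using xz unfolding connects_def by (auto simp: Z_def)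
      have "y \<odot>\<^bsub>C (Suc ?r)\<^esub> (r \<odot>\<^bsub>C (Suc ?r)\<^esub> z) = r \<odot>\<^bsub>C (Suc ?r)\<^esub> (y \<odot>\<^bsub>C (Suc ?r)\<^esub> z)"
        using c r y C.smult_assoc1[symmetric, where i="Suc ?r"] N.R.m_comm[of r y] by simp
      then show ?thesis using xz C.cong_mod_smult[OF V[OF L] r, of "Suc ?r"] c y r
        by (intro connectsI[OF L y reg]) (auto simp: connects_def \<delta>_simps)
    qed
  qed (use L L' C Z_submodule B_submodule B_le_Z in auto)
  then show ?case using Cons.IH[OF L'] Cons.prems by simp
qed simp

end

section \<open>Finitely generated and Noetherian modules\<close>

lemma linear_image_submodule:
  assumes M: "module R M" and N: "module R N" and f: "f \<in> linear_maps R M N" and T: "submodule T R M"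
  shows "submodule (f ` T) R N"
proof -
  interpret M: module R M by fact
  interpret N: module R N by fact
  note T' = M.submodule_carrier[OF T] M.submodule_zero[OF T] M.submoduleE(4,5)[OF T]
  note fs = linear_mapsD[OF f] linear_maps_zero[OF M N f]
  show ?thesis
  proof (rule N.submodule_if_closed)
    show "f ` T \<subseteq> carrier N" using T' fs by auto
    show "\<zero>\<^bsub>N\<^esub> \<in> f ` T" using T'(2) fs(4) by force
    show "a \<oplus>\<^bsub>N\<^esub> b \<in> f ` T" if "a \<in> f ` T" "b \<in> f ` T" for a b
    proof -
      from that obtain x y where "x \<in> T" "y \<in> T" "a = f x" "b = f y" by auto
      then show ?thesis using T' fs by (intro image_eqI[of _ _ "x \<oplus>\<^bsub>M\<^esub> y"]) auto
    qed
    show "r \<odot>\<^bsub>N\<^esub> a \<in> f ` T" if "r \<in> carrier R" "a \<in> f ` T" for r a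
    proof -
      from that obtain x where "x \<in> T" "a = f x" by auto
      then show ?thesis using T' fs that(1) by (intro image_eqI[of _ _ "r \<odot>\<^bsub>M\<^esub> x"]) auto
    qed
  qed
qed

lemma linear_vimage_submodule:
  assumes M: "module R M" and N: "module R N" and f: "f \<in> linear_maps R M N"
    and T: "submodule T R M" and K: "submodule K R N"
  shows "submodule {x \<in> T. f x \<in> K} R M"
proof -
  interpret M: module R M by fact
  interpret N: module R N by fact
  note T' = M.submodule_carrier[OF T] M.submodule_zero[OF T] M.submoduleE(4,5)[OF T]
    N.submodule_zero[OF K] N.submoduleE(4,5)[OF K]
  note fs = linear_mapsD[OF f] linear_maps_zero[OF M N f]
  show ?thesis by (rule M.submodule_if_closed) (use T' fs in auto)
qed

definition fg_sub :: "('a, 'r) ring_scheme \<Rightarrow> ('a, 'b, 'm) module_scheme \<Rightarrow> 'b set \<Rightarrow> bool" where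
  "fg_sub R M T \<longleftrightarrow> (\<exists>S. finite S \<and> S \<subseteq> T \<and> submodule_span R M S = T)"

lemma (in module) noeth_iff: "noeth \<longleftrightarrow> (\<forall>K. submodule K R M \<longrightarrow> fg_sub R M K)"
  by (simp add: noeth_def fg_sub_def)

lemma fg_sub_image:
  assumes M: "module R M" and N: "module R N" and f: "f \<in> linear_maps R M N"
    and T: "submodule T R M" "fg_sub R M T"
  shows "fg_sub R N (f ` T)"
proof -
  interpret M: module R M by fact
  interpret N: module R N by fact
  obtain S where S: "finite S" "S \<subseteq> T" "submodule_span R M S = T" using T unfolding fg_sub_def by blast
  note Tc = M.submodule_carrier[OF T(1)]
  have fS: "f ` S \<subseteq> carrier N" using S(2) Tc linear_mapsD(1)[OF f] by blast
  have "submodule {x \<in> carrier M. f x \<in> submodule_span R N (f ` S)} R M"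
    by (rule linear_vimage_submodule[OF M N f M.carrier_is_submodule N.span_submodule[OF fS]])
  moreover have "S \<subseteq> {x \<in> carrier M. f x \<in> submodule_span R N (f ` S)}"
    using S(2) Tc N.span_upper[of "f ` S"] by blast
  ultimately have "T \<subseteq> {x \<in> carrier M. f x \<in> submodule_span R N (f ` S)}"
    using M.span_least S(3) by blast
  moreover have "submodule_span R N (f ` S) \<subseteq> f ` T"
    using N.span_least[OF linear_image_submodule[OF M N f T(1)]] S(2) by blast
  ultimately have "submodule_span R N (f ` S) = f ` T" by blast
  then show ?thesis using S unfolding fg_sub_def by blast
qed

text \<open>Lifts of generators of the image, together with generators of the kernel,
  generate.\<close>

lemma fg_sub_extension:
  assumes M: "module R M" and N: "module R N" and f: "f \<in> linear_maps R M N"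
    and T: "submodule T R M"
    and fg: "fg_sub R N (f ` T)" "fg_sub R M {x \<in> T. f x \<in> {\<zero>\<^bsub>N\<^esub>}}"
  shows "fg_sub R M T"
proof -
  interpret M: module R M by fact
  interpret N: module R N by fact
  note Tc = M.submodule_carrier[OF T]
  obtain S where S: "finite S" "S \<subseteq> f ` T" "submodule_span R N S = f ` T" using fg(1) unfolding fg_sub_def by blast
  obtain S1 where S1: "finite S1" "S1 \<subseteq> T" "S = f ` S1" using finite_subset_image[OF S(1,2)] by blast
  obtain S2 where S2: "finite S2" "S2 \<subseteq> {x \<in> T. f x \<in> {\<zero>\<^bsub>N\<^esub>}}" "submodule_span R M S2 = {x \<in> T. f x \<in> {\<zero>\<^bsub>N\<^esub>}}"
    using fg(2) unfolding fg_sub_def by blast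
  let ?H = "submodule_span R M (S1 \<union> S2)"
  have "S1 \<union> S2 \<subseteq> carrier M" using S1 S2 Tc by blast
  note H = M.span_submodule[OF this]
  have HT: "?H \<subseteq> T" using M.span_least[OF T] S1 S2 by blast
  have "submodule_span R N S \<subseteq> f ` ?H"
    using N.span_least[OF linear_image_submodule[OF M N f H], of S] M.span_upper[of "S1 \<union> S2"] S1(3) by blast
  then have img: "f ` T \<subseteq> f ` ?H" using S(3) by simp
  have ker: "{x \<in> T. f x \<in> {\<zero>\<^bsub>N\<^esub>}} \<subseteq> ?H"
    unfolding S2(3)[symmetric] using M.span_upper[of "S1 \<union> S2"] by (intro M.span_least[OF H]) auto
  have "T \<subseteq> ?H"
  proof
    fix t assume t: "t \<in> T"
    then obtain h where h: "h \<in> ?H" "f t = f h" using img by blast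
    have c: "t \<in> carrier M" "h \<in> carrier M" using t h Tc HT by auto
    have "f (t \<ominus>\<^bsub>M\<^esub> h) = \<zero>\<^bsub>N\<^esub>"
      using linear_maps_minus[OF M N f c] h c linear_mapsD(1)[OF f] by (simp add: a_minus_def N.M.r_neg)
    moreover have "t \<ominus>\<^bsub>M\<^esub> h \<in> T" using M.submodule_minus[OF T t] h HT by blast
    ultimately have "t \<ominus>\<^bsub>M\<^esub> h \<in> ?H" using ker by blast
    then have "(t \<ominus>\<^bsub>M\<^esub> h) \<oplus>\<^bsub>M\<^esub> h \<in> ?H" using h M.submoduleE(5)[OF H] by blast
    then show "t \<in> ?H" using M.add_minus_cancel(2)[OF c] by simp
  qed
  then have "?H = T" using HT by blast
  then show ?thesis using S1 S2 unfolding fg_sub_def by (intro exI[of _ "S1 \<union> S2"]) auto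
qed

text \<open>One construction for three uses: free modules with \<open>J\<close> finite, the ambient
  module of \<open>Hom_module\<close> with \<open>J\<close> the carrier of the source, and Koszul
  cochains with \<open>J = UNIV\<close>.\<close>

definition pow_module :: "'x set \<Rightarrow> ('a, 'b, 'm) module_scheme \<Rightarrow> ('a, 'x \<Rightarrow> 'b) module" where
  "pow_module J N = \<lparr>carrier = J \<rightarrow>\<^sub>E carrier N, monoid.mult = undefined, one = undefined,
     ring.zero = (\<lambda>i\<in>J. \<zero>\<^bsub>N\<^esub>), add = (\<lambda>u v. \<lambda>i\<in>J. u i \<oplus>\<^bsub>N\<^esub> v i), smult = (\<lambda>a v. \<lambda>i\<in>J. a \<odot>\<^bsub>N\<^esub> v i)\<rparr>"

lemma free_module_eq: "free_module R n = pow_module {..<n} (self_module R)"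
  by (simp add: free_module_def pow_module_def self_module_def)

lemma pow_module_simps:
  "carrier (pow_module J N) = J \<rightarrow>\<^sub>E carrier N"
  "\<zero>\<^bsub>pow_module J N\<^esub> = (\<lambda>i\<in>J. \<zero>\<^bsub>N\<^esub>)"
  "u \<oplus>\<^bsub>pow_module J N\<^esub> v = (\<lambda>i\<in>J. u i \<oplus>\<^bsub>N\<^esub> v i)"
  "a \<odot>\<^bsub>pow_module J N\<^esub> v = (\<lambda>i\<in>J. a \<odot>\<^bsub>N\<^esub> v i)"
  by (simp_all add: pow_module_def)

lemma (in module) pow_module_module: "module R (pow_module J M)"
proof (rule moduleI[OF R.is_cring abelian_groupI])
  show "\<exists>y\<in>carrier (pow_module J M). y \<oplus>\<^bsub>pow_module J M\<^esub> x = \<zero>\<^bsub>pow_module J M\<^esub>"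
    if "x \<in> carrier (pow_module J M)" for x
    using that by (intro bexI[of _ "\<lambda>i\<in>J. \<ominus>\<^bsub>M\<^esub> x i"]) (auto simp: pow_module_simps fun_eq_iff PiE_iff M.l_neg)
qed (auto simp: pow_module_simps PiE_iff fun_eq_iff extensional_def M.a_assoc M.a_comm M.a_lcomm
    smult_l_distr smult_r_distr smult_assoc1)

lemma (in module) pow_module_minus:
  assumes "u \<in> carrier (pow_module J M)" "v \<in> carrier (pow_module J M)"
  shows "u \<ominus>\<^bsub>pow_module J M\<^esub> v = (\<lambda>i\<in>J. u i \<ominus>\<^bsub>M\<^esub> v i)"
proof -
  interpret P: module R "pow_module J M" by (rule pow_module_module)
  have "u \<ominus>\<^bsub>pow_module J M\<^esub> v = u \<oplus>\<^bsub>pow_module J M\<^esub> (\<ominus> \<one>) \<odot>\<^bsub>pow_module J M\<^esub> v"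
    using assms by (simp add: P.smult_l_minus a_minus_def)
  also have "\<dots> = (\<lambda>i\<in>J. u i \<ominus>\<^bsub>M\<^esub> v i)"
    using assms by (auto simp: pow_module_simps fun_eq_iff PiE_iff smult_l_minus a_minus_def)
  finally show ?thesis .
qed

lemma (in module) noeth_pow_module:
  assumes noeth and J: "finite J"
  shows "module.noeth R (pow_module J M)"
proof -
  let ?P = "pow_module J M"
  interpret P: module R ?P by (rule pow_module_module)
  \<comment> \<open>Induction over the set \<open>Y\<close> of coordinates that may be nonzero.
    Evaluation at one coordinate has its image in \<open>M\<close> and a kernel supported on one
    coordinate less.\<close>
  have *: "fg_sub R ?P T" if "finite Y" "Y \<subseteq> J" "submodule T R ?P" "\<forall>t\<in>T. \<forall>i\<in>J - Y. t i = \<zero>\<^bsub>M\<^esub>" for Y T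
    using that
  proof (induction Y arbitrary: T rule: finite_induct)
    case empty
    then have "t = \<zero>\<^bsub>?P\<^esub>" if "t \<in> T" for t
      using that P.submodule_carrier[of T t] by (auto simp: pow_module_simps fun_eq_iff PiE_iff extensional_def)
    then have "T = {\<zero>\<^bsub>?P\<^esub>}" using P.submodule_zero[of T] empty by blast
    moreover have "submodule_span R ?P {} = {\<zero>\<^bsub>?P\<^esub>}"
      using P.span_least[OF P.zero_submodule, of "{}"] P.submodule_zero[OF P.span_submodule[of "{}"]] by auto
    ultimately show ?case unfolding fg_sub_def by blast
  next
    case (insert p Y)
    have p: "p \<in> J" using insert by auto
    have ev: "(\<lambda>t. t p) \<in> linear_maps R ?P M"
      using p by (auto simp: linear_maps_def pow_module_simps)
    note T = insert.prems(2)
    show ?case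
    proof (rule fg_sub_extension[OF P.module_axioms module_axioms ev T])
      show "fg_sub R M ((\<lambda>t. t p) ` T)"
        using linear_image_submodule[OF P.module_axioms module_axioms ev T] assms(1) by (simp add: noeth_iff)
      show "fg_sub R ?P {t \<in> T. t p \<in> {\<zero>\<^bsub>M\<^esub>}}"
        using insert.prems linear_vimage_submodule[OF P.module_axioms module_axioms ev T zero_submodule]
        by (intro insert.IH) auto
    qed
  qed
  show ?thesis unfolding P.noeth_iff using *[of J] J by auto
qed

section \<open>Free modules\<close>

primrec lin_comb :: "('a, 'b, 'm) module_scheme \<Rightarrow> (nat \<Rightarrow> 'b) \<Rightarrow> nat \<Rightarrow> (nat \<Rightarrow> 'a) \<Rightarrow> 'b" where
  "lin_comb M u 0 v = \<zero>\<^bsub>M\<^esub>"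
| "lin_comb M u (Suc k) v = lin_comb M u k v \<oplus>\<^bsub>M\<^esub> v k \<odot>\<^bsub>M\<^esub> u k"

lemma free_module_simps:
  "carrier (free_module R n) = {..<n} \<rightarrow>\<^sub>E carrier R"
  "\<zero>\<^bsub>free_module R n\<^esub> = (\<lambda>i\<in>{..<n}. \<zero>\<^bsub>R\<^esub>)"
  "u \<oplus>\<^bsub>free_module R n\<^esub> v = (\<lambda>i\<in>{..<n}. u i \<oplus>\<^bsub>R\<^esub> v i)"
  "a \<odot>\<^bsub>free_module R n\<^esub> v = (\<lambda>i\<in>{..<n}. a \<otimes>\<^bsub>R\<^esub> v i)"
  by (simp_all add: free_module_def)

lemma (in cring) self_module_module: "module R (self_module R)"
  by (rule moduleI[OF is_cring abelian_groupI])
    (auto simp: self_module_def a_assoc a_comm a_lcomm m_assoc l_distr r_distr l_neg intro!: bexI[of _ "\<ominus> x" for x])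

lemma self_module_simps:
  "carrier (self_module R) = carrier R" "\<zero>\<^bsub>self_module R\<^esub> = \<zero>\<^bsub>R\<^esub>"
  "x \<oplus>\<^bsub>self_module R\<^esub> y = x \<oplus>\<^bsub>R\<^esub> y" "x \<odot>\<^bsub>self_module R\<^esub> y = x \<otimes>\<^bsub>R\<^esub> y"
  by (simp_all add: self_module_def)

lemma (in cring) free_module_module: "module R (free_module R n)"
  unfolding free_module_eq by (rule module.pow_module_module[OF self_module_module])

definition unit_vec :: "('a, 'r) ring_scheme \<Rightarrow> nat \<Rightarrow> nat \<Rightarrow> (nat \<Rightarrow> 'a)" where
  "unit_vec R n j = (\<lambda>i\<in>{..<n}. if i = j then \<one>\<^bsub>R\<^esub> else \<zero>\<^bsub>R\<^esub>)"

context module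
begin

lemma lin_comb_closed:
  assumes "\<forall>j<k. u j \<in> carrier M" "\<forall>j<k. v j \<in> carrier R"
  shows "lin_comb M u k v \<in> carrier M"
  using assms by (induction k) auto

lemma lin_comb_linear:
  assumes u: "\<forall>j<n. u j \<in> carrier M"
  shows "lin_comb M u n \<in> linear_maps R (free_module R n) M"
proof -
  have c: "lin_comb M u k v \<in> carrier M" if "k \<le> n" "v \<in> {..<n} \<rightarrow>\<^sub>E carrier R" for k v
    using that u by (intro lin_comb_closed) (auto simp: PiE_iff)
  have "lin_comb M u k (\<lambda>i\<in>{..<n}. v i \<oplus> w i) = lin_comb M u k v \<oplus>\<^bsub>M\<^esub> lin_comb M u k w"
    if "k \<le> n" "v \<in> {..<n} \<rightarrow>\<^sub>E carrier R" "w \<in> {..<n} \<rightarrow>\<^sub>E carrier R" for k v w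
    using that
  proof (induction k)
    case (Suc k)
    then have "v k \<in> carrier R" "w k \<in> carrier R" "u k \<in> carrier M" using u by (auto simp: PiE_iff)
    then show ?case using Suc c[of k v] c[of k w] by (simp add: smult_l_distr M.a_ac)
  qed auto
  moreover have "lin_comb M u k (\<lambda>i\<in>{..<n}. a \<otimes> v i) = a \<odot>\<^bsub>M\<^esub> lin_comb M u k v"
    if "k \<le> n" "v \<in> {..<n} \<rightarrow>\<^sub>E carrier R" "a \<in> carrier R" for k v a
    using that
  proof (induction k)
    case (Suc k)
    then have "v k \<in> carrier R" "u k \<in> carrier M" using u by (auto simp: PiE_iff)
    then show ?case using Suc c[of k v] by (simp add: smult_r_distr smult_assoc1)
  qed auto
  ultimately show ?thesis using c unfolding linear_maps_def by (auto simp: free_module_simps)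
qed

lemma lin_comb_in_submodule:
  assumes "submodule H R M" "\<forall>j<k. u j \<in> H" "\<forall>j<k. v j \<in> carrier R"
  shows "lin_comb M u k v \<in> H"
  using assms(2,3) submodule_zero[OF assms(1)] submoduleE(4,5)[OF assms(1)] by (induction k) auto

lemma unit_vec_closed: "unit_vec R n j \<in> carrier (free_module R n)"
  by (auto simp: unit_vec_def free_module_simps)

lemma lin_comb_unit_vec:
  assumes "\<forall>i<n. u i \<in> carrier M" "j < n"
  shows "lin_comb M u n (unit_vec R n j) = u j"
proof -
  have "lin_comb M u k (unit_vec R n j) = (if j < k then u j else \<zero>\<^bsub>M\<^esub>)" if "k \<le> n" for k
    using that
  proof (induction k)
    case (Suc k)
    then show ?case using assms by (auto simp: unit_vec_def less_Suc_eq)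
  qed auto
  then show ?thesis using assms by auto
qed

lemma lin_comb_image:
  assumes u: "\<forall>j<n. u j \<in> carrier M"
  shows "lin_comb M u n ` carrier (free_module R n) = submodule_span R M (u ` {..<n})"
proof
  have "u ` {..<n} \<subseteq> carrier M" using u by auto
  note span = span_submodule[OF this]
  show "lin_comb M u n ` carrier (free_module R n) \<subseteq> submodule_span R M (u ` {..<n})"
    using span_upper[of "u ` {..<n}"]
    by (auto simp: free_module_simps PiE_iff intro!: lin_comb_in_submodule[OF span])
  have "u ` {..<n} \<subseteq> lin_comb M u n ` carrier (free_module R n)"
  proof
    fix x assume "x \<in> u ` {..<n}"
    then obtain j where "j < n" "x = u j" by auto
    then show "x \<in> lin_comb M u n ` carrier (free_module R n)"
      using lin_comb_unit_vec[OF u, of j] unit_vec_closed by (intro image_eqI[of _ _ "unit_vec R n j"]) auto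
  qed
  then show "submodule_span R M (u ` {..<n}) \<subseteq> lin_comb M u n ` carrier (free_module R n)"
    using span_least linear_image_submodule[OF R.free_module_module module_axioms lin_comb_linear[OF u]
        module.carrier_is_submodule[OF R.free_module_module]] by blast
qed

lemma fg_sub_cover:
  assumes "submodule K R M" "fg_sub R M K"
  shows "\<exists>n. \<exists>f\<in>linear_maps R (free_module R n) M. f ` carrier (free_module R n) = K"
proof -
  obtain S where S: "finite S" "S \<subseteq> K" "submodule_span R M S = K" using assms unfolding fg_sub_def by blast
  obtain u :: "nat \<Rightarrow> 'c" and n where u: "S = u ` {..<n}"
    using finite_imp_nat_seg_image_inj_on[OF S(1)] by (auto simp: lessThan_def)
  have "\<forall>j<n. u j \<in> carrier M" using S(2) u submodule_carrier[OF assms(1)] by auto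
  then show ?thesis using lin_comb_linear lin_comb_image S(3) u by metis
qed

text \<open>Projectivity of free modules, in the form that a total linear relation contains a linear map.\<close>

lemma free_module_select:
  assumes dom: "\<And>v x. P v x \<Longrightarrow> x \<in> carrier M"
    and add: "\<And>v w x y. v \<in> carrier (free_module R n) \<Longrightarrow> w \<in> carrier (free_module R n) \<Longrightarrow>
      P v x \<Longrightarrow> P w y \<Longrightarrow> P (v \<oplus>\<^bsub>free_module R n\<^esub> w) (x \<oplus>\<^bsub>M\<^esub> y)"
    and smult: "\<And>a v x. a \<in> carrier R \<Longrightarrow> v \<in> carrier (free_module R n) \<Longrightarrow> P v x \<Longrightarrow>
      P (a \<odot>\<^bsub>free_module R n\<^esub> v) (a \<odot>\<^bsub>M\<^esub> x)"
    and total: "\<And>v. v \<in> carrier (free_module R n) \<Longrightarrow> \<exists>x. P v x"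
  shows "\<exists>f \<in> carrier (Hom_module R (free_module R n) M). \<forall>v\<in>carrier (free_module R n). P v (f v)"
proof -
  let ?F = "free_module R n"
  interpret F: module R ?F by (rule R.free_module_module)
  have "\<forall>j. \<exists>x. P (unit_vec R n j) x" using total unit_vec_closed by blast
  then obtain u where u: "\<And>j. P (unit_vec R n j) (u j)" by metis
  have uc: "\<forall>j<n. u j \<in> carrier M" using dom u by blast
  have P0: "P \<zero>\<^bsub>?F\<^esub> \<zero>\<^bsub>M\<^esub>"
  proof -
    obtain x where x: "P \<zero>\<^bsub>?F\<^esub> x" using total F.M.zero_closed by blast
    then show ?thesis using smult[OF R.zero_closed F.M.zero_closed x] dom[OF x] by simp
  qed
  have "P v (lin_comb M u n v)" if v: "v \<in> carrier ?F" for v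
  proof -
    \<comment> \<open>Truncations stay in the same free module, and each adds one multiple of a unit
      vector to the previous one, so that additivity of \<open>P\<close> applies.\<close>
    let ?t = "\<lambda>k. \<lambda>i\<in>{..<n}. if i < k then v i else \<zero>"
    have tc: "?t k \<in> carrier ?F" for k using v by (auto simp: free_module_simps PiE_iff)
    have "P (?t k) (lin_comb M u k v)" if "k \<le> n" for k
      using that
    proof (induction k)
      case 0
      have "?t 0 = \<zero>\<^bsub>?F\<^esub>" by (simp add: free_module_simps)
      then show ?case using P0 by (simp only: lin_comb.simps)
    next
      case (Suc k)
      have vk: "v k \<in> carrier R" using v Suc by (auto simp: free_module_simps PiE_iff)
      have "?t (Suc k) = ?t k \<oplus>\<^bsub>?F\<^esub> v k \<odot>\<^bsub>?F\<^esub> unit_vec R n k"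
        using v vk by (auto simp: fun_eq_iff free_module_simps PiE_iff unit_vec_def less_Suc_eq)
      moreover have "P (?t k \<oplus>\<^bsub>?F\<^esub> v k \<odot>\<^bsub>?F\<^esub> unit_vec R n k) (lin_comb M u k v \<oplus>\<^bsub>M\<^esub> v k \<odot>\<^bsub>M\<^esub> u k)"
      proof (rule add[OF tc _ _ smult[OF vk unit_vec_closed u]])
        show "v k \<odot>\<^bsub>?F\<^esub> unit_vec R n k \<in> carrier ?F" using vk unit_vec_closed by simp
        show "P (?t k) (lin_comb M u k v)" using Suc by (meson Suc_leD)
      qed
      ultimately show ?case by (simp only: lin_comb.simps)
    qed
    from this[of n] have "P (?t n) (lin_comb M u n v)" by simp
    moreover have "?t n = v" using v by (auto simp: fun_eq_iff free_module_simps PiE_iff extensional_def)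
    ultimately show ?thesis by simp
  qed
  moreover have "restrict (lin_comb M u n) (carrier ?F) \<in> carrier (Hom_module R ?F M)"
    using lin_comb_linear[OF uc] unfolding Hom_module_def linear_maps_def by auto
  ultimately show ?thesis by (intro bexI[of _ "restrict (lin_comb M u n) (carrier ?F)"]) auto
qed

end

lemma (in cring) submodule_self_iff: "submodule H R (self_module R) \<longleftrightarrow> ideal H R"
proof -
  interpret S: module R "self_module R" by (rule self_module_module)
  show ?thesis
  proof
    assume H: "submodule H R (self_module R)"
    show "ideal H R"
    proof (rule idealI[OF ring_axioms])
      show "subgroup H (add_monoid R)"
      proof
        show "inv\<^bsub>add_monoid R\<^esub> a \<in> H" if "a \<in> H" for a
        proof -
          have "a \<in> carrier R" "(\<ominus> \<one>) \<otimes> a \<in> H"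
            using that S.submoduleE(1,4)[OF H] by (auto simp: self_module_simps)
          then have "\<ominus> a \<in> H" by (simp add: l_minus)
          then show ?thesis by (simp add: a_inv_def)
        qed
      qed (use S.submoduleE[OF H] S.submodule_zero[OF H] in \<open>auto simp: self_module_simps\<close>)
    next
      fix a x assume a: "a \<in> H" and x: "x \<in> carrier R"
      have "a \<in> carrier R" using a S.submoduleE(1)[OF H] by (auto simp: self_module_simps)
      moreover show "x \<otimes> a \<in> H" using a x S.submoduleE(4)[OF H] by (simp add: self_module_simps)
      ultimately show "a \<otimes> x \<in> H" using x m_comm[of x a] by simp
    qed
  next
    assume "ideal H R"
    then interpret ideal H R .
    show "submodule H R (self_module R)"
      by (rule S.submodule_if_closed) (auto simp: self_module_simps I_l_closed)
  qed
qed

lemma (in cring) span_self: "submodule_span R (self_module R) S = Idl S"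
  unfolding submodule_span_def genideal_def submodule_self_iff ..

lemma (in cring) noeth_self:
  assumes "noetherian_ring R" shows "module.noeth R (self_module R)"
proof -
  interpret S: module R "self_module R" by (rule self_module_module)
  show ?thesis unfolding S.noeth_def
  proof (intro allI impI)
    fix K assume "submodule K R (self_module R)"
    then have K: "ideal K R" by (simp add: submodule_self_iff)
    then obtain A where "A \<subseteq> carrier R" "finite A" "K = Idl A"
      using noetherian_ring.finetely_gen[OF assms] by blast
    then show "\<exists>S. finite S \<and> S \<subseteq> K \<and> submodule_span R (self_module R) S = K"
      using genideal_self unfolding span_self by blast
  qed
qed

lemma (in cring) noeth_free: "noetherian_ring R \<Longrightarrow> module.noeth R (free_module R n)"
  unfolding free_module_eq by (intro module.noeth_pow_module self_module_module noeth_self finite_lessThan)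

text \<open>A submodule is pulled back along a cover by a free module of finite rank, which is
  Noetherian, and generators are pushed forward.\<close>

lemma (in module) fin_gen_imp_noeth:
  assumes "noetherian_ring R" "fin_gen_module R M"
  shows noeth
proof -
  have "fg_sub R M (carrier M)" using assms unfolding fin_gen_module_def fg_sub_def by blast
  then obtain n f where f: "f \<in> linear_maps R (free_module R n) M" "f ` carrier (free_module R n) = carrier M"
    using fg_sub_cover[OF carrier_is_submodule] by blast
  interpret F: module R "free_module R n" by (rule R.free_module_module)
  show ?thesis unfolding noeth_iff
  proof (intro allI impI)
    fix K assume K: "submodule K R M"
    let ?T = "{v \<in> carrier (free_module R n). f v \<in> K}"
    have T: "submodule ?T R (free_module R n)"
      by (rule linear_vimage_submodule[OF F.module_axioms module_axioms f(1) F.carrier_is_submodule K])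
    then have "fg_sub R (free_module R n) ?T" using R.noeth_free[OF assms(1)] F.noeth_iff by blast
    from fg_sub_image[OF F.module_axioms module_axioms f(1) T this]
    moreover have "K \<subseteq> f ` carrier (free_module R n)" using f(2) submodule_carrier[OF K] by auto
    then have "f ` ?T = K" by auto
    ultimately show "fg_sub R M K" by simp
  qed
qed

text \<open>One step of a resolution: the kernel is finitely generated because free modules of
  finite rank are Noetherian.\<close>

lemma (in cring) free_kernel_cover:
  assumes noeth: "noetherian_ring R" and Q: "module R Q" and f: "f \<in> linear_maps R (free_module R n) Q"
  shows "\<exists>m. \<exists>d\<in>linear_maps R (free_module R m) (free_module R n).
    d ` carrier (free_module R m) = {v \<in> carrier (free_module R n). f v = \<zero>\<^bsub>Q\<^esub>}"
proof -
  interpret Q: module R Q by (rule Q)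
  interpret F: module R "free_module R n" by (rule free_module_module)
  have K: "submodule {v \<in> carrier (free_module R n). f v \<in> {\<zero>\<^bsub>Q\<^esub>}} R (free_module R n)"
    by (rule linear_vimage_submodule[OF F.module_axioms Q f F.carrier_is_submodule Q.zero_submodule])
  then have "fg_sub R (free_module R n) {v \<in> carrier (free_module R n). f v \<in> {\<zero>\<^bsub>Q\<^esub>}}"
    using noeth_free[OF noeth] F.noeth_iff by blast
  from F.fg_sub_cover[OF K this] show ?thesis by simp
qed

text \<open>Guarantees that the \<open>SOME\<close> in \<open>Ext\<close> selects a genuine
  resolution.\<close>

lemma free_resolution_exists:
  assumes R: "cring R" "noetherian_ring R" and N: "fin_gen_module R N"
  shows "\<exists>C. is_free_resolution R N C"
proof -
  interpret R: cring R by fact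
  interpret N: module R N using N by (simp add: fin_gen_module_def)
  let ?F = "free_module R"
  interpret F: module R "?F n" for n by (rule R.free_module_module)
  have "fg_sub R N (carrier N)" using N unfolding fin_gen_module_def fg_sub_def by blast
  then obtain n0 aug where aug: "aug \<in> linear_maps R (?F n0) N" "aug ` carrier (?F n0) = carrier N"
    using N.fg_sub_cover[OF N.carrier_is_submodule] by blast
  obtain m0 d0 where d0: "d0 \<in> linear_maps R (?F m0) (?F n0)"
    "d0 ` carrier (?F m0) = {v \<in> carrier (?F n0). aug v = \<zero>\<^bsub>N\<^esub>}"
    using R.free_kernel_cover[OF R(2) N.module_axioms aug(1)] by blast
  \<comment> \<open>A triple holds the rank of the target, the rank of the source and the
    differential. \<open>P\<close> ties the initial triple to the augmentation; \<open>Q\<close>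
    matches the ranks of neighbours and expresses exactness between them.\<close>
  define P where "P i x = (case x of (n, m, d) \<Rightarrow> d \<in> linear_maps R (?F m) (?F n) \<and>
      (i = 0 \<longrightarrow> n = n0 \<and> d ` carrier (?F m) = {v \<in> carrier (?F n0). aug v = \<zero>\<^bsub>N\<^esub>}))" for i :: nat and x
  define Q where "Q i x y = (case x of (n, m, d) \<Rightarrow> case y of (n', m', d') \<Rightarrow> n' = m \<and>
      d' ` carrier (?F m') = {v \<in> carrier (?F m). d v = \<zero>\<^bsub>?F n\<^esub>})" for i :: nat and x y
  have "\<exists>f. \<forall>i. P i (f i) \<and> Q i (f i) (f (Suc i))"
  proof (rule dependent_nat_choice)
    show "\<exists>x. P 0 x" using d0 unfolding P_def by (intro exI[of _ "(n0, m0, d0)"]) auto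
    show "\<exists>y. P (Suc i) y \<and> Q i x y" if "P i x" for x i
    proof -
      obtain n m d where x: "x = (n, m, d)" by (cases x)
      then have "d \<in> linear_maps R (?F m) (?F n)" using that by (simp add: P_def)
      from R.free_kernel_cover[OF R(2) F.module_axioms this] obtain m' d' where "d' \<in> linear_maps R (?F m') (?F m)"
        "d' ` carrier (?F m') = {v \<in> carrier (?F m). d v = \<zero>\<^bsub>?F n\<^esub>}" by blast
      then show ?thesis unfolding P_def Q_def x by (intro exI[of _ "(m, m', d')"]) auto
    qed
  qed
  then obtain f where f: "\<And>i. P i (f i)" "\<And>i. Q i (f i) (f (Suc i))" by blast
  define C where "C = \<lparr>res_rank = (\<lambda>i. fst (f i)), res_diff = (\<lambda>i. snd (snd (f i))), res_aug = aug\<rparr>"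
  have rank: "fst (f (Suc i)) = fst (snd (f i))" for i using f(2)[of i] by (auto simp: Q_def split: prod.splits)
  have lin: "snd (snd (f i)) \<in> linear_maps R (?F (fst (f (Suc i)))) (?F (fst (f i)))" for i
    using f(1)[of i] by (auto simp: P_def rank split: prod.splits)
  have ex: "{v \<in> carrier (?F (fst (f (Suc i)))). snd (snd (f i)) v = \<zero>\<^bsub>?F (fst (f i))\<^esub>}
       = snd (snd (f (Suc i))) ` carrier (?F (fst (f (Suc (Suc i)))))" for i
    using f(2)[of i] by (auto simp: Q_def rank split: prod.splits)
  have z: "fst (f 0) = n0" "snd (snd (f 0)) ` carrier (?F (fst (f (Suc 0)))) = {v \<in> carrier (?F n0). aug v = \<zero>\<^bsub>N\<^esub>}"
    using f(1)[of 0] by (auto simp: P_def rank split: prod.splits)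
  have "is_free_resolution R N C"
    unfolding is_free_resolution_def res_module_def C_def free_res.simps
  proof (intro conjI allI)
    show "aug \<in> linear_maps R (?F (fst (f 0))) N" "aug ` carrier (?F (fst (f 0))) = carrier N"
      using aug unfolding z(1) by simp_all
    show "{v \<in> carrier (?F (fst (f 0))). aug v = \<zero>\<^bsub>N\<^esub>} = snd (snd (f 0)) ` carrier (?F (fst (f 1)))"
      using z by simp
    show "snd (snd (f i)) \<in> linear_maps R (?F (fst (f (Suc i)))) (?F (fst (f i)))" for i by (rule lin)
    show "{v \<in> carrier (?F (fst (f (Suc i)))). snd (snd (f i)) v = \<zero>\<^bsub>?F (fst (f i))\<^esub>}
       = snd (snd (f (Suc i))) ` carrier (?F (fst (f (Suc (Suc i)))))" for i by (rule ex)
  qed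
  then show ?thesis ..
qed

section \<open>Ext out of a resolution\<close>

lemma Hom_module_eq:
  "Hom_module R F N = (pow_module (carrier F) N)\<lparr>carrier := linear_maps R F N \<inter> extensional (carrier F)\<rparr>"
  by (simp add: Hom_module_def pow_module_def)

lemma Hom_module_simps:
  "carrier (Hom_module R F N) = linear_maps R F N \<inter> extensional (carrier F)"
  "\<zero>\<^bsub>Hom_module R F N\<^esub> = (\<lambda>i\<in>carrier F. \<zero>\<^bsub>N\<^esub>)"
  "u \<oplus>\<^bsub>Hom_module R F N\<^esub> v = (\<lambda>i\<in>carrier F. u i \<oplus>\<^bsub>N\<^esub> v i)"
  "a \<odot>\<^bsub>Hom_module R F N\<^esub> v = (\<lambda>i\<in>carrier F. a \<odot>\<^bsub>N\<^esub> v i)"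
  by (simp_all add: Hom_module_def)

text \<open>Inside the function module \<open>pow_module (carrier F) N\<close> only closure under
  the operations has to be checked. For scalar multiples it relies on commutativity of
  \<open>R\<close>.\<close>

lemma Hom_module_module:
  assumes F: "module R F" and N: "module R N"
  shows "module R (Hom_module R F N)"
proof -
  interpret F: module R F by fact
  interpret N: module R N by fact
  interpret P: module R "pow_module (carrier F) N" by (rule N.pow_module_module)
  have "submodule (linear_maps R F N \<inter> extensional (carrier F)) R (pow_module (carrier F) N)"
  proof (rule P.submodule_if_closed)
    show "linear_maps R F N \<inter> extensional (carrier F) \<subseteq> carrier (pow_module (carrier F) N)"
      by (auto simp: linear_maps_def pow_module_simps PiE_def)
    show "\<zero>\<^bsub>pow_module (carrier F) N\<^esub> \<in> linear_maps R F N \<inter> extensional (carrier F)"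
      by (auto simp: linear_maps_def pow_module_simps)
    show "f \<oplus>\<^bsub>pow_module (carrier F) N\<^esub> g \<in> linear_maps R F N \<inter> extensional (carrier F)"
      if fg: "f \<in> linear_maps R F N \<inter> extensional (carrier F)" "g \<in> linear_maps R F N \<inter> extensional (carrier F)" for f g
    proof -
      have f: "f \<in> linear_maps R F N" and g: "g \<in> linear_maps R F N" using fg by auto
      show ?thesis using linear_mapsD[OF f] linear_mapsD[OF g]
        by (auto simp: linear_maps_def pow_module_simps N.M.a_ac N.smult_r_distr)
    qed
    show "a \<odot>\<^bsub>pow_module (carrier F) N\<^esub> f \<in> linear_maps R F N \<inter> extensional (carrier F)"
      if a: "a \<in> carrier R" and f: "f \<in> linear_maps R F N \<inter> extensional (carrier F)" for a f
    proof -
      have f: "f \<in> linear_maps R F N" using f by auto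
      show ?thesis using linear_mapsD[OF f] a
        by (auto simp: linear_maps_def pow_module_simps N.smult_r_distr N.smult_assoc1[symmetric] F.R.m_comm)
    qed
  qed
  from submodule.submodule_is_module[OF this P.module_axioms] show ?thesis by (simp add: Hom_module_eq)
qed

definition Hom_into :: "('a, 'r) ring_scheme \<Rightarrow> ('a, 'c, 'n) module_scheme \<Rightarrow> ('a, 'b, 'm) module_scheme
    \<Rightarrow> 'b set \<Rightarrow> ('c \<Rightarrow> 'b) set" where
  "Hom_into R F N L = {f \<in> carrier (Hom_module R F N). \<forall>v\<in>carrier F. f v \<in> L}"

lemma Hom_minus_apply:
  assumes F: "module R F" and N: "module R N"
    and f: "f \<in> carrier (Hom_module R F N)" and g: "g \<in> carrier (Hom_module R F N)" and v: "v \<in> carrier F"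
  shows "(f \<ominus>\<^bsub>Hom_module R F N\<^esub> g) v = f v \<ominus>\<^bsub>N\<^esub> g v"
proof -
  interpret N: module R N by fact
  interpret H: module R "Hom_module R F N" by (rule Hom_module_module[OF F N])
  have "f \<ominus>\<^bsub>Hom_module R F N\<^esub> g = f \<oplus>\<^bsub>Hom_module R F N\<^esub> (\<ominus>\<^bsub>R\<^esub> \<one>\<^bsub>R\<^esub>) \<odot>\<^bsub>Hom_module R F N\<^esub> g"
    using f g by (simp add: H.smult_l_minus a_minus_def)
  then show ?thesis using f g v linear_mapsD(1)[of g R F N v]
    by (simp add: Hom_module_simps N.smult_l_minus a_minus_def)
qed

lemma Hom_cong_iff:
  assumes F: "module R F" and N: "module R N"
    and f: "f \<in> carrier (Hom_module R F N)" and g: "g \<in> carrier (Hom_module R F N)"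
  shows "cong_mod (Hom_module R F N) (Hom_into R F N L) f g \<longleftrightarrow> (\<forall>v\<in>carrier F. cong_mod N L (f v) (g v))"
proof -
  interpret H: module R "Hom_module R F N" by (rule Hom_module_module[OF F N])
  have "f \<ominus>\<^bsub>Hom_module R F N\<^esub> g \<in> carrier (Hom_module R F N)" using f g by simp
  then show ?thesis using f g Hom_minus_apply[OF F N f g] linear_mapsD(1)[of f R F N] linear_mapsD(1)[of g R F N]
    unfolding cong_mod_def Hom_into_def by (auto simp: Hom_module_simps(1))
qed

lemma Hom_into_submodule:
  assumes F: "module R F" and N: "module R N" and L: "submodule L R N"
  shows "submodule (Hom_into R F N L) R (Hom_module R F N)"
proof -
  interpret N: module R N by fact
  interpret H: module R "Hom_module R F N" by (rule Hom_module_module[OF F N])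
  note l = N.submodule_zero[OF L] N.submoduleE(4,5)[OF L]
  show ?thesis
  proof (rule H.submodule_if_closed)
    show "\<zero>\<^bsub>Hom_module R F N\<^esub> \<in> Hom_into R F N L" using l H.M.zero_closed
      unfolding Hom_into_def by (auto simp: Hom_module_simps(2))
    show "f \<oplus>\<^bsub>Hom_module R F N\<^esub> g \<in> Hom_into R F N L" if "f \<in> Hom_into R F N L" "g \<in> Hom_into R F N L" for f g
      using that l H.M.a_closed[of f g] unfolding Hom_into_def by (auto simp: Hom_module_simps(3))
    show "a \<odot>\<^bsub>Hom_module R F N\<^esub> f \<in> Hom_into R F N L" if "a \<in> carrier R" "f \<in> Hom_into R F N L" for a f
      using that l H.smult_closed[of a f] unfolding Hom_into_def by (auto simp: Hom_module_simps(4))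
  qed (auto simp: Hom_into_def)
qed

text \<open>The resolution \<open>D\<close> is arbitrary here; it is instantiated later with the one
  chosen in \<open>Ext\<close>.\<close>

locale resolution = N?: module R N for R :: "('a, 'r) ring_scheme" (structure) and N :: "('a, 'b, 'm) module_scheme" +
  fixes k :: "('a, 'c, 'n) module_scheme" and D :: "('a, 'c) free_res"
  assumes k: "module R k" and D: "is_free_resolution R k D"
begin

abbreviation F :: "nat \<Rightarrow> ('a, nat \<Rightarrow> 'a) module" where "F i \<equiv> res_module R D i"
abbreviation d :: "nat \<Rightarrow> (nat \<Rightarrow> 'a) \<Rightarrow> (nat \<Rightarrow> 'a)" where "d \<equiv> res_diff D"

lemma F: "module R (F i)"
  unfolding res_module_def by (rule N.R.free_module_module)

sublocale F: module R "F i" for i by (rule F)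
sublocale k: module R k by (rule k)

lemma d_linear: "d i \<in> linear_maps R (F (Suc i)) (F i)"
  using D unfolding is_free_resolution_def by blast

lemma exact: "{v \<in> carrier (F (Suc i)). d i v = \<zero>\<^bsub>F i\<^esub>} = d (Suc i) ` carrier (F (Suc (Suc i)))"
  using D unfolding is_free_resolution_def by blast

lemma exact_0: "{v \<in> carrier (F 0). res_aug D v = \<zero>\<^bsub>k\<^esub>} = d 0 ` carrier (F 1)"
  and aug_linear: "res_aug D \<in> linear_maps R (F 0) k"
  and aug_surj: "res_aug D ` carrier (F 0) = carrier k"
  using D unfolding is_free_resolution_def by auto

lemmas d_simps = linear_mapsD[OF d_linear]

lemma dd: "v \<in> carrier (F (Suc (Suc i))) \<Longrightarrow> d i (d (Suc i) v) = \<zero>\<^bsub>F i\<^esub>"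
  using exact[of i] by blast

lemma select:
  assumes Q: "module R Q"
    and dom: "\<And>v x. P v x \<Longrightarrow> x \<in> carrier Q"
    and add: "\<And>v w x y. v \<in> carrier (F i) \<Longrightarrow> w \<in> carrier (F i) \<Longrightarrow>
      P v x \<Longrightarrow> P w y \<Longrightarrow> P (v \<oplus>\<^bsub>F i\<^esub> w) (x \<oplus>\<^bsub>Q\<^esub> y)"
    and smult: "\<And>a v x. a \<in> carrier R \<Longrightarrow> v \<in> carrier (F i) \<Longrightarrow> P v x \<Longrightarrow>
      P (a \<odot>\<^bsub>F i\<^esub> v) (a \<odot>\<^bsub>Q\<^esub> x)"
    and total: "\<And>v. v \<in> carrier (F i) \<Longrightarrow> \<exists>x. P v x"
  shows "\<exists>f \<in> carrier (Hom_module R (F i) Q). \<forall>v\<in>carrier (F i). P v (f v)"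
  unfolding res_module_def
  by (rule module.free_module_select[OF Q]) (use dom add smult total in \<open>auto simp: res_module_def\<close>)

definition hom_d :: "nat \<Rightarrow> ((nat \<Rightarrow> 'a) \<Rightarrow> 'b) \<Rightarrow> ((nat \<Rightarrow> 'a) \<Rightarrow> 'b)" where
  "hom_d i f = compose (carrier (F (Suc i))) f (d i)"

lemma hom_d_apply: "v \<in> carrier (F (Suc i)) \<Longrightarrow> hom_d i f v = f (d i v)"
  by (simp add: hom_d_def compose_def)

lemma hom_d_closed:
  assumes "f \<in> carrier (Hom_module R (F i) N)"
  shows "hom_d i f \<in> carrier (Hom_module R (F (Suc i)) N)"
proof -
  have f: "f \<in> linear_maps R (F i) N" using assms by (simp add: Hom_module_simps)
  show ?thesis using linear_mapsD[OF f] d_simps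
    unfolding Hom_module_simps linear_maps_def hom_d_def compose_def by auto
qed

sublocale hom: cochains R N "\<lambda>i. Hom_module R (F i) N" hom_d "\<lambda>i. Hom_into R (F i) N"
proof (rule cochains.intro)
  fix i
  interpret H: module R "Hom_module R (F i) N" by (rule Hom_module_module[OF F N.module_axioms])
  show "module R N" by (rule N.module_axioms)
  show H: "module R (Hom_module R (F i) N)" by (rule H.module_axioms)
  show "hom_d i \<in> linear_maps R (Hom_module R (F i) N) (Hom_module R (F (Suc i)) N)"
    using hom_d_closed d_simps(1)
    by (auto simp: linear_maps_def[of R "Hom_module R (F i) N"] Hom_module_simps(3,4) fun_eq_iff hom_d_def compose_def)
  fix L assume L: "submodule L R N"
  show "submodule (Hom_into R (F i) N L) R (Hom_module R (F i) N)"
    by (rule Hom_into_submodule[OF F N.module_axioms L])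
  show "hom_d i f \<in> Hom_into R (F (Suc i)) N L" if "f \<in> Hom_into R (F i) N L" for f
    using that hom_d_closed[of f i] d_simps(1) by (auto simp: Hom_into_def hom_d_apply)
  show "hom_d (Suc i) (hom_d i f) \<in> Hom_into R (F (Suc (Suc i))) N L" if f: "f \<in> carrier (Hom_module R (F i) N)" for f
  proof -
    have "hom_d (Suc i) (hom_d i f) v = \<zero>\<^bsub>N\<^esub>" if "v \<in> carrier (F (Suc (Suc i)))" for v
      using that f d_simps(1)[of v "Suc i"] linear_maps_zero[OF F N.module_axioms, of f]
      by (simp add: hom_d_apply dd Hom_module_simps(1))
    then show ?thesis using hom_d_closed[OF hom_d_closed[OF f]] N.submodule_zero[OF L] by (simp add: Hom_into_def)
  qed
  fix y assume y: "y \<in> carrier R"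
  show "f \<in> Hom_into R (F i) N (N.add_mult y L) \<longleftrightarrow>
      (\<exists>g\<in>carrier (Hom_module R (F i) N). cong_mod (Hom_module R (F i) N) (Hom_into R (F i) N L) f (y \<odot>\<^bsub>Hom_module R (F i) N\<^esub> g))"
    (is "?l \<longleftrightarrow> ?r") if f: "f \<in> carrier (Hom_module R (F i) N)" for f
  proof -
    have fl: "f \<in> linear_maps R (F i) N" using f by (simp add: Hom_module_simps)
    note fs = linear_mapsD[OF fl]
    have iff: "cong_mod (Hom_module R (F i) N) (Hom_into R (F i) N L) f (y \<odot>\<^bsub>Hom_module R (F i) N\<^esub> g)
        \<longleftrightarrow> (\<forall>v\<in>carrier (F i). cong_mod N L (f v) (y \<odot>\<^bsub>N\<^esub> g v))" if "g \<in> carrier (Hom_module R (F i) N)" for g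
      using Hom_cong_iff[OF F N.module_axioms f H.smult_closed[OF y that]] by (simp add: Hom_module_simps(4))
    show ?thesis
    proof
      assume ?l
      then have am: "f v \<in> N.add_mult y L" if "v \<in> carrier (F i)" for v using that by (simp add: Hom_into_def)
      \<comment> \<open>This is where freeness enters: a map into \<open>L + yN\<close> is divided
        by \<open>y\<close> modulo \<open>L\<close>, and the entrywise quotients are chosen so as to
        form a linear map.\<close>
      have "\<exists>g\<in>carrier (Hom_module R (F i) N). \<forall>v\<in>carrier (F i). g v \<in> carrier N \<and> cong_mod N L (f v) (y \<odot>\<^bsub>N\<^esub> g v)"
      proof (rule select[OF N.module_axioms])
        show "x \<in> carrier N" if "x \<in> carrier N \<and> cong_mod N L (f v) (y \<odot>\<^bsub>N\<^esub> x)" for v x using that by blast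
        show "\<exists>x. x \<in> carrier N \<and> cong_mod N L (f v) (y \<odot>\<^bsub>N\<^esub> x)" if "v \<in> carrier (F i)" for v
          using am[OF that] unfolding N.add_mult_def by blast
        show "x \<oplus>\<^bsub>N\<^esub> z \<in> carrier N \<and> cong_mod N L (f (v \<oplus>\<^bsub>F i\<^esub> w)) (y \<odot>\<^bsub>N\<^esub> (x \<oplus>\<^bsub>N\<^esub> z))"
          if "v \<in> carrier (F i)" "w \<in> carrier (F i)" "x \<in> carrier N \<and> cong_mod N L (f v) (y \<odot>\<^bsub>N\<^esub> x)"
            "z \<in> carrier N \<and> cong_mod N L (f w) (y \<odot>\<^bsub>N\<^esub> z)" for v w x z
          using that fs y N.cong_mod_add[OF L, of "f v" "y \<odot>\<^bsub>N\<^esub> x" "f w" "y \<odot>\<^bsub>N\<^esub> z"] by (simp add: N.smult_r_distr)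
        show "a \<odot>\<^bsub>N\<^esub> x \<in> carrier N \<and> cong_mod N L (f (a \<odot>\<^bsub>F i\<^esub> v)) (y \<odot>\<^bsub>N\<^esub> (a \<odot>\<^bsub>N\<^esub> x))"
          if "a \<in> carrier R" "v \<in> carrier (F i)" "x \<in> carrier N \<and> cong_mod N L (f v) (y \<odot>\<^bsub>N\<^esub> x)" for a v x
        proof -
          have "y \<odot>\<^bsub>N\<^esub> (a \<odot>\<^bsub>N\<^esub> x) = a \<odot>\<^bsub>N\<^esub> (y \<odot>\<^bsub>N\<^esub> x)"
            using that y by (simp add: N.smult_assoc1[symmetric] N.R.m_comm)
          then show ?thesis using that fs y N.cong_mod_smult[OF L that(1), of "f v" "y \<odot>\<^bsub>N\<^esub> x"] by simp
        qed
      qed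
      then show ?r using iff by blast
    next
      assume ?r
      then obtain g where g: "g \<in> carrier (Hom_module R (F i) N)" "\<forall>v\<in>carrier (F i). cong_mod N L (f v) (y \<odot>\<^bsub>N\<^esub> g v)"
        using iff by blast
      then have "f v \<in> N.add_mult y L" if "v \<in> carrier (F i)" for v
        using that fs(1)[OF that] linear_mapsD(1)[of g R "F i" N v] unfolding N.add_mult_def Hom_module_simps by blast
      then show ?l using f by (simp add: Hom_into_def)
    qed
  qed
  assume reg: "N.regular_mod L y"
  show "g \<in> Hom_into R (F i) N L" if g: "g \<in> carrier (Hom_module R (F i) N)" "y \<odot>\<^bsub>Hom_module R (F i) N\<^esub> g \<in> Hom_into R (F i) N L" for g
    using g reg linear_mapsD(1)[of g R "F i" N] unfolding Hom_into_def N.regular_mod_def by (auto simp: Hom_module_simps)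
qed

text \<open>For \<open>L\<close> the zero submodule congruence is equality, so \<open>hom.Z\<close>
  and \<open>hom.B\<close> are the cocycles and coboundaries of the definition.\<close>

lemma Ext_length:
  "module_length R (Ext_of_resolution R D i N) = rlen R (Hom_module R (F i) N) (hom.B i {\<zero>\<^bsub>N\<^esub>}) (hom.Z i {\<zero>\<^bsub>N\<^esub>})"
proof -
  note z = N.zero_submodule
  have fz: "f \<in> Hom_into R (F i) N {\<zero>\<^bsub>N\<^esub>} \<longleftrightarrow> f = \<zero>\<^bsub>Hom_module R (F i) N\<^esub>" if "f \<in> carrier (Hom_module R (F i) N)" for f i
    using that by (auto simp: Hom_into_def Hom_module_simps fun_eq_iff extensional_def)
  have Z: "Hom_cocycles R D N i = hom.Z i {\<zero>\<^bsub>N\<^esub>}"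
    unfolding Hom_cocycles_def hom.Z_def using hom_d_closed[of _ i] by (auto simp: Hom_into_def hom_d_apply)
  have "Hom_coboundaries R D N i = hom.B i {\<zero>\<^bsub>N\<^esub>}"
  proof (cases i)
    case 0
    have "hom.B 0 {\<zero>\<^bsub>N\<^esub>} = {\<zero>\<^bsub>Hom_module R (F 0) N\<^esub>}"
      using fz[of _ 0] hom.C.M.zero_closed[of 0] unfolding hom.B_0 by (auto simp: Hom_into_def)
    then show ?thesis using 0 by (simp add: Hom_coboundaries_def)
  next
    case (Suc j)
    have eq: "cong_mod (Hom_module R (F (Suc j)) N) (Hom_into R (F (Suc j)) N {\<zero>\<^bsub>N\<^esub>}) f (hom_d j g) \<longleftrightarrow> f = hom_d j g"
      if "f \<in> carrier (Hom_module R (F (Suc j)) N)" "g \<in> carrier (Hom_module R (F j) N)" for f g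
    proof -
      note c = that(1) hom_d_closed[OF that(2)]
      have "f \<ominus>\<^bsub>Hom_module R (F (Suc j)) N\<^esub> hom_d j g = \<zero>\<^bsub>Hom_module R (F (Suc j)) N\<^esub> \<longleftrightarrow> f = hom_d j g"
        using c hom.C.add_minus_cancel(2)[OF c] by (auto simp: a_minus_def hom.C.M.r_neg)
      then show ?thesis using c fz[of "f \<ominus>\<^bsub>Hom_module R (F (Suc j)) N\<^esub> hom_d j g"] unfolding cong_mod_def by simp
    qed
    show ?thesis unfolding Suc hom.B_Suc Hom_coboundaries_def
      using eq hom_d_closed[of _ j] by (auto simp: hom_d_def[symmetric])
  qed
  then show ?thesis unfolding Ext_of_resolution_def Z
    using hom.C.module_length_subquot[OF hom.Z_submodule[OF z] hom.B_submodule[OF z] hom.B_le_Z[OF z]] by simp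
qed

text \<open>A scalar annihilating \<^term>\<open>k\<close> is null-homotopic on the resolution.\<close>

lemma homotopy:
  assumes y: "y \<in> carrier R" and ann: "\<And>x. x \<in> carrier k \<Longrightarrow> y \<odot>\<^bsub>k\<^esub> x = \<zero>\<^bsub>k\<^esub>"
  shows "\<exists>s\<in>linear_maps R (F i) (F (Suc i)).
    (case i of 0 \<Rightarrow> (\<forall>v\<in>carrier (F i). y \<odot>\<^bsub>F i\<^esub> v = d i (s v))
     | Suc j \<Rightarrow> (\<exists>t\<in>linear_maps R (F j) (F i). \<forall>v\<in>carrier (F i). y \<odot>\<^bsub>F i\<^esub> v = d i (s v) \<oplus>\<^bsub>F i\<^esub> t (d j v)))"
proof (induction i)
  case 0
  have "\<exists>s\<in>carrier (Hom_module R (F 0) (F 1)). \<forall>v\<in>carrier (F 0). s v \<in> carrier (F 1) \<and> d 0 (s v) = y \<odot>\<^bsub>F 0\<^esub> v"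
  proof (rule select[OF F])
    fix v assume v: "v \<in> carrier (F 0)"
    have "res_aug D (y \<odot>\<^bsub>F 0\<^esub> v) = \<zero>\<^bsub>k\<^esub>"
      using v y ann linear_mapsD[OF aug_linear] by simp
    then have "y \<odot>\<^bsub>F 0\<^esub> v \<in> d 0 ` carrier (F 1)" using v y exact_0 by auto
    then show "\<exists>x. x \<in> carrier (F 1) \<and> d 0 x = y \<odot>\<^bsub>F 0\<^esub> v" by auto
  next
    fix a v x assume "a \<in> carrier R" "v \<in> carrier (F 0)" "x \<in> carrier (F 1) \<and> d 0 x = y \<odot>\<^bsub>F 0\<^esub> v"
    then show "a \<odot>\<^bsub>F 1\<^esub> x \<in> carrier (F 1) \<and> d 0 (a \<odot>\<^bsub>F 1\<^esub> x) = y \<odot>\<^bsub>F 0\<^esub> (a \<odot>\<^bsub>F 0\<^esub> v)"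
      using d_simps(3)[of a x 0] y by (simp add: F.smult_assoc1[symmetric] N.R.m_comm)
  qed (use d_simps(2)[of _ 0] y in \<open>auto simp: F.smult_r_distr\<close>)
  then show ?case by (auto simp: Hom_module_simps intro!: bexI)
next
  case (Suc i)
  then obtain s where s: "s \<in> linear_maps R (F i) (F (Suc i))" and
    h: "case i of 0 \<Rightarrow> (\<forall>v\<in>carrier (F i). y \<odot>\<^bsub>F i\<^esub> v = d i (s v))
     | Suc j \<Rightarrow> (\<exists>t\<in>linear_maps R (F j) (F i). \<forall>v\<in>carrier (F i). y \<odot>\<^bsub>F i\<^esub> v = d i (s v) \<oplus>\<^bsub>F i\<^esub> t (d j v))" by blast
  note ss = linear_mapsD[OF s]
  \<comment> \<open>The part of the homotopy that factors through the previous differential vanishes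
    on boundaries.\<close>
  have ys: "y \<odot>\<^bsub>F i\<^esub> d i w = d i (s (d i w))" if w: "w \<in> carrier (F (Suc i))" for w
  proof (cases i)
    case 0
    then show ?thesis using h w d_simps(1)[of w i] by simp
  next
    case (Suc j)
    then obtain t where t: "t \<in> linear_maps R (F j) (F i)" "y \<odot>\<^bsub>F i\<^esub> d i w = d i (s (d i w)) \<oplus>\<^bsub>F i\<^esub> t (d j (d i w))"
      using h w d_simps(1)[of w i] by auto
    moreover have "t (d j (d i w)) = \<zero>\<^bsub>F i\<^esub>" using dd[of w j] w Suc linear_maps_zero[OF F F t(1)] by simp
    ultimately show ?thesis using w d_simps(1) ss(1) by simp
  qed
  \<comment> \<open>\<open>s'\<close> is a linear choice of preimages under
    \<open>d (Suc i)\<close>, available because the right-hand side is a cycle by \<open>ys\<close>.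
    The old \<open>s\<close> becomes the second half of the homotopy in the next degree.\<close>
  have "\<exists>s'\<in>carrier (Hom_module R (F (Suc i)) (F (Suc (Suc i)))). \<forall>v\<in>carrier (F (Suc i)).
      s' v \<in> carrier (F (Suc (Suc i))) \<and> d (Suc i) (s' v) = y \<odot>\<^bsub>F (Suc i)\<^esub> v \<ominus>\<^bsub>F (Suc i)\<^esub> s (d i v)"
  proof (rule select[OF F])
    fix v assume v: "v \<in> carrier (F (Suc i))"
    have c: "y \<odot>\<^bsub>F (Suc i)\<^esub> v \<in> carrier (F (Suc i))" "s (d i v) \<in> carrier (F (Suc i))"
      using v y d_simps(1) ss(1) by auto
    have "d i (y \<odot>\<^bsub>F (Suc i)\<^esub> v \<ominus>\<^bsub>F (Suc i)\<^esub> s (d i v)) = \<zero>\<^bsub>F i\<^esub>"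
      using linear_maps_minus[OF F F d_linear c] ys[OF v] v y c d_simps by (simp add: a_minus_def F.M.r_neg)
    then have "y \<odot>\<^bsub>F (Suc i)\<^esub> v \<ominus>\<^bsub>F (Suc i)\<^esub> s (d i v) \<in> d (Suc i) ` carrier (F (Suc (Suc i)))"
      using exact[of i] c by auto
    then show "\<exists>x. x \<in> carrier (F (Suc (Suc i))) \<and> d (Suc i) x = y \<odot>\<^bsub>F (Suc i)\<^esub> v \<ominus>\<^bsub>F (Suc i)\<^esub> s (d i v)"
      by auto
  next
    fix a v x assume a: "a \<in> carrier R" and v: "v \<in> carrier (F (Suc i))" and
      x: "x \<in> carrier (F (Suc (Suc i))) \<and> d (Suc i) x = y \<odot>\<^bsub>F (Suc i)\<^esub> v \<ominus>\<^bsub>F (Suc i)\<^esub> s (d i v)"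
    have c: "y \<odot>\<^bsub>F (Suc i)\<^esub> v \<in> carrier (F (Suc i))" "s (d i v) \<in> carrier (F (Suc i))"
      using v y d_simps(1) ss(1) by auto
    show "a \<odot>\<^bsub>F (Suc (Suc i))\<^esub> x \<in> carrier (F (Suc (Suc i))) \<and>
        d (Suc i) (a \<odot>\<^bsub>F (Suc (Suc i))\<^esub> x) = y \<odot>\<^bsub>F (Suc i)\<^esub> (a \<odot>\<^bsub>F (Suc i)\<^esub> v) \<ominus>\<^bsub>F (Suc i)\<^esub> s (d i (a \<odot>\<^bsub>F (Suc i)\<^esub> v))"
      using a v x y c d_simps ss
      by (simp add: F.smult_minus_distr F.smult_assoc1[symmetric] N.R.m_comm)
  next
    fix v w x z assume v: "v \<in> carrier (F (Suc i))" and w: "w \<in> carrier (F (Suc i))" and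
      x: "x \<in> carrier (F (Suc (Suc i))) \<and> d (Suc i) x = y \<odot>\<^bsub>F (Suc i)\<^esub> v \<ominus>\<^bsub>F (Suc i)\<^esub> s (d i v)" and
      z: "z \<in> carrier (F (Suc (Suc i))) \<and> d (Suc i) z = y \<odot>\<^bsub>F (Suc i)\<^esub> w \<ominus>\<^bsub>F (Suc i)\<^esub> s (d i w)"
    have c: "y \<odot>\<^bsub>F (Suc i)\<^esub> u \<in> carrier (F (Suc i))" "s (d i u) \<in> carrier (F (Suc i))" if "u \<in> carrier (F (Suc i))" for u
      using that y d_simps(1) ss(1) by auto
    show "x \<oplus>\<^bsub>F (Suc (Suc i))\<^esub> z \<in> carrier (F (Suc (Suc i))) \<and>
        d (Suc i) (x \<oplus>\<^bsub>F (Suc (Suc i))\<^esub> z) = y \<odot>\<^bsub>F (Suc i)\<^esub> (v \<oplus>\<^bsub>F (Suc i)\<^esub> w) \<ominus>\<^bsub>F (Suc i)\<^esub> s (d i (v \<oplus>\<^bsub>F (Suc i)\<^esub> w))"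
      using v w x z y c d_simps ss by (simp add: F.smult_r_distr F.add_minus_add)
  qed auto
  then obtain s' where s': "s' \<in> linear_maps R (F (Suc i)) (F (Suc (Suc i)))"
    "\<forall>v\<in>carrier (F (Suc i)). d (Suc i) (s' v) = y \<odot>\<^bsub>F (Suc i)\<^esub> v \<ominus>\<^bsub>F (Suc i)\<^esub> s (d i v)"
    by (auto simp: Hom_module_simps)
  have "\<forall>v\<in>carrier (F (Suc i)). y \<odot>\<^bsub>F (Suc i)\<^esub> v = d (Suc i) (s' v) \<oplus>\<^bsub>F (Suc i)\<^esub> s (d i v)"
  proof
    fix v assume v: "v \<in> carrier (F (Suc i))"
    then show "y \<odot>\<^bsub>F (Suc i)\<^esub> v = d (Suc i) (s' v) \<oplus>\<^bsub>F (Suc i)\<^esub> s (d i v)"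
      using s'(2) F.add_minus_cancel(2)[of "y \<odot>\<^bsub>F (Suc i)\<^esub> v" "Suc i" "s (d i v)"] y d_simps(1) ss(1) by simp
  qed
  then show ?case using s s'(1) by auto
qed

text \<open>Composing \<open>f\<close> with the homotopy splits \<open>y\<close> times
  \<open>f\<close> into a part that evaluates \<open>f\<close> on boundaries, hence has values in
  \<open>L\<close>, and, in positive degree, the coboundary of \<open>f\<close> composed with
  \<open>t\<close>.\<close>

lemma kill:
  assumes y: "y \<in> carrier R" and ann: "\<And>x. x \<in> carrier k \<Longrightarrow> y \<odot>\<^bsub>k\<^esub> x = \<zero>\<^bsub>k\<^esub>"
    and L: "submodule L R N" and f: "f \<in> hom.Z i L"
  shows "y \<odot>\<^bsub>Hom_module R (F i) N\<^esub> f \<in> hom.B i L"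
proof -
  have fc: "f \<in> carrier (Hom_module R (F i) N)" and fd: "\<And>w. w \<in> carrier (F (Suc i)) \<Longrightarrow> f (d i w) \<in> L"
    using f by (auto simp: hom.Z_def Hom_into_def hom_d_apply)
  have fl: "f \<in> linear_maps R (F i) N" using fc by (simp add: Hom_module_simps)
  note fs = linear_mapsD[OF fl]
  obtain s where s: "s \<in> linear_maps R (F i) (F (Suc i))" and
    h: "case i of 0 \<Rightarrow> (\<forall>v\<in>carrier (F i). y \<odot>\<^bsub>F i\<^esub> v = d i (s v))
     | Suc j \<Rightarrow> (\<exists>t\<in>linear_maps R (F j) (F i). \<forall>v\<in>carrier (F i). y \<odot>\<^bsub>F i\<^esub> v = d i (s v) \<oplus>\<^bsub>F i\<^esub> t (d j v))"
    using homotopy[OF y ann, of i] by blast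
  note ss = linear_mapsD[OF s]
  have yf: "y \<odot>\<^bsub>Hom_module R (F i) N\<^esub> f \<in> carrier (Hom_module R (F i) N)" using y fc by simp
  show ?thesis
  proof (cases i)
    case 0
    have "(y \<odot>\<^bsub>Hom_module R (F i) N\<^esub> f) v \<in> L" if v: "v \<in> carrier (F i)" for v
    proof -
      have "(y \<odot>\<^bsub>Hom_module R (F i) N\<^esub> f) v = f (y \<odot>\<^bsub>F i\<^esub> v)" using v y fs by (simp add: Hom_module_simps)
      also have "\<dots> = f (d i (s v))" using h 0 v by simp
      finally show ?thesis using fd ss(1)[OF v] by simp
    qed
    then show ?thesis using yf 0 by (simp add: hom.B_0 Hom_into_def)
  next
    case (Suc j)
    then obtain t where t: "t \<in> linear_maps R (F j) (F i)"
      "\<forall>v\<in>carrier (F i). y \<odot>\<^bsub>F i\<^esub> v = d i (s v) \<oplus>\<^bsub>F i\<^esub> t (d j v)" using h by auto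
    note ts = linear_mapsD[OF t(1)]
    define g where "g = restrict (f \<circ> t) (carrier (F j))"
    have g: "g \<in> carrier (Hom_module R (F j) N)"
      unfolding g_def Hom_module_simps linear_maps_def using ts fs by auto
    have "cong_mod N L ((y \<odot>\<^bsub>Hom_module R (F i) N\<^esub> f) v) (hom_d j g v)" if v: "v \<in> carrier (F i)" for v
    proof -
      have c: "d i (s v) \<in> carrier (F i)" "d j v \<in> carrier (F j)" "t (d j v) \<in> carrier (F i)"
        using v Suc ss(1) d_simps(1)[of _ i] d_simps(1)[of _ j] ts(1) by auto
      have "(y \<odot>\<^bsub>Hom_module R (F i) N\<^esub> f) v = f (y \<odot>\<^bsub>F i\<^esub> v)" using v y fs by (simp add: Hom_module_simps)
      also have "\<dots> = f (d i (s v)) \<oplus>\<^bsub>N\<^esub> f (t (d j v))" using t(2) v fs c by simp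
      also have "f (t (d j v)) = hom_d j g v" using v Suc c by (simp add: hom_d_apply g_def)
      finally have eq: "(y \<odot>\<^bsub>Hom_module R (F i) N\<^esub> f) v = f (d i (s v)) \<oplus>\<^bsub>N\<^esub> hom_d j g v" .
      have "hom_d j g v \<in> carrier N" using v Suc c fs(1) by (simp add: hom_d_apply g_def)
      then show ?thesis unfolding eq using fd[OF ss(1)[OF v]] fs(1)[OF c(1)]
        by (simp add: cong_mod_def N.add_minus_cancel)
    qed
    then have "cong_mod (Hom_module R (F i) N) (Hom_into R (F i) N L) (y \<odot>\<^bsub>Hom_module R (F i) N\<^esub> f) (hom_d j g)"
      using Hom_cong_iff[OF F N.module_axioms yf] hom_d_closed[OF g] Suc by blast
    then show ?thesis using yf g unfolding Suc hom.B_Suc by blast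
  qed
qed

end

section \<open>Colon submodules and quotients by sequences\<close>

context module
begin

text \<open>For \<open>I\<close> the maximal ideal of a local ring this is the preimage in
  \<open>M\<close> of the socle of \<open>M/L\<close>.\<close>

definition colon_sub :: "'c set \<Rightarrow> 'a set \<Rightarrow> 'c set" where
  "colon_sub L I = {u \<in> carrier M. \<forall>a\<in>I. a \<odot>\<^bsub>M\<^esub> u \<in> L}"

lemma colon_sub_submodule:
  assumes L: "submodule L R M" and I: "I \<subseteq> carrier R"
  shows "submodule (colon_sub L I) R M"
proof (rule submodule_if_closed)
  note l = submodule_zero[OF L] submoduleE(4,5)[OF L]
  show "\<zero>\<^bsub>M\<^esub> \<in> colon_sub L I" using l I by (auto simp: colon_sub_def subset_iff)
  show "a \<oplus>\<^bsub>M\<^esub> b \<in> colon_sub L I" if "a \<in> colon_sub L I" "b \<in> colon_sub L I" for a b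
    using that l I by (auto simp: colon_sub_def smult_r_distr subset_iff)
  show "r \<odot>\<^bsub>M\<^esub> u \<in> colon_sub L I" if r: "r \<in> carrier R" and u: "u \<in> colon_sub L I" for r u
  proof -
    have "a \<odot>\<^bsub>M\<^esub> (r \<odot>\<^bsub>M\<^esub> u) = r \<odot>\<^bsub>M\<^esub> (a \<odot>\<^bsub>M\<^esub> u)" if "a \<in> I" for a
      using that I r u by (auto simp: colon_sub_def smult_assoc1[symmetric] R.m_comm subset_iff)
    then show ?thesis using r u l by (auto simp: colon_sub_def)
  qed
qed (auto simp: colon_sub_def)

lemma colon_sub_upper:
  assumes L: "submodule L R M" and I: "I \<subseteq> carrier R"
  shows "L \<subseteq> colon_sub L I"
  using submoduleE(4)[OF L] submodule_carrier[OF L] I by (auto simp: colon_sub_def)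

lemma fold_add_mult_least:
  assumes "submodule H R M" "L \<subseteq> H" "\<And>y u. y \<in> set ys \<Longrightarrow> u \<in> carrier M \<Longrightarrow> y \<odot>\<^bsub>M\<^esub> u \<in> H"
  shows "fold add_mult ys L \<subseteq> H"
  using assms(2,3) by (induction ys arbitrary: L) (auto simp: add_mult_least[OF assms(1)])

lemma fold_add_mult_upper:
  assumes "submodule L R M" "set ys \<subseteq> carrier R"
  shows "L \<subseteq> fold add_mult ys L"
  using assms
proof (induction ys arbitrary: L)
  case (Cons y ys)
  then show ?case using Cons.IH[of "add_mult y L"] add_mult_submodule[of L y] add_mult_upper[of L y] by auto
qed simp

lemma smult_mem_fold_add_mult:
  assumes "submodule L R M" "set ys \<subseteq> carrier R" "y \<in> set ys" "u \<in> carrier M"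
  shows "y \<odot>\<^bsub>M\<^esub> u \<in> fold add_mult ys L"
  using assms
proof (induction ys arbitrary: L)
  case (Cons z ys)
  then have L': "submodule (add_mult z L) R M" using add_mult_submodule[of L z] by auto
  show ?case
  proof (cases "y = z")
    case True
    then have "y \<odot>\<^bsub>M\<^esub> u \<in> add_mult z L" using smult_mem_add_mult[of L z u] Cons by auto
    then show ?thesis using fold_add_mult_upper[OF L', of ys] Cons by auto
  next
    case False
    then show ?thesis using Cons.IH[OF L'] Cons.prems by auto
  qed
qed simp

lemma ideal_times_submodule:
  assumes "I \<subseteq> carrier R"
  shows "submodule (ideal_times_module R I M) R M"
  unfolding ideal_times_module_def using assms by (intro span_submodule) auto

text \<open>Gives the fold an ideal-theoretic meaning; in particular it depends only on the set of
  members of \<open>ys\<close>, which later permits reversing the list.\<close>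

lemma fold_add_mult_eq_ideal_times:
  assumes "set ys \<subseteq> carrier R"
  shows "fold add_mult ys {\<zero>\<^bsub>M\<^esub>} = ideal_times_module R (Idl (set ys)) M"
proof
  let ?L = "fold add_mult ys {\<zero>\<^bsub>M\<^esub>}"
  note L = fold_add_mult_submodule[OF assms zero_submodule]
  have Idl: "ideal (Idl (set ys)) R" by (rule R.genideal_ideal[OF assms])
  then have Ic: "Idl (set ys) \<subseteq> carrier R" by (simp add: ideal.axioms(1) additive_subgroup.a_subset)
  note T = ideal_times_submodule[OF Ic]
  have mem: "a \<odot>\<^bsub>M\<^esub> u \<in> ideal_times_module R (Idl (set ys)) M" if "a \<in> Idl (set ys)" "u \<in> carrier M" for a u
    using that span_upper[of "{a \<odot>\<^bsub>M\<^esub> x | a x. a \<in> Idl (set ys) \<and> x \<in> carrier M}"] unfolding ideal_times_module_def by blast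
  show "?L \<subseteq> ideal_times_module R (Idl (set ys)) M"
    using mem submodule_zero[OF T] R.genideal_self[OF assms] by (intro fold_add_mult_least[OF T]) auto
  \<comment> \<open>The scalars that carry \<open>M\<close> into \<open>?L\<close> form an ideal
    containing \<open>ys\<close>, hence containing the ideal generated by \<open>ys\<close>.\<close>
  let ?J = "{a \<in> carrier R. \<forall>u\<in>carrier M. a \<odot>\<^bsub>M\<^esub> u \<in> ?L}"
  interpret S: module R "self_module R" by (rule R.self_module_module)
  have "submodule ?J R (self_module R)"
    by (rule S.submodule_if_closed)
      (auto simp: self_module_simps smult_l_distr smult_assoc1 intro: submodule_zero[OF L] submoduleE(4,5)[OF L])
  then have "ideal ?J R" by (simp add: R.submodule_self_iff)
  then have "Idl (set ys) \<subseteq> ?J"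
    using smult_mem_fold_add_mult[OF zero_submodule assms] assms by (intro R.genideal_minimal) auto
  then show "ideal_times_module R (Idl (set ys)) M \<subseteq> ?L"
    unfolding ideal_times_module_def by (intro span_least[OF L]) auto
qed

lemma weakly_regular_iff_nth:
  "weakly_regular L ys \<longleftrightarrow> (\<forall>i<length ys. regular_mod (fold add_mult (take i ys) L) (ys ! i))"
  by (induction ys arbitrary: L) (auto simp: All_less_Suc2)

lemma weakly_regular_append:
  "weakly_regular L (xs @ ys) \<longleftrightarrow> weakly_regular L xs \<and> weakly_regular (fold add_mult xs L) ys"
  by (induction xs arbitrary: L) auto

text \<open>Translates the condition on cosets in \<open>quot_module\<close> into conditions inside
  \<open>M\<close>, where the inductions take place.\<close>

lemma regular_sequence_iff:
  assumes "set ys \<subseteq> carrier R"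
  shows "regular_sequence R M ys \<longleftrightarrow> weakly_regular {\<zero>\<^bsub>M\<^esub>} ys \<and> fold add_mult ys {\<zero>\<^bsub>M\<^esub>} \<noteq> carrier M"
proof -
  have "(\<forall>v\<in>carrier (quot_module M L). y \<odot>\<^bsub>quot_module M L\<^esub> v = \<zero>\<^bsub>quot_module M L\<^esub> \<longrightarrow> v = \<zero>\<^bsub>quot_module M L\<^esub>)
      \<longleftrightarrow> regular_mod L y" if "submodule L R M" "y \<in> carrier R" for L y
    using that unfolding regular_mod_def
    by (auto simp: quot_module_simps[OF that(1)] coset_eq_self_iff[OF that(1)])
  moreover have "set (take i ys) \<subseteq> carrier R" "ys ! i \<in> carrier R" if "i < length ys" for i
    using assms that by (auto dest: in_set_takeD)
  ultimately show ?thesis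
    unfolding regular_sequence_def weakly_regular_iff_nth Let_def
    using assms fold_add_mult_submodule[OF _ zero_submodule]
    by (simp add: fold_add_mult_eq_ideal_times[symmetric])
qed

end

section \<open>Ext of R/I: degree zero, and the length of a regular sequence\<close>

locale quotient_resolution = resolution R N "quot_module (self_module R) I" D
  for R :: "('a, 'r) ring_scheme" (structure) and N :: "('a, 'b, 'm) module_scheme"
    and I :: "'a set" and D :: "('a, 'a set) free_res" +
  assumes I: "ideal I R"
begin

text \<open>\<open>Hom(R/I, N/L)\<close> is the part of \<open>N/L\<close> killed by
  \<open>I\<close>, by evaluation at one. On the resolution this means evaluating a cocycle at a
  vector \<open>v0\<close> over the class of one.\<close>

lemma rlen_H0:
  assumes L: "submodule L R N"
  shows "rlen R (Hom_module R (F 0) N) (hom.B 0 L) (hom.Z 0 L) = rlen R N L (N.colon_sub L I)"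
proof -
  interpret S: module R "self_module R" by (rule N.R.self_module_module)
  have Is: "submodule I R (self_module R)" using I by (simp add: N.R.submodule_self_iff)
  have Ic: "I \<subseteq> carrier R" using S.submodule_carrier[OF Is] by (auto simp: self_module_simps)
  let ?c = "\<lambda>a. I +>\<^bsub>self_module R\<^esub> a"
  define k where "k = quot_module (self_module R) I"
  note aug_linear = aug_linear[folded k_def] and aug_surj = aug_surj[folded k_def]
    and exact_0 = exact_0[folded k_def] and k = k[folded k_def]
  interpret kk: module R k by (rule k)
  note q = S.quot_module_simps[OF Is, folded k_def, unfolded self_module_simps]
  note as = linear_mapsD[OF aug_linear]
  have c0: "?c a = \<zero>\<^bsub>k\<^esub> \<longleftrightarrow> a \<in> I" if "a \<in> carrier R" for a
    using S.coset_eq_self_iff[OF Is, of a] that q(2) by (simp add: self_module_simps)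
  have cc: "?c a \<in> carrier k" if "a \<in> carrier R" for a using that q(1) by auto
  have c_eq: "a \<ominus>\<^bsub>R\<^esub> b \<in> I" if "a \<in> carrier R" "b \<in> carrier R" "?c a = ?c b" for a b
  proof -
    have "a \<ominus>\<^bsub>self_module R\<^esub> b \<in> I" using S.coset_eq_iff[OF Is, of a b] that by (simp add: self_module_simps)
    moreover have "a \<ominus>\<^bsub>self_module R\<^esub> b = a \<ominus>\<^bsub>R\<^esub> b"
    proof -
      have "a \<ominus>\<^bsub>self_module R\<^esub> b = a \<oplus>\<^bsub>self_module R\<^esub> (\<ominus>\<^bsub>R\<^esub> \<one>\<^bsub>R\<^esub>) \<odot>\<^bsub>self_module R\<^esub> b"
        using that S.smult_l_minus[of "\<one>\<^bsub>R\<^esub>" b] by (simp add: self_module_simps a_minus_def)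
      then show ?thesis using that by (simp add: self_module_simps a_minus_def N.R.l_minus)
    qed
    ultimately show ?thesis by simp
  qed
  obtain v0 where v0: "v0 \<in> carrier (F 0)" "res_aug D v0 = ?c \<one>\<^bsub>R\<^esub>"
    using aug_surj cc[OF N.R.one_closed] by (metis imageE)
  have ex_a: "\<exists>a\<in>carrier R. res_aug D v = ?c a" if "v \<in> carrier (F 0)" for v
    using as(1)[OF that] unfolding q(1) by auto
  have colon: "a \<odot>\<^bsub>N\<^esub> u \<in> L" if "a \<in> I" "u \<in> N.colon_sub L I" for a u
    using that by (simp add: N.colon_sub_def)
  \<comment> \<open>\<open>f\<close> represents the map sending the class of \<open>a\<close> to
    \<open>a\<close> times \<open>u\<close> modulo \<open>L\<close>. Quantifying over all
    representatives \<open>a\<close> spares a choice and makes the relation visibly linear.\<close>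
  define P where "P f u \<longleftrightarrow> f \<in> carrier (Hom_module R (F 0) N) \<and> u \<in> N.colon_sub L I \<and>
    (\<forall>v\<in>carrier (F 0). \<forall>a\<in>carrier R. res_aug D v = ?c a \<longrightarrow> cong_mod N L (f v) (a \<odot>\<^bsub>N\<^esub> u))" for f u
  have PD: "cong_mod N L (f v) (a \<odot>\<^bsub>N\<^esub> u)"
    if "P f u" "v \<in> carrier (F 0)" "a \<in> carrier R" "res_aug D v = ?c a" for f u v a
    using that by (simp add: P_def)
  have Pf: "f \<in> carrier (Hom_module R (F 0) N)" "f \<in> linear_maps R (F 0) N" "u \<in> N.colon_sub L I" "u \<in> carrier N" if "P f u" for f u
    using that by (auto simp: P_def Hom_module_simps(1) N.colon_sub_def)
  show ?thesis
  proof (rule rlen_rel_eq[where P = P])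
    fix f u assume P: "P f u"
    note fs = linear_mapsD[OF Pf(2)[OF P]]
    have "f (d 0 w) \<in> L" if w: "w \<in> carrier (F 1)" for w
    proof -
      have w': "d 0 w \<in> carrier (F 0)" "res_aug D (d 0 w) = \<zero>\<^bsub>k\<^esub>" using w exact_0 by auto
      have "\<zero>\<^bsub>R\<^esub> \<in> I" using S.submodule_zero[OF Is] by (simp add: self_module_simps)
      then have "cong_mod N L (f (d 0 w)) (\<zero>\<^bsub>R\<^esub> \<odot>\<^bsub>N\<^esub> u)" using PD[OF P w'(1), of "\<zero>\<^bsub>R\<^esub>"] w'(2) c0[of "\<zero>\<^bsub>R\<^esub>"] by simp
      then show ?thesis using N.cong_mod_mem[OF L] N.submodule_zero[OF L] Pf(4)[OF P] by simp
    qed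
    then have "f \<in> hom.Z 0 L" using Pf(1)[OF P] hom_d_closed[OF Pf(1)[OF P]]
      by (auto simp: hom.Z_def Hom_into_def hom_d_apply)
    then show "f \<in> hom.Z 0 L \<and> u \<in> N.colon_sub L I" using Pf(3)[OF P] by simp
    show "f \<in> hom.B 0 L \<longleftrightarrow> u \<in> L"
    proof
      assume "f \<in> hom.B 0 L"
      then have "f v0 \<in> L" using v0 by (simp add: hom.B_0 Hom_into_def)
      then show "u \<in> L" using N.cong_mod_mem[OF L PD[OF P v0(1) _ v0(2)]] Pf(4)[OF P] by simp
    next
      assume u: "u \<in> L"
      have "f v \<in> L" if v: "v \<in> carrier (F 0)" for v
      proof -
        obtain a where a: "a \<in> carrier R" "res_aug D v = ?c a" using ex_a[OF v] by auto
        show ?thesis using N.cong_mod_mem[OF L PD[OF P v a]] N.submoduleE(4)[OF L a(1) u] by simp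
      qed
      then show "f \<in> hom.B 0 L" using Pf(1)[OF P] by (simp add: hom.B_0 Hom_into_def)
    qed
  next
    fix f u f' u' assume P: "P f u" "P f' u'"
    show "P (f \<oplus>\<^bsub>Hom_module R (F 0) N\<^esub> f') (u \<oplus>\<^bsub>N\<^esub> u')"
      unfolding P_def
    proof (intro conjI ballI impI)
      show "f \<oplus>\<^bsub>Hom_module R (F 0) N\<^esub> f' \<in> carrier (Hom_module R (F 0) N)"
        using Pf(1)[OF P(1)] Pf(1)[OF P(2)] by simp
      show "u \<oplus>\<^bsub>N\<^esub> u' \<in> N.colon_sub L I"
        using N.submoduleE(5)[OF N.colon_sub_submodule[OF L Ic]] Pf(3)[OF P(1)] Pf(3)[OF P(2)] by blast
      show "cong_mod N L ((f \<oplus>\<^bsub>Hom_module R (F 0) N\<^esub> f') v) (a \<odot>\<^bsub>N\<^esub> (u \<oplus>\<^bsub>N\<^esub> u'))"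
        if "v \<in> carrier (F 0)" "a \<in> carrier R" "res_aug D v = ?c a" for v a
        using N.cong_mod_add[OF L PD[OF P(1) that] PD[OF P(2) that]] that Pf(4)[OF P(1)] Pf(4)[OF P(2)]
        by (simp add: Hom_module_simps(3) N.smult_r_distr)
    qed
  next
    fix r f u assume r: "r \<in> carrier R" and P: "P f u"
    show "P (r \<odot>\<^bsub>Hom_module R (F 0) N\<^esub> f) (r \<odot>\<^bsub>N\<^esub> u)"
      unfolding P_def
    proof (intro conjI ballI impI)
      show "r \<odot>\<^bsub>Hom_module R (F 0) N\<^esub> f \<in> carrier (Hom_module R (F 0) N)"
        using Pf(1)[OF P] r by simp
      show "r \<odot>\<^bsub>N\<^esub> u \<in> N.colon_sub L I"
        using N.submoduleE(4)[OF N.colon_sub_submodule[OF L Ic] r] Pf(3)[OF P] by blast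
      show "cong_mod N L ((r \<odot>\<^bsub>Hom_module R (F 0) N\<^esub> f) v) (a \<odot>\<^bsub>N\<^esub> (r \<odot>\<^bsub>N\<^esub> u))"
        if v: "v \<in> carrier (F 0)" "a \<in> carrier R" "res_aug D v = ?c a" for v a
      proof -
        have "a \<odot>\<^bsub>N\<^esub> (r \<odot>\<^bsub>N\<^esub> u) = r \<odot>\<^bsub>N\<^esub> (a \<odot>\<^bsub>N\<^esub> u)"
          using v r Pf(4)[OF P] by (simp add: N.smult_assoc1[symmetric] N.R.m_comm)
        then show ?thesis using N.cong_mod_smult[OF L r PD[OF P v]] v by (simp add: Hom_module_simps(4))
      qed
    qed
  next
    fix f assume f: "f \<in> hom.Z 0 L"
    then have fc: "f \<in> carrier (Hom_module R (F 0) N)" and fd: "\<And>w. w \<in> carrier (F 1) \<Longrightarrow> f (d 0 w) \<in> L"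
      by (auto simp: hom.Z_def Hom_into_def hom_d_apply)
    have fl: "f \<in> linear_maps R (F 0) N" using fc by (simp add: Hom_module_simps)
    note fs = linear_mapsD[OF fl]
    \<comment> \<open>\<open>v\<close> and \<open>a\<close> times \<open>v0\<close> have the same
      image in \<open>R/I\<close>, so they differ by a boundary, on which the cocycle
      \<open>f\<close> has values in \<open>L\<close>.\<close>
    have key: "cong_mod N L (f v) (a \<odot>\<^bsub>N\<^esub> f v0)" if v: "v \<in> carrier (F 0)" and a: "a \<in> carrier R" "res_aug D v = ?c a" for v a
    proof -
      have av: "a \<odot>\<^bsub>F 0\<^esub> v0 \<in> carrier (F 0)" using a v0 by simp
      have "res_aug D (v \<ominus>\<^bsub>F 0\<^esub> a \<odot>\<^bsub>F 0\<^esub> v0) = ?c a \<ominus>\<^bsub>k\<^esub> a \<odot>\<^bsub>k\<^esub> ?c \<one>\<^bsub>R\<^esub>"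
        using linear_maps_minus[OF F k aug_linear v av] as(3)[OF a(1) v0(1)] a v0 by simp
      also have "a \<odot>\<^bsub>k\<^esub> ?c \<one>\<^bsub>R\<^esub> = ?c a" using q(4)[OF a(1), of "\<one>\<^bsub>R\<^esub>"] a by simp
      finally have "res_aug D (v \<ominus>\<^bsub>F 0\<^esub> a \<odot>\<^bsub>F 0\<^esub> v0) = \<zero>\<^bsub>k\<^esub>"
        using cc[OF a(1)] by (simp add: a_minus_def kk.M.r_neg)
      moreover have "v \<ominus>\<^bsub>F 0\<^esub> a \<odot>\<^bsub>F 0\<^esub> v0 \<in> carrier (F 0)" using v av by simp
      ultimately obtain w where w: "w \<in> carrier (F 1)" "v \<ominus>\<^bsub>F 0\<^esub> a \<odot>\<^bsub>F 0\<^esub> v0 = d 0 w"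
        using exact_0 by blast
      have "f (v \<ominus>\<^bsub>F 0\<^esub> a \<odot>\<^bsub>F 0\<^esub> v0) = f v \<ominus>\<^bsub>N\<^esub> a \<odot>\<^bsub>N\<^esub> f v0"
        using linear_maps_minus[OF F N.module_axioms fl v av] fs(3)[OF a(1) v0(1)] by simp
      then have "f v \<ominus>\<^bsub>N\<^esub> a \<odot>\<^bsub>N\<^esub> f v0 \<in> L" using fd[OF w(1)] w(2) by simp
      then show ?thesis using fs(1)[OF v] fs(1)[OF v0(1)] a by (simp add: cong_mod_def)
    qed
    have "a \<odot>\<^bsub>N\<^esub> f v0 \<in> L" if a: "a \<in> I" for a
    proof -
      have aR: "a \<in> carrier R" using a Ic by blast
      have "res_aug D (a \<odot>\<^bsub>F 0\<^esub> v0) = ?c a" using as(3)[OF aR v0(1)] v0(2) q(4)[OF aR, of "\<one>\<^bsub>R\<^esub>"] aR by simp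
      also have "\<dots> = ?c \<zero>\<^bsub>R\<^esub>" using c0[OF aR] c0[of "\<zero>\<^bsub>R\<^esub>"] a S.submodule_zero[OF Is] by (simp add: self_module_simps)
      finally have "cong_mod N L (f (a \<odot>\<^bsub>F 0\<^esub> v0)) (\<zero>\<^bsub>R\<^esub> \<odot>\<^bsub>N\<^esub> f v0)" using key[of "a \<odot>\<^bsub>F 0\<^esub> v0" "\<zero>\<^bsub>R\<^esub>"] aR v0(1) by simp
      then show ?thesis using N.cong_mod_mem[OF L] N.submodule_zero[OF L] fs(1,3) v0(1) aR by simp
    qed
    then have "f v0 \<in> N.colon_sub L I" using fs(1)[OF v0(1)] by (simp add: N.colon_sub_def)
    then show "\<exists>u. P f u" using key fc unfolding P_def by blast
  next
    fix u assume u: "u \<in> N.colon_sub L I"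
    then have uc: "u \<in> carrier N" by (simp add: N.colon_sub_def)
    \<comment> \<open>The values of \<open>f\<close> are prescribed modulo \<open>L\<close> and
      lifted to \<open>N\<close> by freeness. The prescription is consistent because representatives
      of a class differ by an element of \<open>I\<close>, which carries \<open>u\<close> into
      \<open>L\<close>.\<close>
    have "\<exists>f\<in>carrier (Hom_module R (F 0) N). \<forall>v\<in>carrier (F 0). f v \<in> carrier N \<and>
      (\<forall>a\<in>carrier R. res_aug D v = ?c a \<longrightarrow> cong_mod N L (f v) (a \<odot>\<^bsub>N\<^esub> u))"
    proof (rule select[OF N.module_axioms])
      fix v assume v: "v \<in> carrier (F 0)"
      obtain a where a: "a \<in> carrier R" "res_aug D v = ?c a" using ex_a[OF v] by auto
      have "cong_mod N L (a \<odot>\<^bsub>N\<^esub> u) (b \<odot>\<^bsub>N\<^esub> u)" if b: "b \<in> carrier R" "res_aug D v = ?c b" for b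
      proof -
        have "(a \<ominus>\<^bsub>R\<^esub> b) \<odot>\<^bsub>N\<^esub> u \<in> L" using colon[OF _ u] c_eq[of a b] a b by simp
        then show ?thesis using a b uc by (simp add: cong_mod_def a_minus_def N.smult_l_distr N.smult_l_minus)
      qed
      then show "\<exists>x. x \<in> carrier N \<and> (\<forall>b\<in>carrier R. res_aug D v = ?c b \<longrightarrow> cong_mod N L x (b \<odot>\<^bsub>N\<^esub> u))"
        using a uc by (intro exI[of _ "a \<odot>\<^bsub>N\<^esub> u"]) auto
    next
      fix v w x y
      assume v: "v \<in> carrier (F 0)" and w: "w \<in> carrier (F 0)" and
        x: "x \<in> carrier N \<and> (\<forall>a\<in>carrier R. res_aug D v = ?c a \<longrightarrow> cong_mod N L x (a \<odot>\<^bsub>N\<^esub> u))" and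
        y: "y \<in> carrier N \<and> (\<forall>a\<in>carrier R. res_aug D w = ?c a \<longrightarrow> cong_mod N L y (a \<odot>\<^bsub>N\<^esub> u))"
      obtain a where a: "a \<in> carrier R" "res_aug D v = ?c a" using ex_a[OF v] by auto
      obtain b where b: "b \<in> carrier R" "res_aug D w = ?c b" using ex_a[OF w] by auto
      have "cong_mod N L (x \<oplus>\<^bsub>N\<^esub> y) (e \<odot>\<^bsub>N\<^esub> u)" if e: "e \<in> carrier R" "res_aug D (v \<oplus>\<^bsub>F 0\<^esub> w) = ?c e" for e
      proof -
        have "?c e = ?c (a \<oplus>\<^bsub>R\<^esub> b)" using e as(2)[OF v w] a b q(3)[OF a(1) b(1)] by simp
        then have *: "(a \<oplus>\<^bsub>R\<^esub> b) \<ominus>\<^bsub>R\<^esub> e \<in> I" using c_eq a b e by simp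
        have "((a \<oplus>\<^bsub>R\<^esub> b) \<ominus>\<^bsub>R\<^esub> e) \<odot>\<^bsub>N\<^esub> u \<in> L" using colon[OF * u] .
        then have "cong_mod N L ((a \<oplus>\<^bsub>R\<^esub> b) \<odot>\<^bsub>N\<^esub> u) (e \<odot>\<^bsub>N\<^esub> u)"
          using a b e uc by (simp add: cong_mod_def a_minus_def N.smult_l_distr N.smult_l_minus)
        moreover have "cong_mod N L (x \<oplus>\<^bsub>N\<^esub> y) (a \<odot>\<^bsub>N\<^esub> u \<oplus>\<^bsub>N\<^esub> b \<odot>\<^bsub>N\<^esub> u)"
          using N.cong_mod_add[OF L] x y a b by blast
        ultimately show ?thesis using a b uc N.cong_mod_trans[OF L] by (simp add: N.smult_l_distr)
      qed
      then show "x \<oplus>\<^bsub>N\<^esub> y \<in> carrier N \<and> (\<forall>e\<in>carrier R. res_aug D (v \<oplus>\<^bsub>F 0\<^esub> w) = ?c e \<longrightarrow> cong_mod N L (x \<oplus>\<^bsub>N\<^esub> y) (e \<odot>\<^bsub>N\<^esub> u))"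
        using x y by auto
    next
      fix r v x
      assume r: "r \<in> carrier R" and v: "v \<in> carrier (F 0)" and
        x: "x \<in> carrier N \<and> (\<forall>a\<in>carrier R. res_aug D v = ?c a \<longrightarrow> cong_mod N L x (a \<odot>\<^bsub>N\<^esub> u))"
      obtain a where a: "a \<in> carrier R" "res_aug D v = ?c a" using ex_a[OF v] by auto
      have "cong_mod N L (r \<odot>\<^bsub>N\<^esub> x) (e \<odot>\<^bsub>N\<^esub> u)" if e: "e \<in> carrier R" "res_aug D (r \<odot>\<^bsub>F 0\<^esub> v) = ?c e" for e
      proof -
        have "?c e = ?c (r \<otimes>\<^bsub>R\<^esub> a)" using e as(3)[OF r v] a q(4)[OF r a(1)] by simp
        then have *: "(r \<otimes>\<^bsub>R\<^esub> a) \<ominus>\<^bsub>R\<^esub> e \<in> I" using c_eq a r e by simp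
        have "((r \<otimes>\<^bsub>R\<^esub> a) \<ominus>\<^bsub>R\<^esub> e) \<odot>\<^bsub>N\<^esub> u \<in> L" using colon[OF * u] .
        then have "cong_mod N L ((r \<otimes>\<^bsub>R\<^esub> a) \<odot>\<^bsub>N\<^esub> u) (e \<odot>\<^bsub>N\<^esub> u)"
          using a r e uc by (simp add: cong_mod_def a_minus_def N.smult_l_distr N.smult_l_minus)
        moreover have "cong_mod N L (r \<odot>\<^bsub>N\<^esub> x) (r \<odot>\<^bsub>N\<^esub> (a \<odot>\<^bsub>N\<^esub> u))"
          using N.cong_mod_smult[OF L r] x a by blast
        ultimately show ?thesis using a r uc N.cong_mod_trans[OF L] by (simp add: N.smult_assoc1)
      qed
      then show "r \<odot>\<^bsub>N\<^esub> x \<in> carrier N \<and> (\<forall>e\<in>carrier R. res_aug D (r \<odot>\<^bsub>F 0\<^esub> v) = ?c e \<longrightarrow> cong_mod N L (r \<odot>\<^bsub>N\<^esub> x) (e \<odot>\<^bsub>N\<^esub> u))"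
        using x r by auto
    qed auto
    then show "\<exists>f. P f u" using u unfolding P_def by blast
  next
    show "L \<subseteq> N.colon_sub L I" by (rule N.colon_sub_upper[OF L Ic])
    show "submodule (N.colon_sub L I) R N" by (rule N.colon_sub_submodule[OF L Ic])
  qed (use hom.C N.module_axioms hom.Z_submodule[OF L] hom.B_submodule[OF L] hom.B_le_Z[OF L] L in auto)
qed

end

text \<open>Elements of \<open>I\<close> annihilate \<open>R/I\<close>, hence the cohomology in
  every degree and for every \<open>L\<close> by null-homotopy, so dimension shifting along
  \<open>ys\<close> leads from degree \<open>length ys\<close> down to degree zero over
  \<open>N/L\<close>.\<close>

lemma Ext_length_eq_socle:
  assumes R: "cring R" "noetherian_ring R" and I: "ideal I R" and N: "module R N"
    and ys: "set ys \<subseteq> I" "module.weakly_regular N {\<zero>\<^bsub>N\<^esub>} ys"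
  defines "L \<equiv> fold (module.add_mult N) ys {\<zero>\<^bsub>N\<^esub>}"
  shows "module_length R (Ext R (length ys) (quot_module (self_module R) I) N) = rlen R N L (module.colon_sub N L I)"
proof -
  interpret R: cring R by fact
  interpret N: module R N by fact
  interpret S: module R "self_module R" by (rule R.self_module_module)
  have Is: "submodule I R (self_module R)" using I by (simp add: R.submodule_self_iff)
  have Ic: "I \<subseteq> carrier R" using S.submodule_carrier[OF Is] by (auto simp: self_module_simps)
  define k where "k = quot_module (self_module R) I"
  have km: "module R k" unfolding k_def by (rule S.quot_module_module[OF Is])
  have proj: "(\<lambda>a. I +>\<^bsub>self_module R\<^esub> a) \<in> linear_maps R (self_module R) k"
    unfolding linear_maps_def k_def using S.quot_module_simps[OF Is] by (auto simp: self_module_simps)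
  have "fg_sub R (self_module R) (carrier R)"
    using R.noeth_self[OF R(2)] S.carrier_is_submodule by (simp add: S.noeth_iff self_module_simps)
  then have "fg_sub R k ((\<lambda>a. I +>\<^bsub>self_module R\<^esub> a) ` carrier R)"
    using fg_sub_image[OF S.module_axioms km proj, of "carrier R"] S.carrier_is_submodule
    by (simp add: self_module_simps)
  then have "fg_sub R k (carrier k)" using S.quot_module_simps(1)[OF Is] unfolding k_def by (simp add: self_module_simps)
  then have "fin_gen_module R k" unfolding fin_gen_module_def fg_sub_def using km by blast
  from free_resolution_exists[OF R this]
  \<comment> \<open>From here on the resolution selected by \<open>Ext\<close> is known only through
    this property.\<close>
  have D: "is_free_resolution R k (SOME C. is_free_resolution R k C)" by (rule someI_ex)
  define D where "D = (SOME C. is_free_resolution R k C)"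
  interpret quotient_resolution R N I D
    by (intro quotient_resolution.intro resolution.intro resolution_axioms.intro quotient_resolution_axioms.intro)
      (use N km D I in \<open>simp_all add: D_def k_def\<close>)
  have ann: "y \<odot>\<^bsub>k\<^esub> x = \<zero>\<^bsub>k\<^esub>" if y: "y \<in> I" and x: "x \<in> carrier k" for x y
  proof -
    obtain a where a: "a \<in> carrier R" "x = I +>\<^bsub>self_module R\<^esub> a"
      using x S.quot_module_simps(1)[OF Is] unfolding k_def by (auto simp: self_module_simps)
    have "y \<otimes>\<^bsub>R\<^esub> a \<in> I" using ideal.I_r_closed[OF I y a(1)] .
    then show ?thesis using S.quot_module_simps(2,4)[OF Is] S.coset_eq_self_iff[OF Is, of "y \<otimes>\<^bsub>R\<^esub> a"] y Ic a
      unfolding k_def by (auto simp: self_module_simps)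
  qed
  have kl: "y \<odot>\<^bsub>Hom_module R (F i) N\<^esub> g \<in> hom.B i L" if "y \<in> set ys" "submodule L R N" "g \<in> hom.Z i L" for y i L g
    using kill[OF _ ann[unfolded k_def] that(2,3)] that(1) ys(1) Ic by auto
  have "module_length R (Ext R (length ys) k N) =
    rlen R (Hom_module R (F (length ys)) N) (hom.B (length ys) {\<zero>\<^bsub>N\<^esub>}) (hom.Z (length ys) {\<zero>\<^bsub>N\<^esub>})"
    using Ext_length[of "length ys"] by (simp add: Ext_def D_def k_def)
  also have "\<dots> = rlen R (Hom_module R (F 0) N) (hom.B 0 L) (hom.Z 0 L)"
    unfolding L_def using ys Ic by (intro hom.rlen_cohomology_shift N.zero_submodule kl) auto
  also have "\<dots> = rlen R N L (N.colon_sub L I)"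
    using rlen_H0 N.fold_add_mult_submodule[OF _ N.zero_submodule, of ys] ys(1) Ic unfolding L_def by auto
  finally show ?thesis by (simp add: k_def)
qed

section \<open>The Koszul complex\<close>

text \<open>
  A Koszul cochain assigns a value to each subset of the sequence \<^term>\<open>xs\<close>, coded by a list of
  Booleans of the same length. In this form the complex of \<^term>\<open>x # xs\<close> is, by recursion, the
  mapping cone of multiplication by \<^term>\<open>x\<close> on the complex of \<^term>\<open>xs\<close>.
\<close>

primrec kos :: "('a, 'b, 'm) module_scheme \<Rightarrow> 'a list \<Rightarrow> (bool list \<Rightarrow> 'b) \<Rightarrow> bool list \<Rightarrow> 'b" where
  "kos N [] f = (\<lambda>l. \<zero>\<^bsub>N\<^esub>)"
| "kos N (x # xs) f = (\<lambda>l. case l of [] \<Rightarrow> \<zero>\<^bsub>N\<^esub>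
     | b # l' \<Rightarrow> if b then x \<odot>\<^bsub>N\<^esub> f (False # l') \<ominus>\<^bsub>N\<^esub> kos N xs (\<lambda>l. f (True # l)) l'
               else kos N xs (\<lambda>l. f (False # l)) l')"

text \<open>Contraction with the basis vector in position \<open>j\<close>; the sign changes once
  for every \<open>True\<close> passed on the way to that position.\<close>

primrec kos_contract :: "('b, 'm) ring_scheme \<Rightarrow> nat \<Rightarrow> (bool list \<Rightarrow> 'b) \<Rightarrow> bool list \<Rightarrow> 'b" where
  "kos_contract N 0 f = (\<lambda>l. case l of [] \<Rightarrow> \<zero>\<^bsub>N\<^esub> | b # l' \<Rightarrow> if b then \<zero>\<^bsub>N\<^esub> else f (True # l'))"
| "kos_contract N (Suc j) f = (\<lambda>l. case l of [] \<Rightarrow> \<zero>\<^bsub>N\<^esub>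
     | b # l' \<Rightarrow> if b then \<ominus>\<^bsub>N\<^esub> kos_contract N j (\<lambda>l. f (True # l)) l'
               else kos_contract N j (\<lambda>l. f (False # l)) l')"

text \<open>A list stands for the subset of positions marked \<open>True\<close>, and the number of
  marks is the cohomological degree.\<close>

definition kos_index :: "nat \<Rightarrow> nat \<Rightarrow> bool list set" where
  "kos_index n i = {l. length l = n \<and> count_list l True = i}"

lemma kos_index_0: "kos_index 0 i = (if i = 0 then {[]} else {})"
  by (auto simp: kos_index_def)

lemma mem_kos_index_Cons:
  "b # l \<in> kos_index (Suc n) i \<longleftrightarrow> (if b then i \<noteq> 0 \<and> l \<in> kos_index n (i - 1) else l \<in> kos_index n i)"
  by (auto simp: kos_index_def)

lemma kos_index_Suc_cases:
  assumes "l \<in> kos_index (Suc n) i"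
  obtains l' where "l = False # l'" "l' \<in> kos_index n i"
    | l' j where "l = True # l'" "i = Suc j" "l' \<in> kos_index n j"
  using assms by (cases l; cases "hd l"; cases i) (auto simp: kos_index_def)

lemma kos_index_gt: "n < i \<Longrightarrow> kos_index n i = {}"
  by (auto simp: kos_index_def) (metis count_le_length not_le)

lemma kos_index_top: "l \<in> kos_index n n \<longleftrightarrow> l = replicate n True"
proof (induction n arbitrary: l)
  case (Suc n)
  show ?case
  proof (cases l)
    case (Cons b l')
    then show ?thesis using Suc.IH[of l'] kos_index_gt[of n "Suc n"]
      by (auto simp: mem_kos_index_Cons)
  qed (auto simp: kos_index_def)
qed (auto simp: kos_index_0)

lemma finite_kos_index: "finite (kos_index n i)"
  by (rule finite_subset[OF _ finite_lists_length_eq[of UNIV n]]) (auto simp: kos_index_def)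

context module
begin

lemma kos_closed:
  "set xs \<subseteq> carrier R \<Longrightarrow> \<forall>l. f l \<in> carrier M \<Longrightarrow> kos M xs f l \<in> carrier M"
  by (induction xs arbitrary: f l) (auto split: list.split)

lemma kos_zero: "set xs \<subseteq> carrier R \<Longrightarrow> kos M xs (\<lambda>l. \<zero>\<^bsub>M\<^esub>) l = \<zero>\<^bsub>M\<^esub>"
  by (induction xs arbitrary: l) (auto split: list.split)

lemma kos_add:
  assumes "set xs \<subseteq> carrier R" "\<forall>l. f l \<in> carrier M" "\<forall>l. g l \<in> carrier M"
  shows "kos M xs (\<lambda>l. f l \<oplus>\<^bsub>M\<^esub> g l) l = kos M xs f l \<oplus>\<^bsub>M\<^esub> kos M xs g l"
  using assms
proof (induction xs arbitrary: f g l)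
  case (Cons x xs)
  show ?case
  proof (cases l)
    case (Cons b l')
    have "kos M xs (\<lambda>l. f (True # l)) l' \<in> carrier M" "kos M xs (\<lambda>l. g (True # l)) l' \<in> carrier M"
      using Cons.prems by (auto intro!: kos_closed)
    then show ?thesis using Cons Cons.IH[of "\<lambda>l. f (b # l)" "\<lambda>l. g (b # l)" l'] Cons.prems
      by (cases b) (auto simp: smult_r_distr add_minus_add)
  qed simp
qed simp

lemma kos_smult:
  assumes "set xs \<subseteq> carrier R" "\<forall>l. f l \<in> carrier M" "a \<in> carrier R"
  shows "kos M xs (\<lambda>l. a \<odot>\<^bsub>M\<^esub> f l) l = a \<odot>\<^bsub>M\<^esub> kos M xs f l"
  using assms
proof (induction xs arbitrary: f l)
  case (Cons x xs)
  show ?case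
  proof (cases l)
    case (Cons b l')
    have "kos M xs (\<lambda>l. f (True # l)) l' \<in> carrier M"
      using Cons.prems by (auto intro!: kos_closed)
    moreover have "x \<odot>\<^bsub>M\<^esub> (a \<odot>\<^bsub>M\<^esub> f (False # l')) = a \<odot>\<^bsub>M\<^esub> (x \<odot>\<^bsub>M\<^esub> f (False # l'))"
      using Cons.prems by (simp add: smult_assoc1[symmetric] R.m_comm)
    ultimately show ?thesis using Cons Cons.IH[of "\<lambda>l. f (b # l)" l'] Cons.prems
      by (cases b) (auto simp: smult_minus_distr)
  qed (use Cons.prems in simp)
qed simp

lemma kos_minus:
  assumes "set xs \<subseteq> carrier R" "\<forall>l. f l \<in> carrier M" "\<forall>l. g l \<in> carrier M"
  shows "kos M xs (\<lambda>l. f l \<ominus>\<^bsub>M\<^esub> g l) l = kos M xs f l \<ominus>\<^bsub>M\<^esub> kos M xs g l"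
proof -
  have m: "x \<ominus>\<^bsub>M\<^esub> y = x \<oplus>\<^bsub>M\<^esub> (\<ominus> \<one>) \<odot>\<^bsub>M\<^esub> y" if "y \<in> carrier M" for x y
    using that by (simp add: smult_l_minus a_minus_def)
  have "(\<lambda>l. f l \<ominus>\<^bsub>M\<^esub> g l) = (\<lambda>l. f l \<oplus>\<^bsub>M\<^esub> (\<ominus> \<one>) \<odot>\<^bsub>M\<^esub> g l)" using assms m by auto
  then show ?thesis using assms kos_closed[OF assms(1,3)]
    by (simp add: kos_add kos_smult m)
qed

text \<open>A cochain of the cone is a pair \<open>(f0, f1)\<close>, sent to
  \<open>(d f0, x f0 - d f1)\<close>. Applied twice, the second entry is
  \<open>x d f0 - d (x f0) + d d f1\<close>, which vanishes by linearity and induction.\<close>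

lemma kos_kos:
  assumes "set xs \<subseteq> carrier R" "\<forall>l. f l \<in> carrier M"
  shows "kos M xs (kos M xs f) l = \<zero>\<^bsub>M\<^esub>"
  using assms
proof (induction xs arbitrary: f l)
  case (Cons x xs)
  have xs: "set xs \<subseteq> carrier R" and x: "x \<in> carrier R" using Cons.prems by auto
  show ?case
  proof (cases l)
    case (Cons b l')
    have c: "\<forall>l. x \<odot>\<^bsub>M\<^esub> f (False # l) \<in> carrier M" "\<forall>l. kos M xs (\<lambda>l. f (b # l)) l \<in> carrier M" for b
      using Cons.prems by (auto intro!: kos_closed)
    have "kos M xs (\<lambda>l. x \<odot>\<^bsub>M\<^esub> f (False # l) \<ominus>\<^bsub>M\<^esub> kos M xs (\<lambda>l. f (True # l)) l) l' =
      x \<odot>\<^bsub>M\<^esub> kos M xs (\<lambda>l. f (False # l)) l'"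
      using kos_minus[OF xs c(1) c(2)] kos_smult[OF xs _ x] Cons.IH[OF xs, of "\<lambda>l. f (True # l)"] Cons.prems c(2)
      by simp
    then show ?thesis using Cons Cons.IH[OF xs, of "\<lambda>l. f (False # l)"] Cons.prems x c(2)[of False]
      by (cases b) (auto simp: a_minus_def M.r_neg)
  qed simp
qed simp

lemma kos_index_zero: "l \<in> kos_index (length xs) 0 \<Longrightarrow> kos M xs f l = \<zero>\<^bsub>M\<^esub>"
  by (induction xs arbitrary: f l) (auto split: list.split simp: kos_index_def)

lemma kos_in_submodule:
  assumes "submodule L R M" "set xs \<subseteq> carrier R" "\<forall>l\<in>kos_index (length xs) i. f l \<in> L"
    and "l \<in> kos_index (length xs) (Suc i)"
  shows "kos M xs f l \<in> L"
  using assms(2-4)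
proof (induction xs arbitrary: f l i)
  case Nil then show ?case by (simp add: kos_index_0)
next
  case (Cons x xs)
  note L = submoduleE(4)[OF assms(1)] submodule_minus[OF assms(1)] submodule_zero[OF assms(1)]
  have xs: "set xs \<subseteq> carrier R" and x: "x \<in> carrier R" using Cons.prems by auto
  from Cons.prems(3) have "l \<in> kos_index (Suc (length xs)) (Suc i)" by simp
  then show ?case
  proof (cases rule: kos_index_Suc_cases)
    case (1 l')
    then show ?thesis using Cons.IH[OF xs, of i "\<lambda>l. f (False # l)" l'] Cons.prems(2)
      by (auto simp: mem_kos_index_Cons)
  next
    case (2 l' j)
    have 1: "x \<odot>\<^bsub>M\<^esub> f (False # l') \<in> L" using L(1)[OF x] Cons.prems(2) 2 by (auto simp: mem_kos_index_Cons)
    have "kos M xs (\<lambda>l. f (True # l)) l' \<in> L"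
    proof (cases i)
      case 0
      then show ?thesis using 2 L(3) kos_index_zero[of l' xs] by auto
    next
      case (Suc k)
      then show ?thesis using Cons.IH[OF xs, of k "\<lambda>l. f (True # l)" l'] Cons.prems(2) 2
        by (auto simp: mem_kos_index_Cons)
    qed
    then show ?thesis using 1 2 L(2) by simp
  qed
qed

lemma kos_contract_closed:
  "\<forall>l. f l \<in> carrier M \<Longrightarrow> kos_contract M j f l \<in> carrier M"
  by (induction j arbitrary: f l) (auto split: list.split)

lemma kos_contract_minus:
  assumes "\<forall>l. f l \<in> carrier M" "\<forall>l. g l \<in> carrier M"
  shows "kos_contract M j (\<lambda>l. f l \<ominus>\<^bsub>M\<^esub> g l) l = kos_contract M j f l \<ominus>\<^bsub>M\<^esub> kos_contract M j g l"
  using assms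
proof (induction j arbitrary: f g l)
  case 0 then show ?case by (auto split: list.split)
next
  case (Suc j)
  show ?case
  proof (cases l)
    case (Cons b l')
    have "kos_contract M j (\<lambda>l. f (b # l)) l' \<in> carrier M" "kos_contract M j (\<lambda>l. g (b # l)) l' \<in> carrier M"
      using Suc.prems by (auto intro!: kos_contract_closed)
    then show ?thesis using Cons Suc.IH[of "\<lambda>l. f (b # l)" "\<lambda>l. g (b # l)" l'] Suc.prems
      by (cases b) (auto simp: a_minus_def M.minus_add)
  qed simp
qed

lemma kos_contract_smult:
  assumes "\<forall>l. f l \<in> carrier M" "a \<in> carrier R"
  shows "kos_contract M j (\<lambda>l. a \<odot>\<^bsub>M\<^esub> f l) l = a \<odot>\<^bsub>M\<^esub> kos_contract M j f l"
  using assms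
proof (induction j arbitrary: f l)
  case 0 then show ?case by (auto split: list.split)
next
  case (Suc j)
  show ?case
  proof (cases l)
    case (Cons b l')
    have "kos_contract M j (\<lambda>l. f (b # l)) l' \<in> carrier M"
      using Suc.prems by (auto intro!: kos_contract_closed)
    then show ?thesis using Cons Suc.IH[of "\<lambda>l. f (b # l)" l'] Suc.prems
      by (cases b) (auto simp: smult_r_minus)
  qed (use Suc.prems in simp)
qed

lemma kos_uminus:
  assumes "set xs \<subseteq> carrier R" "\<forall>l. f l \<in> carrier M"
  shows "kos M xs (\<lambda>l. \<ominus>\<^bsub>M\<^esub> f l) l = \<ominus>\<^bsub>M\<^esub> kos M xs f l"
proof -
  have "(\<lambda>l. \<ominus>\<^bsub>M\<^esub> f l) = (\<lambda>l. (\<ominus> \<one>) \<odot>\<^bsub>M\<^esub> f l)" using assms by (auto simp: smult_l_minus)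
  then show ?thesis using kos_smult[OF assms, of "\<ominus> \<one>"] kos_closed[OF assms] by (simp add: smult_l_minus)
qed

text \<open>For \<open>j = 0\<close> the two summands combine directly. For larger \<open>j\<close>
  the cross terms with the head \<open>x\<close> cancel because of the sign in
  \<open>kos_contract\<close>, and induction settles the rest.\<close>

lemma kos_homotopy:
  assumes "set xs \<subseteq> carrier R" "\<forall>l. f l \<in> carrier M" "j < length xs" "length l = length xs"
  shows "kos M xs (kos_contract M j f) l \<oplus>\<^bsub>M\<^esub> kos_contract M j (kos M xs f) l = xs ! j \<odot>\<^bsub>M\<^esub> f l"
  using assms
proof (induction xs arbitrary: f j l)
  case (Cons x xs)
  have xs: "set xs \<subseteq> carrier R" and x: "x \<in> carrier R" using Cons.prems by auto
  obtain b l' where l: "l = b # l'" "length l' = length xs" using Cons.prems by (cases l) auto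
  have fc: "\<forall>l. f (b # l) \<in> carrier M" for b using Cons.prems by auto
  have kc: "kos M xs (\<lambda>l. f (b # l)) l' \<in> carrier M" for b l' using kos_closed[OF xs fc] by auto
  show ?case
  proof (cases j)
    case 0
    show ?thesis
    proof (cases b)
      case True
      then show ?thesis using 0 l x fc kos_zero[OF xs] by simp
    next
      case False
      have "kos M xs (\<lambda>l. f (True # l)) l' \<oplus>\<^bsub>M\<^esub> (x \<odot>\<^bsub>M\<^esub> f (False # l') \<ominus>\<^bsub>M\<^esub> kos M xs (\<lambda>l. f (True # l)) l') = x \<odot>\<^bsub>M\<^esub> f (False # l')"
        using kc[of True l'] x fc[of False] add_minus_cancel(2)[of "x \<odot>\<^bsub>M\<^esub> f (False # l')" "kos M xs (\<lambda>l. f (True # l)) l'"]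
        by (simp add: M.a_comm)
      then show ?thesis using 0 l False by simp
    qed
  next
    case (Suc i)
    let ?f0 = "\<lambda>l. f (False # l)" and ?f1 = "\<lambda>l. f (True # l)"
    have cc: "\<forall>l. kos_contract M i (\<lambda>l. f (b # l)) l \<in> carrier M" for b using kos_contract_closed[OF fc] by auto
    have IH: "kos M xs (kos_contract M i (\<lambda>l. f (b # l))) l' \<oplus>\<^bsub>M\<^esub> kos_contract M i (kos M xs (\<lambda>l. f (b # l))) l' = xs ! i \<odot>\<^bsub>M\<^esub> f (b # l')" for b
      using Cons.IH[OF xs fc, of i l'] Cons.prems Suc l by auto
    show ?thesis
    proof (cases b)
      case False
      then show ?thesis using IH[of False] Suc l by simp
    next
      case True
      let ?A = "x \<odot>\<^bsub>M\<^esub> kos_contract M i ?f0 l'"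
      let ?B = "kos M xs (kos_contract M i ?f1) l'" and ?C = "kos_contract M i (kos M xs ?f1) l'"
      have c: "?A \<in> carrier M" "?B \<in> carrier M" "?C \<in> carrier M"
        using cc x kos_closed[OF xs cc] kos_contract_closed[of "kos M xs ?f1"] kc by auto
      have e1: "kos M xs (\<lambda>l. \<ominus>\<^bsub>M\<^esub> kos_contract M i ?f1 l) l' = \<ominus>\<^bsub>M\<^esub> ?B" using kos_uminus[OF xs cc] by simp
      have "\<forall>l. x \<odot>\<^bsub>M\<^esub> ?f0 l \<in> carrier M" using x fc by auto
      then have e2: "kos_contract M i (\<lambda>l. x \<odot>\<^bsub>M\<^esub> ?f0 l \<ominus>\<^bsub>M\<^esub> kos M xs ?f1 l) l' = ?A \<ominus>\<^bsub>M\<^esub> ?C"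
        using kos_contract_minus[of "\<lambda>l. x \<odot>\<^bsub>M\<^esub> ?f0 l" "kos M xs ?f1" i l'] kos_contract_smult[OF fc x] kc by simp
      have "(?A \<ominus>\<^bsub>M\<^esub> (\<ominus>\<^bsub>M\<^esub> ?B)) \<oplus>\<^bsub>M\<^esub> \<ominus>\<^bsub>M\<^esub> (?A \<ominus>\<^bsub>M\<^esub> ?C) = (?A \<oplus>\<^bsub>M\<^esub> ?B) \<oplus>\<^bsub>M\<^esub> (?C \<ominus>\<^bsub>M\<^esub> ?A)"
        using c minus_swap[of ?A ?C] by (simp add: a_minus_def)
      also have "\<dots> = ?B \<oplus>\<^bsub>M\<^esub> (?A \<oplus>\<^bsub>M\<^esub> (?C \<ominus>\<^bsub>M\<^esub> ?A))" using c by (simp add: M.a_ac)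
      also have "?A \<oplus>\<^bsub>M\<^esub> (?C \<ominus>\<^bsub>M\<^esub> ?A) = ?C" using c add_minus_cancel(2)[of ?C ?A] by (simp add: M.a_comm)
      finally show ?thesis using IH[of True] e1 e2 Suc l True by simp
    qed
  qed
qed simp

lemma kos_contract_in_submodule:
  assumes "submodule L R M" "\<forall>l\<in>kos_index n (Suc i). f l \<in> L" "l \<in> kos_index n i" "j < n"
  shows "kos_contract M j f l \<in> L"
  using assms(2-4)
proof (induction j arbitrary: f l n i)
  case 0
  then obtain m where n: "n = Suc m" by (cases n) auto
  show ?case using 0(2)[unfolded n]
  proof (cases rule: kos_index_Suc_cases)
    case (1 l') then show ?thesis using 0 n by (auto simp: mem_kos_index_Cons)
  qed (use submodule_zero[OF assms(1)] in auto)
next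
  case (Suc j)
  then obtain m where n: "n = Suc m" by (cases n) auto
  show ?case using Suc(3)[unfolded n]
  proof (cases rule: kos_index_Suc_cases)
    case (1 l')
    then show ?thesis using Suc.IH[of m i "\<lambda>l. f (False # l)" l'] Suc.prems n by (auto simp: mem_kos_index_Cons)
  next
    case (2 l' k)
    then show ?thesis using Suc.IH[of m k "\<lambda>l. f (True # l)" l'] Suc.prems n submoduleE(3)[OF assms(1)]
      by (auto simp: mem_kos_index_Cons)
  qed
qed

lemma kos_in_ideal_times:
  assumes "submodule H R M" "set xs \<subseteq> carrier R" "\<And>x u. x \<in> set xs \<Longrightarrow> u \<in> carrier M \<Longrightarrow> x \<odot>\<^bsub>M\<^esub> u \<in> H"
    and "\<forall>l. f l \<in> carrier M"
  shows "kos M xs f l \<in> H"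
  using assms(2-4)
  by (induction xs arbitrary: f l)
    (auto split: list.split intro: submodule_zero[OF assms(1)] submodule_minus[OF assms(1)])

text \<open>At the list with all entries \<open>True\<close> the differential is a signed sum of
  multiples by the members of \<open>xs\<close>, with independent entries of \<open>f\<close>; so
  every element of \<open>(xs)M\<close> occurs there.\<close>

lemma ideal_times_in_kos:
  assumes "set xs \<subseteq> carrier R" "u \<in> fold add_mult xs {\<zero>\<^bsub>M\<^esub>}"
  shows "\<exists>f. (\<forall>l. f l \<in> carrier M) \<and> kos M xs f (replicate (length xs) True) = u"
proof -
  have K: "submodule {kos M xs f (replicate (length xs) True) | f. \<forall>l. f l \<in> carrier M} R M" (is "submodule ?K R M")
    if "set xs \<subseteq> carrier R" for xs
  proof (rule submodule_if_closed)
    show "?K \<subseteq> carrier M" using kos_closed[OF that] by auto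
    show "\<zero>\<^bsub>M\<^esub> \<in> ?K" using kos_zero[OF that, of "replicate (length xs) True"]
      by (intro CollectI exI[of _ "\<lambda>l. \<zero>\<^bsub>M\<^esub>"]) auto
    show "a \<oplus>\<^bsub>M\<^esub> b \<in> ?K" if ab: "a \<in> ?K" "b \<in> ?K" for a b
    proof -
      from ab obtain f g where "\<forall>l. f l \<in> carrier M" "\<forall>l. g l \<in> carrier M"
        "a = kos M xs f (replicate (length xs) True)" "b = kos M xs g (replicate (length xs) True)" by auto
      then show ?thesis using kos_add[OF \<open>set xs \<subseteq> carrier R\<close>]
        by (intro CollectI exI[of _ "\<lambda>l. f l \<oplus>\<^bsub>M\<^esub> g l"]) auto
    qed
    show "r \<odot>\<^bsub>M\<^esub> a \<in> ?K" if r: "r \<in> carrier R" "a \<in> ?K" for r a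
    proof -
      from r obtain f where "\<forall>l. f l \<in> carrier M" "a = kos M xs f (replicate (length xs) True)" by auto
      then show ?thesis using kos_smult[OF \<open>set xs \<subseteq> carrier R\<close>] r(1)
        by (intro CollectI exI[of _ "\<lambda>l. r \<odot>\<^bsub>M\<^esub> f l"]) auto
    qed
  qed
  have gen: "\<exists>f. (\<forall>l. f l \<in> carrier M) \<and> kos M xs f (replicate (length xs) True) = y \<odot>\<^bsub>M\<^esub> v"
    if "set xs \<subseteq> carrier R" "y \<in> set xs" "v \<in> carrier M" for xs y v
    using that
  proof (induction xs)
    case (Cons x xs)
    show ?case
    proof (cases "y = x")
      case True
      \<comment> \<open>Supported on the subset that omits just the head, the one entry that the
        differential multiplies by \<open>x\<close> here.\<close>
      let ?f = "\<lambda>l. if l = False # replicate (length xs) True then v else \<zero>\<^bsub>M\<^esub>"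
      have "kos M (x # xs) ?f (replicate (length (x # xs)) True) = x \<odot>\<^bsub>M\<^esub> v"
        using kos_zero[of xs] Cons.prems by simp
      then show ?thesis using True Cons.prems by (intro exI[of _ ?f]) auto
    next
      case False
      then obtain f where f: "\<forall>l. f l \<in> carrier M" "kos M xs f (replicate (length xs) True) = y \<odot>\<^bsub>M\<^esub> v"
        using Cons by auto
      \<comment> \<open>The sign undoes the one in the cone.\<close>
      let ?f = "\<lambda>l. case l of [] \<Rightarrow> \<zero>\<^bsub>M\<^esub> | b # l' \<Rightarrow> if b then \<ominus>\<^bsub>M\<^esub> f l' else \<zero>\<^bsub>M\<^esub>"
      have "kos M (x # xs) ?f (replicate (length (x # xs)) True) = y \<odot>\<^bsub>M\<^esub> v"
        using kos_uminus[of xs f] f Cons.prems smult_closed[of y v] by (auto simp: a_minus_def)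
      then show ?thesis using f by (intro exI[of _ ?f]) (auto split: list.split)
    qed
  qed simp
  have "fold add_mult xs {\<zero>\<^bsub>M\<^esub>} \<subseteq> {kos M xs f (replicate (length xs) True) | f. \<forall>l. f l \<in> carrier M}"
  proof (rule fold_add_mult_least[OF K[OF assms(1)]])
    show "{\<zero>\<^bsub>M\<^esub>} \<subseteq> {kos M xs f (replicate (length xs) True) |f. \<forall>l. f l \<in> carrier M}"
      using submodule_zero[OF K[OF assms(1)]] by auto
    show "y \<odot>\<^bsub>M\<^esub> v \<in> {kos M xs f (replicate (length xs) True) |f. \<forall>l. f l \<in> carrier M}"
      if yv: "y \<in> set xs" "v \<in> carrier M" for y v
    proof -
      obtain f where "\<forall>l. f l \<in> carrier M" "kos M xs f (replicate (length xs) True) = y \<odot>\<^bsub>M\<^esub> v"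
        using gen[OF assms(1) yv] by auto
      then show ?thesis by (intro CollectI exI[of _ f]) simp
    qed
  qed
  then show ?thesis using assms(2) by auto
qed

end

text \<open>Induction on \<open>S\<close>, the generators of \<open>Z\<close> modulo
  \<open>B\<close>. Some \<open>w\<close> in \<open>Z\<close> has \<open>u\<close> congruent to
  \<open>x\<close> times \<open>w\<close>; expressing \<open>w\<close> through the generators puts
  \<open>(1 - x a) u\<close> in the span of the others, and \<open>1 - x a\<close> is a unit, so
  \<open>u\<close> can be omitted.\<close>

lemma (in module) nakayama:
  assumes "finite S" "submodule B R M" "submodule Z R M" "S \<subseteq> Z" "Z \<subseteq> submodule_span R M (B \<union> S)"
    and B: "B \<subseteq> Z" and x: "x \<in> carrier R" and unit: "\<And>a. a \<in> carrier R \<Longrightarrow> \<one> \<ominus> x \<otimes> a \<in> Units R"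
    and div: "\<And>z. z \<in> Z \<Longrightarrow> \<exists>w\<in>Z. z \<ominus>\<^bsub>M\<^esub> x \<odot>\<^bsub>M\<^esub> w \<in> B"
  shows "Z \<subseteq> B"
  using assms(1,4,5)
proof (induction S)
  case empty
  then show ?case using span_least[OF assms(2), of "B \<union> {}"] by auto
next
  case (insert u S)
  note B' = assms(2) and Z' = assms(3)
  let ?H = "submodule_span R M (B \<union> S)"
  have S: "B \<union> S \<subseteq> carrier M" using B insert.prems submodule_carrier[OF Z'] by blast
  note H = span_submodule[OF S]
  have up: "B \<subseteq> ?H" "S \<subseteq> ?H" using span_upper[of "B \<union> S"] by auto
  have uZ: "u \<in> Z" and u: "u \<in> carrier M" using insert.prems submodule_carrier[OF Z'] by auto
  note C = cyclic_submodule[OF u] and HC = sum_sub_submodule[OF H cyclic_submodule[OF u]]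
  have "submodule_span R M (B \<union> insert u S) \<subseteq> sum_sub ?H (cyclic u)"
    using sum_sub_upper[OF H C] up cyclic_self[OF u] by (intro span_least[OF HC]) auto
  then have ZHC: "Z \<subseteq> sum_sub ?H (cyclic u)" using insert.prems by auto
  obtain w where w: "w \<in> Z" "u \<ominus>\<^bsub>M\<^esub> x \<odot>\<^bsub>M\<^esub> w \<in> B" using div[OF uZ] by auto
  then obtain h a where ha: "h \<in> ?H" "a \<in> carrier R" "w = h \<oplus>\<^bsub>M\<^esub> a \<odot>\<^bsub>M\<^esub> u"
    using ZHC unfolding sum_sub_def cyclic_def by blast
  have hc: "h \<in> carrier M" "w \<in> carrier M" using ha submodule_carrier[OF H] w submodule_carrier[OF Z'] by auto
  have "(u \<ominus>\<^bsub>M\<^esub> x \<odot>\<^bsub>M\<^esub> w) \<oplus>\<^bsub>M\<^esub> x \<odot>\<^bsub>M\<^esub> h \<in> ?H"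
    using w(2) up submoduleE(4)[OF H x ha(1)] submoduleE(5)[OF H] by blast
  also have "(u \<ominus>\<^bsub>M\<^esub> x \<odot>\<^bsub>M\<^esub> w) \<oplus>\<^bsub>M\<^esub> x \<odot>\<^bsub>M\<^esub> h = (u \<ominus>\<^bsub>M\<^esub> (x \<otimes> a) \<odot>\<^bsub>M\<^esub> u \<ominus>\<^bsub>M\<^esub> x \<odot>\<^bsub>M\<^esub> h) \<oplus>\<^bsub>M\<^esub> x \<odot>\<^bsub>M\<^esub> h"
    using hc ha x u by (simp add: smult_r_distr smult_assoc1 a_minus_def M.minus_add M.a_ac)
  also have "\<dots> = u \<ominus>\<^bsub>M\<^esub> (x \<otimes> a) \<odot>\<^bsub>M\<^esub> u" using hc ha x u by (simp add: add_minus_cancel)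
  also have "\<dots> = (\<one> \<ominus> x \<otimes> a) \<odot>\<^bsub>M\<^esub> u" using ha x u by (simp add: a_minus_def smult_l_distr smult_l_minus)
  finally have "(\<one> \<ominus> x \<otimes> a) \<odot>\<^bsub>M\<^esub> u \<in> ?H" .
  then have "inv (\<one> \<ominus> x \<otimes> a) \<odot>\<^bsub>M\<^esub> ((\<one> \<ominus> x \<otimes> a) \<odot>\<^bsub>M\<^esub> u) \<in> ?H"
    using submoduleE(4)[OF H] unit[OF ha(2)] by auto
  then have "u \<in> ?H" using unit[OF ha(2)] u ha x smult_assoc1[of "inv (\<one> \<ominus> x \<otimes> a)" "\<one> \<ominus> x \<otimes> a" u] by simp
  then have "submodule_span R M (B \<union> insert u S) \<subseteq> ?H" using up by (intro span_least[OF H]) auto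
  then show ?case using insert by auto
qed

section \<open>Koszul cohomology: annihilators and vanishing\<close>

lemma (in cochains) mem_B_Suc:
  assumes "f \<in> B i L" "i = Suc j"
  obtains g where "g \<in> carrier (C j)" "cong_mod (C i) (V i L) f (\<delta> j g)"
  using assms by (auto simp: B_Suc)

lemma pow_UNIV_simps:
  "carrier (pow_module UNIV N) = {f. \<forall>l. f l \<in> carrier N}"
  "\<zero>\<^bsub>pow_module UNIV N\<^esub> = (\<lambda>l. \<zero>\<^bsub>N\<^esub>)"
  "u \<oplus>\<^bsub>pow_module UNIV N\<^esub> v = (\<lambda>l. u l \<oplus>\<^bsub>N\<^esub> v l)"
  "a \<odot>\<^bsub>pow_module UNIV N\<^esub> v = (\<lambda>l. a \<odot>\<^bsub>N\<^esub> v l)"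
  by (auto simp: pow_module_simps PiE_UNIV_domain)

lemma (in module) pow_UNIV_minus:
  assumes "u \<in> carrier (pow_module UNIV M)" "v \<in> carrier (pow_module UNIV M)"
  shows "u \<ominus>\<^bsub>pow_module UNIV M\<^esub> v = (\<lambda>l. u l \<ominus>\<^bsub>M\<^esub> v l)"
  using pow_module_minus[OF assms] by (simp add: restrict_def)

definition kos_into :: "('b, 'm) ring_scheme \<Rightarrow> nat \<Rightarrow> nat \<Rightarrow> 'b set \<Rightarrow> (bool list \<Rightarrow> 'b) set" where
  "kos_into N n i L = {f. (\<forall>l. f l \<in> carrier N) \<and> (\<forall>l\<in>kos_index n i. f l \<in> L)}"

locale koszul = N?: module R N for R :: "('a, 'r) ring_scheme" (structure) and N :: "('a, 'b, 'm) module_scheme" +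
  fixes xs :: "'a list"
  assumes xs: "set xs \<subseteq> carrier R"
begin

abbreviation "n \<equiv> length xs"

sublocale P: module R "pow_module UNIV N :: ('a, bool list \<Rightarrow> 'b) module" by (rule N.pow_module_module)

lemma kos_into_cong_iff:
  assumes "f \<in> carrier (pow_module UNIV N)" "g \<in> carrier (pow_module UNIV N)"
  shows "cong_mod (pow_module UNIV N) (kos_into N n i L) f g \<longleftrightarrow> (\<forall>l\<in>kos_index n i. cong_mod N L (f l) (g l))"
  using assms by (auto simp: cong_mod_def kos_into_def N.pow_UNIV_minus pow_UNIV_simps(1))

text \<open>All degrees share one function module; the degree enters only through
  \<open>kos_into\<close>, which constrains the values on \<open>kos_index n i\<close>. Dividing by
  \<open>y\<close> modulo \<open>L\<close> is done entrywise, by choice.\<close>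

sublocale kos: cochains R N "\<lambda>_. pow_module UNIV N" "\<lambda>_. kos N xs" "\<lambda>i. kos_into N n i"
proof (rule cochains.intro)
  show "module R N" by (rule N.module_axioms)
  show "module R (pow_module UNIV N :: ('a, bool list \<Rightarrow> 'b) module)" by (rule P.module_axioms)
  show "kos N xs \<in> linear_maps R (pow_module UNIV N) (pow_module UNIV N)"
    using N.kos_closed[OF xs] N.kos_add[OF xs] N.kos_smult[OF xs]
    by (auto simp: linear_maps_def pow_UNIV_simps)
  fix i L assume L: "submodule L R N"
  note l = N.submodule_zero[OF L] N.submoduleE(4,5)[OF L]
  show "submodule (kos_into N n i L) R (pow_module UNIV N)"
    by (rule P.submodule_if_closed) (use l in \<open>auto simp: pow_UNIV_simps kos_into_def\<close>)
  show "kos N xs f \<in> kos_into N n (Suc i) L" if "f \<in> kos_into N n i L" for f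
    using that N.kos_closed[OF xs] N.kos_in_submodule[OF L xs] unfolding kos_into_def by auto
  show "kos N xs (kos N xs f) \<in> kos_into N n (Suc (Suc i)) L" if "f \<in> carrier (pow_module UNIV N)" for f
    using that N.kos_kos[OF xs] l by (auto simp: kos_into_def pow_UNIV_simps)
  fix y assume y: "y \<in> carrier R"
  show "f \<in> kos_into N n i (N.add_mult y L) \<longleftrightarrow>
      (\<exists>g\<in>carrier (pow_module UNIV N). cong_mod (pow_module UNIV N) (kos_into N n i L) f (y \<odot>\<^bsub>pow_module UNIV N\<^esub> g))"
    (is "?l \<longleftrightarrow> ?r") if f: "f \<in> carrier (pow_module UNIV N)" for f
  proof -
    have iff: "cong_mod (pow_module UNIV N) (kos_into N n i L) f (y \<odot>\<^bsub>pow_module UNIV N\<^esub> g) \<longleftrightarrow>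
        (\<forall>l\<in>kos_index n i. cong_mod N L (f l) (y \<odot>\<^bsub>N\<^esub> g l))" if "g \<in> carrier (pow_module UNIV N)" for g
      using kos_into_cong_iff[OF f P.smult_closed[OF y that]] by (simp add: pow_UNIV_simps)
    show ?thesis
    proof
      assume ?l
      then have "\<forall>l. \<exists>u. u \<in> carrier N \<and> (l \<in> kos_index n i \<longrightarrow> cong_mod N L (f l) (y \<odot>\<^bsub>N\<^esub> u))"
        unfolding kos_into_def N.add_mult_def by blast
      then obtain g where "\<forall>l. g l \<in> carrier N \<and> (l \<in> kos_index n i \<longrightarrow> cong_mod N L (f l) (y \<odot>\<^bsub>N\<^esub> g l))"
        by metis
      then show ?r using iff[of g] by (intro bexI[of _ g]) (auto simp: pow_UNIV_simps)
    next
      assume ?r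
      then obtain g where "g \<in> carrier (pow_module UNIV N)" "\<forall>l\<in>kos_index n i. cong_mod N L (f l) (y \<odot>\<^bsub>N\<^esub> g l)"
        using iff by auto
      then show ?l using f unfolding kos_into_def N.add_mult_def by (auto simp: pow_UNIV_simps)
    qed
  qed
  assume "N.regular_mod L y"
  then show "g \<in> kos_into N n i L"
    if "g \<in> carrier (pow_module UNIV N)" "y \<odot>\<^bsub>pow_module UNIV N\<^esub> g \<in> kos_into N n i L" for g
    using that unfolding N.regular_mod_def by (auto simp: kos_into_def pow_UNIV_simps)
qed

text \<open>The contraction homotopies show that members of \<open>xs\<close> kill each class, and
  the scalars killing a given class form an ideal.\<close>

lemma kos_kill:
  assumes y: "y \<in> Idl (set xs)" and L: "submodule L R N" and f: "f \<in> kos.Z i L"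
  shows "y \<odot>\<^bsub>pow_module UNIV N\<^esub> f \<in> kos.B i L"
proof -
  note B = kos.B_submodule[OF L, of i]
  have fc: "\<forall>l. f l \<in> carrier N" and fz: "\<forall>l\<in>kos_index n (Suc i). kos N xs f l \<in> L"
    using f by (auto simp: kos.Z_def kos_into_def pow_UNIV_simps)
  have fP: "f \<in> carrier (pow_module UNIV N)" using fc by (simp add: pow_UNIV_simps)
  have gen: "x \<odot>\<^bsub>pow_module UNIV N\<^esub> f \<in> kos.B i L" if x': "x \<in> set xs" for x
  proof -
    obtain j where j: "j < n" "x = xs ! j" using x' by (auto simp: in_set_conv_nth)
    have x: "x \<in> carrier R" using x' xs by auto
    let ?h = "kos_contract N j f"
    have hc: "?h \<in> carrier (pow_module UNIV N)" using N.kos_contract_closed[OF fc] by (simp add: pow_UNIV_simps)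
    have khc: "kos N xs ?h l \<in> carrier N" for l using N.kos_closed[OF xs] N.kos_contract_closed[OF fc] by auto
    have xf: "x \<odot>\<^bsub>pow_module UNIV N\<^esub> f \<in> carrier (pow_module UNIV N)" using x fP by simp
    have key: "cong_mod N L (x \<odot>\<^bsub>N\<^esub> f l) (kos N xs ?h l)" if l: "l \<in> kos_index n i" for l
    proof -
      have r: "kos_contract N j (kos N xs f) l \<in> L"
        using N.kos_contract_in_submodule[OF L fz l j(1)] .
      have "x \<odot>\<^bsub>N\<^esub> f l = kos_contract N j (kos N xs f) l \<oplus>\<^bsub>N\<^esub> kos N xs ?h l"
        using N.kos_homotopy[OF xs fc j(1), of l] l j(2) N.M.a_comm[OF khc N.submodule_carrier[OF L r]]
        by (simp add: kos_index_def)
      then show ?thesis using r khc[of l] N.submodule_carrier[OF L r] x fc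
        by (simp add: cong_mod_def N.add_minus_cancel)
    qed
    show ?thesis
    proof (cases i)
      case 0
      then have "x \<odot>\<^bsub>N\<^esub> f l \<in> L" if "l \<in> kos_index n i" for l
        using N.cong_mod_mem[OF L key[OF that]] N.kos_index_zero[of l xs ?h] that N.submodule_zero[OF L] by simp
      then show ?thesis using 0 xf by (simp add: kos.B_0 kos_into_def pow_UNIV_simps)
    next
      case (Suc k)
      have "kos N xs ?h \<in> carrier (pow_module UNIV N)" using khc by (simp add: pow_UNIV_simps)
      then have "cong_mod (pow_module UNIV N) (kos_into N n i L) (x \<odot>\<^bsub>pow_module UNIV N\<^esub> f) (kos N xs ?h)"
        using kos_into_cong_iff[OF xf] key by (simp add: pow_UNIV_simps)
      then show ?thesis using Suc xf hc by (auto simp: kos.B_Suc)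
    qed
  qed
  let ?J = "{a \<in> carrier R. a \<odot>\<^bsub>pow_module UNIV N\<^esub> f \<in> kos.B i L}"
  interpret S: module R "self_module R" by (rule N.R.self_module_module)
  have "submodule ?J R (self_module R)"
    using P.submodule_zero[OF B] P.submoduleE(4,5)[OF B] fP
    by (intro S.submodule_if_closed) (auto simp: self_module_simps P.smult_l_distr P.smult_assoc1)
  then have "ideal ?J R" by (simp add: N.R.submodule_self_iff)
  then have "Idl (set xs) \<subseteq> ?J" using gen xs by (intro N.R.genideal_minimal) auto
  then show ?thesis using y by auto
qed

text \<open>A weakly regular sequence in the radical of \<open>(xs)\<close> acts nilpotently on the
  Koszul cohomology of \<open>xs\<close>, so the cohomology vanishes below the length of that
  sequence, whatever the length of \<open>xs\<close>.\<close>

lemma kos_vanishes: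
  assumes ys: "set ys \<subseteq> carrier R" "N.weakly_regular {\<zero>\<^bsub>N\<^esub>} ys" "i < length ys"
    and rad: "\<And>y. y \<in> set ys \<Longrightarrow> \<exists>k::nat. y [^] k \<in> Idl (set xs)"
  shows "kos.Z i {\<zero>\<^bsub>N\<^esub>} \<subseteq> kos.B i {\<zero>\<^bsub>N\<^esub>}"
proof (rule kos.cohomology_vanishes[OF N.zero_submodule ys])
  fix y i L g assume y: "y \<in> set ys" and L: "submodule L R N" and g: "g \<in> kos.Z i L"
  obtain k :: nat where "y [^] k \<in> Idl (set xs)" using rad[OF y] by auto
  then show "\<exists>k::nat. (y [^] k) \<odot>\<^bsub>pow_module UNIV N\<^esub> g \<in> kos.B i L" using kos_kill[OF _ L g] by auto
qed

text \<open>The top cohomology is \<open>N/(xs)N\<close>: a constant cochain \<open>u\<close> is a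
  cocycle in degree \<open>n\<close>, and only its value at the all-\<open>True\<close> list counts
  there.\<close>

lemma carrier_le_ideal_times_if_top_vanishes:
  assumes van: "kos.Z n {\<zero>\<^bsub>N\<^esub>} \<subseteq> kos.B n {\<zero>\<^bsub>N\<^esub>}"
  shows "carrier N \<subseteq> fold N.add_mult xs {\<zero>\<^bsub>N\<^esub>}"
proof
  fix u assume u: "u \<in> carrier N"
  note H = N.fold_add_mult_submodule[OF xs N.zero_submodule]
  let ?l = "replicate n True"
  have l: "?l \<in> kos_index n n" by (simp add: kos_index_top)
  have "(\<lambda>_. u) \<in> kos.Z n {\<zero>\<^bsub>N\<^esub>}"
    using u N.kos_closed[OF xs] kos_index_gt[of n "Suc n"] by (simp add: kos.Z_def pow_UNIV_simps kos_into_def)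
  then have B: "(\<lambda>_. u) \<in> kos.B n {\<zero>\<^bsub>N\<^esub>}" using van by auto
  show "u \<in> fold N.add_mult xs {\<zero>\<^bsub>N\<^esub>}"
  proof (cases n)
    case 0
    then have "kos.B n {\<zero>\<^bsub>N\<^esub>} = kos_into N n 0 {\<zero>\<^bsub>N\<^esub>}" unfolding kos.B_def by simp
    then have "u = \<zero>\<^bsub>N\<^esub>" using B l 0 unfolding kos_into_def by auto
    then show ?thesis using N.submodule_zero[OF H] by simp
  next
    case (Suc j)
    then obtain g where g: "g \<in> carrier (pow_module UNIV N)"
      "cong_mod (pow_module UNIV N) (kos_into N n n {\<zero>\<^bsub>N\<^esub>}) (\<lambda>_. u) (kos N xs g)"
      by (rule kos.mem_B_Suc[OF B])
    have gc: "\<forall>l. g l \<in> carrier N" using g by (simp add: pow_UNIV_simps)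
    have "cong_mod N {\<zero>\<^bsub>N\<^esub>} u (kos N xs g ?l)"
      using g(2) l u gc N.kos_closed[OF xs gc] by (subst (asm) kos_into_cong_iff) (auto simp: pow_UNIV_simps)
    then have "cong_mod N (fold N.add_mult xs {\<zero>\<^bsub>N\<^esub>}) u (kos N xs g ?l)"
      using N.submodule_zero[OF H] by (auto simp: cong_mod_def)
    moreover have "kos N xs g ?l \<in> fold N.add_mult xs {\<zero>\<^bsub>N\<^esub>}"
      using N.smult_mem_fold_add_mult[OF N.zero_submodule xs] by (intro N.kos_in_ideal_times[OF H xs _ gc]) auto
    ultimately show ?thesis using N.cong_mod_mem[OF H] by blast
  qed
qed

end

section \<open>From vanishing Koszul cohomology to regularity\<close>

lemma (in module) fold_add_mult_rev:
  assumes "set xs \<subseteq> carrier R"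
  shows "fold add_mult (rev xs) {\<zero>\<^bsub>M\<^esub>} = fold add_mult xs {\<zero>\<^bsub>M\<^esub>}"
  using assms by (simp add: fold_add_mult_eq_ideal_times)

text \<open>A relation expressing \<open>x\<close> times \<open>u\<close> through \<open>xs\<close>
  is a cocycle of \<open>x # xs\<close> one degree below the top. Once it is a coboundary, its entry
  \<open>u\<close> lies in \<open>(xs)M\<close>.\<close>

lemma (in module) regular_if_kos_vanishes:
  assumes xs: "set xs \<subseteq> carrier R" and x: "x \<in> carrier R"
    and van: "cochains.Z (\<lambda>_. pow_module UNIV M) (\<lambda>_. kos M (x # xs)) (kos_into M (Suc (length xs))) (length xs) {\<zero>\<^bsub>M\<^esub>}
      \<subseteq> cochains.B (\<lambda>_. pow_module UNIV M) (\<lambda>_. kos M (x # xs)) (kos_into M (Suc (length xs))) (length xs) {\<zero>\<^bsub>M\<^esub>}"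
  shows "regular_mod (fold add_mult xs {\<zero>\<^bsub>M\<^esub>}) x"
  unfolding regular_mod_def
proof (intro ballI impI)
  interpret K: koszul R M "x # xs" by unfold_locales (use xs x in auto)
  note Z_def = K.kos.Z_def[unfolded length_Cons]
    and B_def = K.kos.B_def[unfolded length_Cons]
    and cong_iff = K.kos_into_cong_iff[unfolded length_Cons]
  let ?Z = "cochains.Z (\<lambda>_. pow_module UNIV M) (\<lambda>_. kos M (x # xs)) (kos_into M (Suc (length xs)))"
  let ?B = "cochains.B (\<lambda>_. pow_module UNIV M) (\<lambda>_. kos M (x # xs)) (kos_into M (Suc (length xs)))"
  note H = fold_add_mult_submodule[OF xs zero_submodule]
  let ?l = "replicate (length xs) True"
  fix u assume u: "u \<in> carrier M" "x \<odot>\<^bsub>M\<^esub> u \<in> fold add_mult xs {\<zero>\<^bsub>M\<^esub>}"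
  obtain f1 where f1: "\<forall>l. f1 l \<in> carrier M" "kos M xs f1 ?l = x \<odot>\<^bsub>M\<^esub> u"
    using ideal_times_in_kos[OF xs u(2)] by auto
  \<comment> \<open>Entries over subsets omitting \<open>x\<close> are \<open>u\<close>, over the
    others they are those of \<open>f1\<close>; the top value of the differential is then
    \<open>x u\<close> minus \<open>x u\<close>.\<close>
  define f where "f l = (case l of [] \<Rightarrow> \<zero>\<^bsub>M\<^esub> | b # l' \<Rightarrow> if b then f1 l' else u)" for l
  have fc: "\<forall>l. f l \<in> carrier M" using f1 u by (auto simp: f_def split: list.split)
  have fT: "(\<lambda>l. f (True # l)) = f1" by (simp add: f_def)
  have "kos M (x # xs) f l = \<zero>\<^bsub>M\<^esub>" if "l \<in> kos_index (Suc (length xs)) (Suc (length xs))" for l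
    using that f1 u x fT by (simp add: kos_index_top f_def a_minus_def M.r_neg)
  then have "f \<in> ?Z (length xs) {\<zero>\<^bsub>M\<^esub>}"
    using fc kos_closed[OF K.xs fc] by (simp add: Z_def pow_UNIV_simps kos_into_def del: kos.simps)
  then have fB: "f \<in> ?B (length xs) {\<zero>\<^bsub>M\<^esub>}" using van by (auto simp del: kos.simps)
  have l: "False # ?l \<in> kos_index (Suc (length xs)) (length xs)" by (simp add: mem_kos_index_Cons kos_index_top)
  show "u \<in> fold add_mult xs {\<zero>\<^bsub>M\<^esub>}"
  proof (cases "length xs")
    case 0
    then have "?B (length xs) {\<zero>\<^bsub>M\<^esub>} = kos_into M (Suc (length xs)) 0 {\<zero>\<^bsub>M\<^esub>}" unfolding B_def by simp
    then have "f (False # ?l) \<in> {\<zero>\<^bsub>M\<^esub>}" using fB l 0 unfolding kos_into_def by auto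
    then show ?thesis using submodule_zero[OF H] by (simp add: f_def)
  next
    case (Suc j)
    then obtain g where g: "g \<in> carrier (pow_module UNIV M)"
      "cong_mod (pow_module UNIV M) (kos_into M (Suc (length xs)) (length xs) {\<zero>\<^bsub>M\<^esub>}) f (kos M (x # xs) g)"
      by (rule K.kos.mem_B_Suc[unfolded length_Cons, OF fB])
    have gc: "\<forall>l. g l \<in> carrier M" using g by (simp add: pow_UNIV_simps)
    have "kos M (x # xs) g \<in> carrier (pow_module UNIV M)" "f \<in> carrier (pow_module UNIV M)"
      using kos_closed[OF K.xs gc] fc by (auto simp: pow_UNIV_simps simp del: kos.simps)
    then have "cong_mod M {\<zero>\<^bsub>M\<^esub>} (f (False # ?l)) (kos M (x # xs) g (False # ?l))"
      using g(2) l cong_iff[of f "kos M (x # xs) g" "length xs" "{\<zero>\<^bsub>M\<^esub>}"] by (simp del: kos.simps)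
    then have "cong_mod M (fold add_mult xs {\<zero>\<^bsub>M\<^esub>}) u (kos M xs (\<lambda>l. g (False # l)) ?l)"
      using submodule_zero[OF H] by (auto simp: cong_mod_def f_def)
    moreover have "kos M xs (\<lambda>l. g (False # l)) ?l \<in> fold add_mult xs {\<zero>\<^bsub>M\<^esub>}"
      using smult_mem_fold_add_mult[OF zero_submodule xs] gc by (intro kos_in_ideal_times[OF H xs]) auto
    ultimately show ?thesis using cong_mod_mem[OF H] by blast
  qed
qed

lemma (in cochains) V_le_B:
  assumes L: "submodule L R N" shows "V i L \<subseteq> B i L"
proof
  fix f assume f: "f \<in> V i L"
  show "f \<in> B i L"
  proof (cases i)
    case (Suc j)
    have "cong_mod (C (Suc j)) (V (Suc j) L) f (\<delta> j \<zero>\<^bsub>C j\<^esub>)"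
      using f Suc C.cong_mod_zero V[OF L] linear_maps_zero[OF C C \<delta>, of j] by auto
    then show ?thesis using f Suc C.submodule_carrier[OF V[OF L]] by (auto simp: B_Suc)
  qed (use f in \<open>simp add: B_0\<close>)
qed

text \<open>In the long exact sequence of the cone, multiplication by \<open>x\<close> in degree
  \<open>j\<close> of \<open>xs\<close> is followed by the map into degree \<open>Suc j\<close> of
  \<open>x # xs\<close>. As the latter cohomology is zero, \<open>x\<close> acts surjectively, and
  Nakayama's lemma leaves no class.\<close>

lemma (in module) kos_vanishes_tl:
  assumes noeth and xs: "set xs \<subseteq> carrier R" and n: "length xs = Suc j"
    and x: "x \<in> carrier R" and unit: "\<And>a. a \<in> carrier R \<Longrightarrow> \<one> \<ominus> x \<otimes> a \<in> Units R"
    and van: "cochains.Z (\<lambda>_. pow_module UNIV M) (\<lambda>_. kos M (x # xs)) (kos_into M (Suc (length xs))) (length xs) {\<zero>\<^bsub>M\<^esub>}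
      \<subseteq> cochains.B (\<lambda>_. pow_module UNIV M) (\<lambda>_. kos M (x # xs)) (kos_into M (Suc (length xs))) (length xs) {\<zero>\<^bsub>M\<^esub>}"
  shows "cochains.Z (\<lambda>_. pow_module UNIV M) (\<lambda>_. kos M xs) (kos_into M (length xs)) j {\<zero>\<^bsub>M\<^esub>}
      \<subseteq> cochains.B (\<lambda>_. pow_module UNIV M) (\<lambda>_. kos M xs) (kos_into M (length xs)) j {\<zero>\<^bsub>M\<^esub>}"
proof -
  interpret K: koszul R M xs by unfold_locales (use xs in auto)
  interpret K': koszul R M "x # xs" by unfold_locales (use xs x in auto)
  let ?Z = "K.kos.Z j {\<zero>\<^bsub>M\<^esub>}" and ?B = "K.kos.B j {\<zero>\<^bsub>M\<^esub>}"
  let ?Z' = "cochains.Z (\<lambda>_. pow_module UNIV M) (\<lambda>_. kos M (x # xs)) (kos_into M (Suc (length xs)))"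
  let ?B' = "cochains.B (\<lambda>_. pow_module UNIV M) (\<lambda>_. kos M (x # xs)) (kos_into M (Suc (length xs)))"
  let ?I = "kos_index (length xs) j"
  let ?PI = "pow_module ?I M"
  interpret PI: module R ?PI by (rule pow_module_module)
  note z = zero_submodule
  note Z = K.kos.Z_submodule[OF z, of j] and B = K.kos.B_submodule[OF z, of j] and BZ = K.kos.B_le_Z[OF z, of j]
  \<comment> \<open>Functions on all lists need not form a Noetherian module. Restriction to the
    finitely many lists of degree \<open>j\<close> lands in one, and what restriction forgets lies
    in \<open>?B\<close>, since cochains vanishing in degree \<open>j\<close> are
    coboundaries.\<close>
  have res: "(\<lambda>f. restrict f ?I) \<in> linear_maps R (pow_module UNIV M) ?PI"
    by (auto simp: linear_maps_def pow_module_simps fun_eq_iff)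
  have fg: "fg_sub R ?PI ((\<lambda>f. restrict f ?I) ` ?Z)"
    using noeth_pow_module[OF assms(1) finite_kos_index] PI.noeth_iff
      linear_image_submodule[OF K.P.module_axioms PI.module_axioms res Z] by blast
  then obtain S' where S': "finite S'" "S' \<subseteq> (\<lambda>f. restrict f ?I) ` ?Z" "submodule_span R ?PI S' = (\<lambda>f. restrict f ?I) ` ?Z"
    unfolding fg_sub_def by blast
  obtain S where S: "finite S" "S \<subseteq> ?Z" "S' = (\<lambda>f. restrict f ?I) ` S" using finite_subset_image[OF S'(1,2)] by blast
  let ?H = "submodule_span R (pow_module UNIV M) (?B \<union> S)"
  have "?B \<union> S \<subseteq> carrier (pow_module UNIV M)" using S BZ K.P.submodule_carrier[OF Z] by blast
  note H = K.P.span_submodule[OF this]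
  have "submodule_span R ?PI S' \<subseteq> (\<lambda>f. restrict f ?I) ` ?H"
    using PI.span_least[OF linear_image_submodule[OF K.P.module_axioms PI.module_axioms res H], of S'] K.P.span_upper[of "?B \<union> S"] S(3)
    by blast
  then have img: "(\<lambda>f. restrict f ?I) ` ?Z \<subseteq> (\<lambda>f. restrict f ?I) ` ?H" using S'(3) by simp
  have cover: "?Z \<subseteq> ?H"
  proof
    fix f assume f: "f \<in> ?Z"
    then have "restrict f ?I \<in> (\<lambda>f. restrict f ?I) ` ?H" using img by blast
    then obtain h where h: "h \<in> ?H" "restrict f ?I = restrict h ?I" by auto
    have c: "f \<in> carrier (pow_module UNIV M)" "h \<in> carrier (pow_module UNIV M)"
      using K.P.submodule_carrier[OF Z f] K.P.submodule_carrier[OF H h(1)] by auto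
    have "f l = h l" if "l \<in> ?I" for l using fun_cong[OF h(2), of l] that by simp
    then have "f \<ominus>\<^bsub>pow_module UNIV M\<^esub> h \<in> kos_into M (length xs) j {\<zero>\<^bsub>M\<^esub>}"
      unfolding pow_UNIV_minus[OF c] using c by (auto simp: kos_into_def pow_UNIV_simps a_minus_def M.r_neg)
    then have "f \<ominus>\<^bsub>pow_module UNIV M\<^esub> h \<in> ?H" using K.kos.V_le_B[OF z, of j] K.P.span_upper[of "?B \<union> S"] by blast
    from K.P.submoduleE(5)[OF H this h(1)] show "f \<in> ?H" using K.P.add_minus_cancel(2)[OF c] by simp
  qed
  show ?thesis
  proof (rule K.P.nakayama[OF S(1) B Z S(2) cover BZ x unit])
    fix f assume f: "f \<in> ?Z"
    have fc: "\<forall>l. f l \<in> carrier M" and fz: "\<And>l. l \<in> kos_index (length xs) (Suc j) \<Longrightarrow> kos M xs f l = \<zero>\<^bsub>M\<^esub>"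
      using f by (auto simp: K.kos.Z_def pow_UNIV_simps kos_into_def)
    \<comment> \<open>The cocycle \<open>f\<close> is placed on the subsets containing
      \<open>x\<close>, which gives a cocycle of \<open>x # xs\<close> one degree higher.\<close>
    define F where "F l = (case l of [] \<Rightarrow> \<zero>\<^bsub>M\<^esub> | b # l' \<Rightarrow> if b then f l' else \<zero>\<^bsub>M\<^esub>)" for l
    have Fc: "\<forall>l. F l \<in> carrier M" using fc by (auto simp: F_def split: list.split)
    have FT: "(\<lambda>l. F (True # l)) = f" and FF: "(\<lambda>l. F (False # l)) = (\<lambda>l. \<zero>\<^bsub>M\<^esub>)" by (auto simp: F_def)
    have "kos M (x # xs) F l = \<zero>\<^bsub>M\<^esub>" if l: "l \<in> kos_index (Suc (length xs)) (Suc (length xs))" for l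
      using l
    proof (cases rule: kos_index_Suc_cases)
      case (1 l') then show ?thesis using kos_index_gt[of "length xs" "Suc (length xs)"] by auto
    next
      case (2 l' i)
      then have "l' \<in> kos_index (length xs) (Suc j)" using n by simp
      then have "kos M xs (\<lambda>l. F (True # l)) l' = \<zero>\<^bsub>M\<^esub>" using fz unfolding FT by simp
      then show ?thesis using 2(1) x by (simp add: F_def[of "False # l'"])
    qed
    then have "F \<in> ?Z' (length xs) {\<zero>\<^bsub>M\<^esub>}"
      using Fc kos_closed[OF K'.xs Fc]
      by (simp add: K'.kos.Z_def[unfolded length_Cons] pow_UNIV_simps kos_into_def del: kos.simps)
    then have "F \<in> ?B' (length xs) {\<zero>\<^bsub>M\<^esub>}" using van by blast
    then obtain g where g: "g \<in> carrier (pow_module UNIV M)"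
      "cong_mod (pow_module UNIV M) (kos_into M (Suc (length xs)) (length xs) {\<zero>\<^bsub>M\<^esub>}) F (kos M (x # xs) g)"
      by (rule K'.kos.mem_B_Suc[unfolded length_Cons, OF _ n])
    have gc: "\<forall>l. g l \<in> carrier M" using g by (simp add: pow_UNIV_simps)
    have kg: "\<forall>l. kos M (x # xs) g l \<in> carrier M" using kos_closed[OF K'.xs gc] by blast
    have eq: "F l = kos M (x # xs) g l" if l: "l \<in> kos_index (Suc (length xs)) (Suc j)" for l
    proof -
      have "cong_mod M {\<zero>\<^bsub>M\<^esub>} (F l) (kos M (x # xs) g l)"
        using g(2) l n K'.kos_into_cong_iff[unfolded length_Cons, of F "kos M (x # xs) g" "length xs" "{\<zero>\<^bsub>M\<^esub>}"] Fc kg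
        by (simp add: pow_UNIV_simps del: kos.simps)
      then show ?thesis using add_minus_cancel(2)[of "F l" "kos M (x # xs) g l"]
        by (auto simp: cong_mod_def simp del: kos.simps)
    qed
    define g0 g1 where "g0 = (\<lambda>l. g (False # l))" and "g1 = (\<lambda>l. g (True # l))"
    have g01: "\<forall>l. g0 l \<in> carrier M" "\<forall>l. g1 l \<in> carrier M" using gc by (auto simp: g0_def g1_def)
    have k1: "kos M xs g1 l \<in> carrier M" for l using kos_closed[OF xs g01(2)] .
    have "kos M xs g0 l = \<zero>\<^bsub>M\<^esub>" if "l \<in> kos_index (length xs) (Suc j)" for l
      using eq[of "False # l"] that by (simp add: mem_kos_index_Cons F_def g0_def)
    then have g0Z: "g0 \<in> ?Z" using g01 kos_closed[OF xs g01(1)]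
      by (simp add: K.kos.Z_def pow_UNIV_simps kos_into_def)
    have g0P: "g0 \<in> carrier (pow_module UNIV M)" "f \<in> carrier (pow_module UNIV M)"
      using g01 fc by (auto simp: pow_UNIV_simps)
    \<comment> \<open>In the relevant degree, \<open>F = kos M (x # xs) g\<close> says on subsets
      containing \<open>x\<close> that \<open>f\<close> is \<open>x g0\<close> minus the
      differential of \<open>g1\<close>, and on the others that \<open>g0\<close> is a cocycle. So
      \<open>f\<close> and \<open>x g0\<close> differ by a coboundary.\<close>
    let ?D = "f \<ominus>\<^bsub>pow_module UNIV M\<^esub> x \<odot>\<^bsub>pow_module UNIV M\<^esub> g0"
    have Dc: "?D \<in> carrier (pow_module UNIV M)" using g0P x by simp
    have D: "?D l = \<ominus>\<^bsub>M\<^esub> kos M xs g1 l" if "l \<in> ?I" for l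
    proof -
      have "f l = x \<odot>\<^bsub>M\<^esub> g0 l \<ominus>\<^bsub>M\<^esub> kos M xs g1 l"
        using eq[of "True # l"] that by (simp add: mem_kos_index_Cons F_def g0_def g1_def)
      moreover have "?D l = f l \<ominus>\<^bsub>M\<^esub> x \<odot>\<^bsub>M\<^esub> g0 l"
        using pow_UNIV_minus[OF g0P(2) K.P.smult_closed[OF x g0P(1)]] by (simp add: pow_UNIV_simps)
      ultimately show ?thesis using x g01(1) k1[of l] M.a_comm[of "x \<odot>\<^bsub>M\<^esub> g0 l" "\<ominus>\<^bsub>M\<^esub> kos M xs g1 l"]
          add_minus_cancel(1)[of "\<ominus>\<^bsub>M\<^esub> kos M xs g1 l" "x \<odot>\<^bsub>M\<^esub> g0 l"] by (simp add: a_minus_def)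
    qed
    have "?D \<in> ?B"
    proof (cases j)
      case 0
      then have "?D \<in> kos_into M (length xs) j {\<zero>\<^bsub>M\<^esub>}"
        using D Dc kos_index_zero[of _ xs g1] M.r_neg[of "\<zero>\<^bsub>M\<^esub>"] by (auto simp: kos_into_def pow_UNIV_simps)
      then show ?thesis using K.kos.V_le_B[OF z] by blast
    next
      case (Suc k)
      let ?g = "\<lambda>l. \<ominus>\<^bsub>M\<^esub> g1 l"
      have gP: "?g \<in> carrier (pow_module UNIV M)" using g01 by (simp add: pow_UNIV_simps)
      have kgc: "kos M xs ?g \<in> carrier (pow_module UNIV M)" using kos_uminus[OF xs g01(2)] k1 by (simp add: pow_UNIV_simps)
      have "cong_mod (pow_module UNIV M) (kos_into M (length xs) j {\<zero>\<^bsub>M\<^esub>}) ?D (kos M xs ?g)"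
        using K.kos_into_cong_iff[OF Dc kgc] D kos_uminus[OF xs g01(2)] k1 cong_mod_refl[OF z] by simp
      then show ?thesis unfolding Suc K.kos.B_Suc using Dc gP by blast
    qed
    then show "\<exists>w\<in>?Z. f \<ominus>\<^bsub>pow_module UNIV M\<^esub> x \<odot>\<^bsub>pow_module UNIV M\<^esub> w \<in> ?B" using g0Z by blast
  qed
qed

text \<open>Removing the head \<open>x\<close> gives two conclusions: \<open>x\<close> is regular
  modulo the tail, and the vanishing passes to the tail. Regularity is thus obtained with the head
  in last position, whence the reversal.\<close>

lemma (in module) weakly_regular_rev_if_kos_vanishes:
  assumes noeth and xs: "set xs \<subseteq> carrier R" "length xs = Suc j"
    and unit: "\<And>x a. x \<in> set xs \<Longrightarrow> a \<in> carrier R \<Longrightarrow> \<one> \<ominus> x \<otimes> a \<in> Units R"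
    and van: "cochains.Z (\<lambda>_. pow_module UNIV M) (\<lambda>_. kos M xs) (kos_into M (length xs)) j {\<zero>\<^bsub>M\<^esub>}
      \<subseteq> cochains.B (\<lambda>_. pow_module UNIV M) (\<lambda>_. kos M xs) (kos_into M (length xs)) j {\<zero>\<^bsub>M\<^esub>}"
  shows "weakly_regular {\<zero>\<^bsub>M\<^esub>} (rev xs)"
  using xs unit van
proof (induction xs arbitrary: j)
  case (Cons x xs)
  have x: "x \<in> carrier R" and xs: "set xs \<subseteq> carrier R" and j: "j = length xs" using Cons.prems by auto
  have van: "cochains.Z (\<lambda>_. pow_module UNIV M) (\<lambda>_. kos M (x # xs)) (kos_into M (Suc (length xs))) (length xs) {\<zero>\<^bsub>M\<^esub>}
      \<subseteq> cochains.B (\<lambda>_. pow_module UNIV M) (\<lambda>_. kos M (x # xs)) (kos_into M (Suc (length xs))) (length xs) {\<zero>\<^bsub>M\<^esub>}"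
    using Cons.prems(4) unfolding j length_Cons .
  have "regular_mod (fold add_mult xs {\<zero>\<^bsub>M\<^esub>}) x" by (rule regular_if_kos_vanishes[OF xs x van])
  then have last: "regular_mod (fold add_mult (rev xs) {\<zero>\<^bsub>M\<^esub>}) x" by (simp add: fold_add_mult_rev[OF xs])
  have "weakly_regular {\<zero>\<^bsub>M\<^esub>} (rev xs)"
  proof (cases "length xs")
    case (Suc i)
    have "\<And>a. a \<in> carrier R \<Longrightarrow> \<one> \<ominus> x \<otimes> a \<in> Units R" using Cons.prems(3) by simp
    from kos_vanishes_tl[OF assms(1) xs Suc x this van]
    show ?thesis using Cons.IH[OF xs Suc] Cons.prems(3) by simp
  qed simp
  then show ?case using last by (simp add: weakly_regular_append)
qed simp

text \<open>The vanishing of Koszul cohomology below \<open>length ys\<close> covers degree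
  \<open>length xs - 1\<close>, the one from which regularity is read off. The complex is taken for
  \<open>rev xs\<close>, so that the reversal is undone.\<close>

lemma (in module) weakly_regular_if_radical:
  assumes noeth and xs: "set xs \<subseteq> carrier R"
    and unit: "\<And>x a. x \<in> set xs \<Longrightarrow> a \<in> carrier R \<Longrightarrow> \<one> \<ominus> x \<otimes> a \<in> Units R"
    and ys: "set ys \<subseteq> carrier R" "weakly_regular {\<zero>\<^bsub>M\<^esub>} ys" "length xs \<le> length ys"
    and rad: "\<And>y. y \<in> set ys \<Longrightarrow> \<exists>k::nat. y [^] k \<in> Idl (set xs)"
  shows "weakly_regular {\<zero>\<^bsub>M\<^esub>} xs"
proof (cases "length xs")
  case (Suc j)
  interpret K: koszul R M "rev xs" by unfold_locales (use xs in auto)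
  have "K.kos.Z j {\<zero>\<^bsub>M\<^esub>} \<subseteq> K.kos.B j {\<zero>\<^bsub>M\<^esub>}"
    using ys(3) Suc rad by (intro K.kos_vanishes[OF ys(1,2)]) auto
  from weakly_regular_rev_if_kos_vanishes[OF assms(1) _ _ _ this] show ?thesis
    using xs unit Suc by simp
qed simp

section \<open>Noetherian local rings\<close>

text \<open>A nonempty chain of ideals in a Noetherian ring contains its union, so Zorn's lemma
  applies within any set of ideals.\<close>

lemma (in noetherian_ring) exists_maximal_in:
  assumes "S \<noteq> {}" "\<And>I. I \<in> S \<Longrightarrow> ideal I R"
  shows "\<exists>I\<in>S. \<forall>J\<in>S. I \<subseteq> J \<longrightarrow> J = I"
proof (rule subset_Zorn)
  fix C assume C: "subset.chain S C"
  show "\<exists>U\<in>S. \<forall>I\<in>C. I \<subseteq> U"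
  proof (cases "C = {}")
    case False
    have "subset.chain {I. ideal I R} C" using C assms(2) unfolding pred_on.chain_def by auto
    then have "\<Union>C \<in> C" using ideal_chain_is_trivial[OF False] by auto
    moreover have "C \<subseteq> S" using C unfolding pred_on.chain_def by simp
    ultimately show ?thesis by auto
  qed (use assms(1) in auto)
qed

context cring
begin

lemma idealD:
  assumes "ideal I R"
  shows "I \<subseteq> carrier R" "\<zero> \<in> I" "a \<in> I \<Longrightarrow> b \<in> I \<Longrightarrow> a \<oplus> b \<in> I" "r \<in> carrier R \<Longrightarrow> a \<in> I \<Longrightarrow> r \<otimes> a \<in> I"
    "a \<in> I \<Longrightarrow> r \<in> carrier R \<Longrightarrow> a \<otimes> r \<in> I"
proof -
  interpret ideal I R by fact
  show "I \<subseteq> carrier R" "\<zero> \<in> I" "a \<in> I \<Longrightarrow> b \<in> I \<Longrightarrow> a \<oplus> b \<in> I" "r \<in> carrier R \<Longrightarrow> a \<in> I \<Longrightarrow> r \<otimes> a \<in> I"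
    "a \<in> I \<Longrightarrow> r \<in> carrier R \<Longrightarrow> a \<otimes> r \<in> I" using a_subset I_l_closed I_r_closed by auto
qed

definition ideal_add :: "'a set \<Rightarrow> 'a \<Rightarrow> 'a set" where
  "ideal_add I a = {p \<oplus> r \<otimes> a | p r. p \<in> I \<and> r \<in> carrier R}"

lemma ideal_add:
  assumes I: "ideal I R" and a: "a \<in> carrier R"
  shows "ideal (ideal_add I a) R" "I \<subseteq> ideal_add I a" "a \<in> ideal_add I a"
proof -
  interpret S: module R "self_module R" by (rule self_module_module)
  have eq: "ideal_add I a = S.sum_sub I (S.cyclic a)"
    unfolding ideal_add_def S.sum_sub_def S.cyclic_def by (auto simp: self_module_simps)
  have s: "submodule I R (self_module R)" "submodule (S.cyclic a) R (self_module R)" "a \<in> S.cyclic a"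
    using I a S.cyclic_submodule S.cyclic_self by (auto simp: submodule_self_iff self_module_simps)
  show "ideal (ideal_add I a) R" using S.sum_sub_submodule[OF s(1,2)] by (simp add: eq submodule_self_iff)
  show "I \<subseteq> ideal_add I a" "a \<in> ideal_add I a" using S.sum_sub_upper[OF s(1,2)] s(3) unfolding eq by auto
qed

lemma ideal_proper_iff: "ideal I R \<Longrightarrow> I \<noteq> carrier R \<longleftrightarrow> \<one> \<notin> I"
  using idealD[of I] ideal.one_imp_carrier[of I R] by blast

text \<open>An ideal maximal among those containing \<open>I\<close> and disjoint from
  \<open>S\<close> is prime: if \<open>a\<close> and \<open>b\<close> lie outside, enlarging by
  either meets \<open>S\<close>. With \<open>a b\<close> inside, the product of the two elements
  found would lie both in \<open>S\<close> and in the ideal.\<close>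

lemma exists_prime_avoiding:
  assumes noeth: "noetherian_ring R" and I: "ideal I R"
    and S: "S \<subseteq> carrier R" "\<one> \<in> S" "\<And>a b. a \<in> S \<Longrightarrow> b \<in> S \<Longrightarrow> a \<otimes> b \<in> S" and disj: "I \<inter> S = {}"
  shows "\<exists>P. primeideal P R \<and> I \<subseteq> P \<and> P \<inter> S = {}"
proof -
  let ?A = "{J. ideal J R \<and> I \<subseteq> J \<and> J \<inter> S = {}}"
  have "?A \<noteq> {}" using I disj by auto
  from noetherian_ring.exists_maximal_in[OF noeth this] obtain P where
    P: "ideal P R" "I \<subseteq> P" "P \<inter> S = {}" and max: "\<And>J. ideal J R \<Longrightarrow> P \<subseteq> J \<Longrightarrow> J \<inter> S = {} \<Longrightarrow> J = P" by auto
  note PD = idealD[OF P(1)]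
  have meets: "\<exists>p r. p \<in> P \<and> r \<in> carrier R \<and> p \<oplus> r \<otimes> a \<in> S" if "a \<in> carrier R" "a \<notin> P" for a
  proof -
    have "ideal_add P a \<noteq> P" using ideal_add(3)[OF P(1) that(1)] that(2) by auto
    then have "ideal_add P a \<inter> S \<noteq> {}" using max[OF ideal_add(1,2)[OF P(1) that(1)]] by auto
    then show ?thesis unfolding ideal_add_def by auto
  qed
  have "primeideal P R"
  proof (rule primeidealI[OF P(1) is_cring])
    show "carrier R \<noteq> P" using P(3) S(2) by auto
    fix a b assume ab: "a \<in> carrier R" "b \<in> carrier R" "a \<otimes> b \<in> P"
    show "a \<in> P \<or> b \<in> P"
    proof (rule ccontr)
      assume "\<not> (a \<in> P \<or> b \<in> P)"
      then obtain p r p' r' where pr: "p \<in> P" "r \<in> carrier R" "p \<oplus> r \<otimes> a \<in> S"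
        "p' \<in> P" "r' \<in> carrier R" "p' \<oplus> r' \<otimes> b \<in> S" using meets[OF ab(1)] meets[OF ab(2)] by auto
      then have c: "p \<in> carrier R" "p' \<in> carrier R" using PD(1) by auto
      have "(p \<oplus> r \<otimes> a) \<otimes> (p' \<oplus> r' \<otimes> b) = p \<otimes> (p' \<oplus> r' \<otimes> b) \<oplus> ((r \<otimes> a) \<otimes> p' \<oplus> (r \<otimes> r') \<otimes> (a \<otimes> b))"
        using pr(2,5) c ab(1,2) by algebra
      also have "\<dots> \<in> P" using PD pr c ab by auto
      finally show False using S(3)[OF pr(3,6)] P(3) by auto
    qed
  qed
  then show ?thesis using P by auto
qed

lemma exists_maximalideal:
  assumes noeth: "noetherian_ring R" and I: "ideal I R" "I \<noteq> carrier R"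
  shows "\<exists>m. maximalideal m R \<and> I \<subseteq> m"
proof -
  let ?A = "{J. ideal J R \<and> I \<subseteq> J \<and> J \<noteq> carrier R}"
  have "?A \<noteq> {}" using I by auto
  from noetherian_ring.exists_maximal_in[OF noeth this] obtain m where
    *: "m \<in> ?A" "\<forall>J\<in>?A. m \<subseteq> J \<longrightarrow> J = m" by blast
  then have m: "ideal m R" "I \<subseteq> m" "m \<noteq> carrier R" by auto
  have max: "J = m" if "ideal J R" "m \<subseteq> J" "J \<noteq> carrier R" for J using * that m(2) by blast
  have "maximalideal m R" using m max by (intro maximalidealI) auto
  then show ?thesis using m by auto
qed

lemma prime_pow:
  assumes "primeideal P R" "a \<in> carrier R" "a [^] (n::nat) \<in> P"
  shows "a \<in> P"
proof -
  interpret primeideal P R by fact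
  show ?thesis using assms(3)
  proof (induction n)
    case 0 then show ?case using I_notcarr one_imp_carrier by auto
  next
    case (Suc n) then show ?case using I_prime[of "a [^] n" a] assms(2) by auto
  qed
qed

text \<open>An element regular modulo \<^term>\<open>I\<close> avoids the minimal primes of \<^term>\<open>I\<close>.\<close>

lemma smaller_prime:
  assumes noeth: "noetherian_ring R" and I: "ideal I R" and P: "primeideal P R" "I \<subseteq> P" "y \<in> P"
    and reg: "\<And>u. u \<in> carrier R \<Longrightarrow> y \<otimes> u \<in> I \<Longrightarrow> u \<in> I"
  shows "\<exists>P'. primeideal P' R \<and> I \<subseteq> P' \<and> P' \<subset> P"
proof -
  interpret P: primeideal P R by fact
  have y: "y \<in> carrier R" using P P.a_subset by auto
  \<comment> \<open>A prime disjoint from this multiplicative set contains neither \<open>y\<close>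
    nor anything outside \<open>P\<close>.\<close>
  let ?S = "{s \<otimes> y [^] (k::nat) | s k. s \<in> carrier R - P}"
  have one: "\<one> \<notin> P" using P.I_notcarr P.one_imp_carrier by auto
  have "\<exists>P'. primeideal P' R \<and> I \<subseteq> P' \<and> P' \<inter> ?S = {}"
  proof (rule exists_prime_avoiding[OF noeth I])
    show "?S \<subseteq> carrier R" using y by auto
    show "\<one> \<in> ?S" using one by (intro CollectI exI[of _ \<one>] exI[of _ 0]) auto
    show "a \<otimes> b \<in> ?S" if ab: "a \<in> ?S" "b \<in> ?S" for a b
    proof -
      from ab obtain s t k l where st: "s \<in> carrier R - P" "t \<in> carrier R - P" "a = s \<otimes> y [^] (k::nat)" "b = t \<otimes> y [^] (l::nat)"
        by auto
      then have "a \<otimes> b = (s \<otimes> t) \<otimes> y [^] (k + l)" using y by (simp add: nat_pow_mult[symmetric] m_ac)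
      moreover have "s \<otimes> t \<in> carrier R - P" using st P.I_prime by auto
      ultimately show ?thesis by blast
    qed
    \<comment> \<open>Cancelling \<open>y\<close> repeatedly shows that \<open>I\<close>, which lies
      in \<open>P\<close>, misses \<open>?S\<close>.\<close>
    have "s \<in> I" if "s \<in> carrier R" "s \<otimes> y [^] (k::nat) \<in> I" for s k
      using that
    proof (induction k)
      case (Suc k)
      then have "y \<otimes> (s \<otimes> y [^] k) \<in> I" using y by (simp add: m_ac)
      then show ?case using Suc reg[of "s \<otimes> y [^] k"] y by simp
    qed simp
    then show "I \<inter> ?S = {}" using P(2) by auto
  qed
  then obtain P' where P': "primeideal P' R" "I \<subseteq> P'" "P' \<inter> ?S = {}" by auto
  have "P' \<subseteq> P"
  proof
    fix a assume a: "a \<in> P'"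
    then have ac: "a \<in> carrier R" using primeideal.axioms(1)[OF P'(1)] idealD(1) by blast
    show "a \<in> P"
    proof (rule ccontr)
      assume "a \<notin> P"
      then have "a \<in> ?S" using ac by (intro CollectI exI[of _ a] exI[of _ 0]) auto
      then show False using a P'(3) by auto
    qed
  qed
  moreover have "y \<in> ?S" using y one by (intro CollectI exI[of _ \<one>] exI[of _ 1]) auto
  then have "y \<notin> P'" using P'(3) by auto
  ultimately have "P' \<subset> P" using P(3) by auto
  then show ?thesis using P' by auto
qed

text \<open>Taken from the last one backwards, each element of the sequence lets the prime shrink
  strictly while the earlier elements remain in it.\<close>

lemma prime_chain_if_weakly_regular:
  assumes noeth: "noetherian_ring R" and ys: "set ys \<subseteq> carrier R"
    "module.weakly_regular (self_module R) {\<zero>} ys" and P: "primeideal P R" "set ys \<subseteq> P"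
  shows "chain_to (\<lambda>P. primeideal P R) (length ys) P"
  using ys P
proof (induction ys arbitrary: P rule: rev_induct)
  case Nil then show ?case by (auto intro: chain_to.zero)
next
  case (snoc y ys)
  interpret S: module R "self_module R" by (rule self_module_module)
  have zero: "{\<zero>} = {\<zero>\<^bsub>self_module R\<^esub>}" by (simp add: self_module_simps)
  let ?L = "fold S.add_mult ys {\<zero>}"
  have ys: "set ys \<subseteq> carrier R" and y: "y \<in> carrier R" using snoc.prems by auto
  have wr: "S.weakly_regular {\<zero>} ys" "S.regular_mod ?L y" using snoc.prems(2) by (auto simp: S.weakly_regular_append)
  have L: "submodule ?L R (self_module R)" unfolding zero by (rule S.fold_add_mult_submodule[OF ys S.zero_submodule])
  then have Li: "ideal ?L R" by (simp add: submodule_self_iff)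
  have Pi: "ideal P R" using snoc.prems(3) by (rule primeideal.axioms(1))
  have LP: "?L \<subseteq> P"
    using snoc.prems(4) idealD[OF Pi] Pi by (intro S.fold_add_mult_least) (auto simp: submodule_self_iff self_module_simps)
  have "\<exists>P'. primeideal P' R \<and> ?L \<subseteq> P' \<and> P' \<subset> P"
    using snoc.prems(4) wr(2) by (intro smaller_prime[OF noeth Li snoc.prems(3) LP, of y]) (auto simp: S.regular_mod_def self_module_simps)
  then obtain P' where P': "primeideal P' R" "?L \<subseteq> P'" "P' \<subset> P" by auto
  have "z \<in> ?L" if z: "z \<in> set ys" for z
    using S.smult_mem_fold_add_mult[OF S.zero_submodule ys z, of \<one>] ys z by (auto simp: self_module_simps)
  then have "set ys \<subseteq> P'" using P'(2) by auto
  from snoc.IH[OF ys wr(1) P'(1) this] P'(3) snoc.prems(3) show ?case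
    by (auto intro: chain_to.Suc[of _ "length ys" P'])
qed

end

lemma krull_dim_eq_chain_len: "krull_dim R = chain_len (\<lambda>P. primeideal P R)"
  unfolding krull_dim_def chain_len_alt ..

section \<open>Local rings: units, depth and systems of parameters\<close>

locale noetherian_local = cring R for R :: "('a, 'r) ring_scheme" (structure) +
  assumes noeth: "noetherian_ring R" and local: "local_ring R"
begin

sublocale S: module R "self_module R" by (rule self_module_module)

definition m :: "'a set" where "m = the_max_ideal R"

lemma m_maximal: "maximalideal m R"
  using local theI'[of "\<lambda>I. maximalideal I R"] unfolding local_ring_def m_def the_max_ideal_def by blast

lemma m_unique: "maximalideal I R \<Longrightarrow> I = m"
  using local m_maximal unfolding local_ring_def by blast

lemma m_ideal: "ideal m R" using m_maximal by (rule maximalideal.axioms(1))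

lemmas m_simps = idealD[OF m_ideal]

lemma one_notin_m: "\<one> \<notin> m"
  using maximalideal.I_notcarr[OF m_maximal] ideal_proper_iff[OF m_ideal] by auto

lemma m_prime: "primeideal m R"
  using maximalideal_prime[OF m_maximal] .

lemma le_m: "ideal I R \<Longrightarrow> \<one> \<notin> I \<Longrightarrow> I \<subseteq> m"
  using exists_maximalideal[OF noeth] ideal_proper_iff m_unique by metis

lemma prime_le_m: "primeideal P R \<Longrightarrow> P \<subseteq> m"
  using le_m primeideal.axioms(1) ideal_proper_iff primeideal.I_notcarr by metis

lemma unit_iff: assumes "a \<in> carrier R" "a \<notin> m" shows "a \<in> Units R"
proof -
  have "ideal (PIdl a) R" "a \<in> PIdl a" using assms by (auto intro: cgenideal_ideal cgenideal_self)
  then have "\<one> \<in> PIdl a" using le_m assms(2) by blast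
  then obtain b where "b \<in> carrier R" "\<one> = b \<otimes> a" unfolding cgenideal_def by auto
  then show ?thesis using assms(1) m_comm[of b a] unfolding Units_def by auto
qed

text \<open>Supplies the unit hypothesis of \<open>nakayama\<close> for elements of the maximal
  ideal.\<close>

lemma one_minus_unit:
  assumes "x \<in> m" "a \<in> carrier R" shows "\<one> \<ominus> x \<otimes> a \<in> Units R"
proof (rule unit_iff)
  have x: "x \<in> carrier R" using assms m_simps(1) by auto
  show "\<one> \<ominus> x \<otimes> a \<in> carrier R" using x assms by auto
  show "\<one> \<ominus> x \<otimes> a \<notin> m"
  proof
    assume "\<one> \<ominus> x \<otimes> a \<in> m"
    then have "(\<one> \<ominus> x \<otimes> a) \<oplus> x \<otimes> a \<in> m" using assms m_simps by auto
    moreover have "(\<one> \<ominus> x \<otimes> a) \<oplus> x \<otimes> a = \<one>" using x assms by algebra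
    ultimately show False using one_notin_m by simp
  qed
qed

text \<open>If a regular sequence were longer than a generating list of \<open>m\<close>, the Koszul
  cohomology of the generators would vanish in top degree too, and \<open>R\<close> would be
  contained in \<open>m\<close>.\<close>

lemma length_regular_le:
  assumes m: "m = Idl (set xs)" "set xs \<subseteq> carrier R"
    and ys: "set ys \<subseteq> m" "S.weakly_regular {\<zero>} ys"
  shows "length ys \<le> length xs"
proof (rule ccontr)
  assume "\<not> length ys \<le> length xs"
  then have lt: "length xs < length ys" by simp
  have zero: "{\<zero>} = {\<zero>\<^bsub>self_module R\<^esub>}" by (simp add: self_module_simps)
  interpret K: koszul R "self_module R" xs by unfold_locales (rule m(2))
  have ysc: "set ys \<subseteq> carrier R" using ys m_simps(1) by auto
  have "\<exists>k::nat. y [^] k \<in> Idl (set xs)" if y: "y \<in> set ys" for y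
  proof -
    have "y \<in> Idl (set xs)" "y \<in> carrier R" using y ys(1) ysc m(1) by auto
    then have "y [^] (1::nat) \<in> Idl (set xs)" by simp
    then show ?thesis ..
  qed
  then have "carrier (self_module R) \<subseteq> fold S.add_mult xs {\<zero>\<^bsub>self_module R\<^esub>}"
    using K.kos_vanishes[OF ysc ys(2)[unfolded zero] lt] K.carrier_le_ideal_times_if_top_vanishes by blast
  also have "\<dots> \<subseteq> m"
  proof (rule S.fold_add_mult_least)
    show "y \<odot>\<^bsub>self_module R\<^esub> u \<in> m" if "y \<in> set xs" "u \<in> carrier (self_module R)" for y u
      using that genideal_self[OF m(2)] m(1) m_simps(5) by (auto simp: self_module_simps)
  qed (use m_ideal m_simps in \<open>auto simp: submodule_self_iff self_module_simps\<close>)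
  finally show False using one_notin_m by (auto simp: self_module_simps)
qed

text \<open>The supremum in \<open>depth\<close>, being finite, is attained.\<close>

lemma regular_sequence_of_length_depth:
  assumes M: "module R M" and d: "depth R M = enat d" "carrier M \<noteq> {\<zero>\<^bsub>M\<^esub>}"
  shows "\<exists>ys. set ys \<subseteq> m \<and> length ys = d \<and> module.weakly_regular M {\<zero>\<^bsub>M\<^esub>} ys"
proof -
  interpret M: module R M by fact
  let ?A = "{enat (length xs) | xs. set xs \<subseteq> the_max_ideal R \<and> regular_sequence R M xs}"
  have S: "Sup ?A = enat d" using d by (simp add: depth_def)
  show ?thesis
  proof (cases d)
    case 0
    then show ?thesis by (intro exI[of _ "[]"]) simp
  next
    case (Suc c)
    then have "enat c < Sup ?A" using S by simp
    then obtain xs where xs: "c < length xs" "set xs \<subseteq> m" "regular_sequence R M xs"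
      unfolding less_Sup_iff m_def by auto
    have "enat (length xs) \<le> Sup ?A" using xs(2,3) unfolding m_def by (intro Sup_upper) auto
    then have "length xs = d" using S xs(1) Suc by simp
    then show ?thesis using xs(2,3) M.regular_sequence_iff[of xs] m_simps(1) by (intro exI[of _ xs]) auto
  qed
qed

text \<open>The sequence realising the depth lies in \<open>m\<close>, the radical of the ideal of
  \<open>xs\<close>, and both lists have length \<open>d\<close>; this is the situation of
  \<open>weakly_regular_if_radical\<close>.\<close>

lemma sop_weakly_regular:
  assumes M: "fin_gen_module R M" and d: "depth R M = krull_dim R" "krull_dim R = enat d" "carrier M \<noteq> {\<zero>\<^bsub>M\<^esub>}"
    and xs: "system_of_parameters R xs"
  shows "module.weakly_regular M {\<zero>\<^bsub>M\<^esub>} xs"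
proof -
  interpret M: module R M using M by (simp add: fin_gen_module_def)
  obtain ys where ys: "set ys \<subseteq> m" "length ys = d" "M.weakly_regular {\<zero>\<^bsub>M\<^esub>} ys"
    using regular_sequence_of_length_depth[OF M.module_axioms _ d(3)] d by auto
  have xs': "set xs \<subseteq> m" "length xs = d" "ideal_radical R (Idl (set xs)) = m"
    using xs d(2) unfolding system_of_parameters_def m_def by auto
  show ?thesis
    using xs' ys m_simps(1) one_minus_unit
    by (intro M.weakly_regular_if_radical[OF M.fin_gen_imp_noeth[OF noeth M] _ _ _ ys(3)])
      (auto simp: ideal_radical_def)
qed

text \<open>For a ring whose depth equals its dimension this makes \<open>krull_dim\<close> finite,
  as the existence of a system of parameters requires.\<close>

lemma depth_finite: "depth R (self_module R) \<noteq> \<infinity>"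
proof -
  obtain A where A: "A \<subseteq> carrier R" "finite A" "m = Idl A"
    using noetherian_ring.finetely_gen[OF noeth m_ideal] by blast
  obtain xs where xs: "set xs = A" using finite_list[OF A(2)] by auto
  have "\<one> \<noteq> \<zero>" using one_notin_m m_simps(2) by auto
  then have "carrier (self_module R) \<noteq> {\<zero>\<^bsub>self_module R\<^esub>}" using one_closed by (auto simp: self_module_simps)
  moreover have "Sup {enat (length ys) | ys. set ys \<subseteq> the_max_ideal R \<and> regular_sequence R (self_module R) ys} \<le> enat (length xs)"
  proof (rule Sup_least)
    fix l assume "l \<in> {enat (length ys) | ys. set ys \<subseteq> the_max_ideal R \<and> regular_sequence R (self_module R) ys}"
    then obtain ys where ys: "l = enat (length ys)" "set ys \<subseteq> m" "regular_sequence R (self_module R) ys"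
      unfolding m_def by auto
    then have "S.weakly_regular {\<zero>} ys" using S.regular_sequence_iff[of ys] m_simps(1) by (auto simp: self_module_simps)
    then show "l \<le> enat (length xs)" using length_regular_le[OF _ _ ys(2), of xs] A xs ys by auto
  qed
  ultimately show ?thesis by (auto simp: depth_def)
qed

text \<open>A regular sequence of length \<open>n\<close>, the dimension, is a system of parameters:
  a prime other than \<open>m\<close> containing it would end a chain of length \<open>n\<close>,
  and \<open>m\<close> on top would exceed the dimension. So \<open>m\<close> is the only prime over
  the sequence, hence the radical of its ideal.\<close>

lemma sop_exists:
  assumes d: "depth R (self_module R) = krull_dim R"
  shows "\<exists>xs. system_of_parameters R xs"
proof -
  obtain n where n: "krull_dim R = enat n" using depth_finite d by auto
  have "\<one> \<noteq> \<zero>" using one_notin_m m_simps(2) by auto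
  then have nz: "carrier (self_module R) \<noteq> {\<zero>\<^bsub>self_module R\<^esub>}" using one_closed by (auto simp: self_module_simps)
  obtain ys where ys: "set ys \<subseteq> m" "length ys = n" "S.weakly_regular {\<zero>} ys"
    using regular_sequence_of_length_depth[OF S.module_axioms _ nz, of n] d n by (auto simp: self_module_simps)
  have ysc: "set ys \<subseteq> carrier R" using ys m_simps(1) by auto
  have only: "P = m" if P: "primeideal P R" "set ys \<subseteq> P" for P
  proof (rule ccontr)
    assume "P \<noteq> m"
    then have "P \<subset> m" using prime_le_m[OF P(1)] by auto
    then have "chain_to (\<lambda>P. primeideal P R) (Suc n) m"
      using prime_chain_if_weakly_regular[OF noeth ysc ys(3) P] m_prime ys(2) by (auto intro: chain_to.Suc)
    then have "enat (Suc n) \<le> krull_dim R"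
      using enat_le_chain_len_iff[of "\<lambda>P. primeideal P R" "Suc n"] m_prime unfolding krull_dim_eq_chain_len by auto
    then show False using n by simp
  qed
  have "ideal_radical R (Idl (set ys)) = m"
  proof
    have "Idl (set ys) \<subseteq> m" using genideal_minimal[OF m_ideal ys(1)] .
    then show "ideal_radical R (Idl (set ys)) \<subseteq> m" unfolding ideal_radical_def using prime_pow[OF m_prime] by auto
    show "m \<subseteq> ideal_radical R (Idl (set ys))"
    proof
      fix a assume a: "a \<in> m"
      then have ac: "a \<in> carrier R" using m_simps(1) by auto
      show "a \<in> ideal_radical R (Idl (set ys))"
      proof (rule ccontr)
        assume "a \<notin> ideal_radical R (Idl (set ys))"
        \<comment> \<open>An ideal missing all powers of \<open>a\<close> is contained in a prime
          missing them, which cannot be \<open>m\<close>.\<close>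
        then have disj: "Idl (set ys) \<inter> range (\<lambda>k::nat. a [^] k) = {}" using ac by (auto simp: ideal_radical_def)
        have "\<exists>P. primeideal P R \<and> Idl (set ys) \<subseteq> P \<and> P \<inter> range (\<lambda>k::nat. a [^] k) = {}"
        proof (rule exists_prime_avoiding[OF noeth genideal_ideal[OF ysc] _ _ _ disj])
          show "\<one> \<in> range (\<lambda>k::nat. a [^] k)" by (rule image_eqI[of _ _ 0]) auto
          show "b \<otimes> c \<in> range (\<lambda>k::nat. a [^] k)" if "b \<in> range (\<lambda>k::nat. a [^] k)" "c \<in> range (\<lambda>k::nat. a [^] k)" for b c
            using that ac by (auto simp: nat_pow_mult)
        qed (use ac in auto)
        then obtain P where P: "primeideal P R" "Idl (set ys) \<subseteq> P" "P \<inter> range (\<lambda>k::nat. a [^] k) = {}" by auto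
        then have "P = m" using only genideal_self[OF ysc] by blast
        moreover have "a [^] (1::nat) \<in> range (\<lambda>k::nat. a [^] k)" by (rule rangeI)
        ultimately show False using P(3) a ac by auto
      qed
    qed
  qed
  then have "system_of_parameters R ys" using ys n unfolding system_of_parameters_def m_def by simp
  then show "\<exists>xs. system_of_parameters R xs" ..
qed

end

section \<open>Idealization\<close>

lemma idealization_simps:
  "carrier (idealization R M) = carrier R \<times> carrier M"
  "(a, x) \<otimes>\<^bsub>idealization R M\<^esub> (b, y) = (a \<otimes>\<^bsub>R\<^esub> b, a \<odot>\<^bsub>M\<^esub> y \<oplus>\<^bsub>M\<^esub> b \<odot>\<^bsub>M\<^esub> x)"
  "(a, x) \<oplus>\<^bsub>idealization R M\<^esub> (b, y) = (a \<oplus>\<^bsub>R\<^esub> b, x \<oplus>\<^bsub>M\<^esub> y)"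
  "\<zero>\<^bsub>idealization R M\<^esub> = (\<zero>\<^bsub>R\<^esub>, \<zero>\<^bsub>M\<^esub>)" "\<one>\<^bsub>idealization R M\<^esub> = (\<one>\<^bsub>R\<^esub>, \<zero>\<^bsub>M\<^esub>)"
  by (simp_all add: idealization_def)

locale idealized = noetherian_local R + M: module R M
  for R :: "('a, 'r) ring_scheme" (structure) and M :: "('a, 'b, 'm) module_scheme" +
  assumes fg: "fin_gen_module R M"
begin

definition A :: "('a \<times> 'b) ring" where "A = idealization R M"

lemmas A_simps = idealization_simps[of R M, folded A_def]

lemma A_cring: "cring A"
proof (rule cringI[OF abelian_groupI comm_monoidI])
  show "\<exists>y\<in>carrier A. y \<oplus>\<^bsub>A\<^esub> x = \<zero>\<^bsub>A\<^esub>" if "x \<in> carrier A" for x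
    using that by (auto simp: A_simps l_neg M.M.l_neg intro!: bexI[of _ "(\<ominus> fst x, \<ominus>\<^bsub>M\<^esub> snd x)"])
  show "x \<otimes>\<^bsub>A\<^esub> y \<otimes>\<^bsub>A\<^esub> z = x \<otimes>\<^bsub>A\<^esub> (y \<otimes>\<^bsub>A\<^esub> z)" if "x \<in> carrier A" "y \<in> carrier A" "z \<in> carrier A" for x y z
  proof -
    from that obtain a u b v c w where *: "x = (a, u)" "y = (b, v)" "z = (c, w)" "a \<in> carrier R" "b \<in> carrier R" "c \<in> carrier R"
      "u \<in> carrier M" "v \<in> carrier M" "w \<in> carrier M" by (auto simp: A_simps)
    have "c \<odot>\<^bsub>M\<^esub> (a \<odot>\<^bsub>M\<^esub> v) = a \<odot>\<^bsub>M\<^esub> (c \<odot>\<^bsub>M\<^esub> v)" "(b \<otimes> c) \<odot>\<^bsub>M\<^esub> u = c \<odot>\<^bsub>M\<^esub> (b \<odot>\<^bsub>M\<^esub> u)"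
      using * by (simp_all add: M.smult_assoc1[symmetric] m_comm)
    then show ?thesis using * by (simp add: A_simps m_assoc M.smult_r_distr M.smult_assoc1 M.M.a_assoc)
  qed
  show "x \<otimes>\<^bsub>A\<^esub> y = y \<otimes>\<^bsub>A\<^esub> x" if "x \<in> carrier A" "y \<in> carrier A" for x y
    using that by (auto simp: A_simps m_comm M.M.a_comm)
  show "(x \<oplus>\<^bsub>A\<^esub> y) \<otimes>\<^bsub>A\<^esub> z = x \<otimes>\<^bsub>A\<^esub> z \<oplus>\<^bsub>A\<^esub> y \<otimes>\<^bsub>A\<^esub> z" if "x \<in> carrier A" "y \<in> carrier A" "z \<in> carrier A" for x y z
    using that by (auto simp: A_simps l_distr M.smult_r_distr M.smult_l_distr M.M.a_ac)
qed (auto simp: A_simps a_assoc a_comm a_lcomm M.M.a_assoc M.M.a_comm M.M.a_lcomm)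

sublocale A: cring A by (rule A_cring)
sublocale SA: module A "self_module A" by (rule A.self_module_module)

lemma A_uminus: "a \<in> carrier R \<Longrightarrow> x \<in> carrier M \<Longrightarrow> \<ominus>\<^bsub>A\<^esub> (a, x) = (\<ominus> a, \<ominus>\<^bsub>M\<^esub> x)"
  by (rule A.minus_equality) (auto simp: A_simps l_neg M.M.l_neg)

lemma SA_uminus: "z \<in> carrier A \<Longrightarrow> \<ominus>\<^bsub>self_module A\<^esub> z = \<ominus>\<^bsub>A\<^esub> z"
  using SA.smult_l_minus[of "\<one>\<^bsub>A\<^esub>" z] by (simp add: self_module_simps A.l_minus)

lemma SR_uminus: "z \<in> carrier R \<Longrightarrow> \<ominus>\<^bsub>self_module R\<^esub> z = \<ominus> z"
  using S.smult_l_minus[of "\<one>" z] by (simp add: self_module_simps l_minus)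

lemma SA_minus:
  "a \<in> carrier R \<Longrightarrow> x \<in> carrier M \<Longrightarrow> b \<in> carrier R \<Longrightarrow> y \<in> carrier M \<Longrightarrow>
    (a, x) \<ominus>\<^bsub>self_module A\<^esub> (b, y) = (a \<ominus>\<^bsub>self_module R\<^esub> b, x \<ominus>\<^bsub>M\<^esub> y)"
  by (simp add: a_minus_def self_module_simps SA_uminus SR_uminus A_simps A_uminus)

lemma submodule_A_iff: "submodule J A (self_module A) \<longleftrightarrow> ideal J A"
  by (rule A.submodule_self_iff)

text \<open>The condition \<open>IK\<close> comes from the product
  \<open>(r, x) (a, y) = (r a, r y + a x)\<close>, whose second entry contains \<open>a x\<close>
  with \<open>x\<close> arbitrary.\<close>

lemma prod_submodule:
  assumes I: "submodule I R (self_module R)" and K: "submodule K R M"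
    and IK: "\<And>a x. a \<in> I \<Longrightarrow> x \<in> carrier M \<Longrightarrow> a \<odot>\<^bsub>M\<^esub> x \<in> K"
  shows "submodule (I \<times> K) A (self_module A)"
proof (rule SA.submodule_if_closed)
  note i = S.submodule_carrier[OF I, unfolded self_module_simps] S.submodule_zero[OF I, unfolded self_module_simps]
    S.submoduleE(4,5)[OF I, unfolded self_module_simps]
  note k = M.submodule_carrier[OF K] M.submodule_zero[OF K] M.submoduleE(4,5)[OF K]
  show "I \<times> K \<subseteq> carrier (self_module A)" using i k by (auto simp: self_module_simps A_simps)
  show "\<zero>\<^bsub>self_module A\<^esub> \<in> I \<times> K" using i k by (auto simp: self_module_simps A_simps)
  show "a \<oplus>\<^bsub>self_module A\<^esub> b \<in> I \<times> K" if "a \<in> I \<times> K" "b \<in> I \<times> K" for a b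
    using that i k by (auto simp: self_module_simps A_simps)
  show "r \<odot>\<^bsub>self_module A\<^esub> a \<in> I \<times> K" if "r \<in> carrier A" "a \<in> I \<times> K" for r a
    using that i k IK by (auto simp: self_module_simps A_simps)
qed

lemma fst_submodule:
  assumes J: "submodule J A (self_module A)"
  shows "submodule (fst ` J) R (self_module R)"
proof (rule S.submodule_if_closed)
  note j = SA.submodule_carrier[OF J, unfolded self_module_simps] SA.submodule_zero[OF J, unfolded self_module_simps]
    SA.submoduleE(4,5)[OF J, unfolded self_module_simps]
  show "fst ` J \<subseteq> carrier (self_module R)" using j(1) by (auto simp: self_module_simps A_simps)
  show "\<zero>\<^bsub>self_module R\<^esub> \<in> fst ` J" using j(2) by (auto simp: self_module_simps A_simps intro!: image_eqI)
  show "a \<oplus>\<^bsub>self_module R\<^esub> b \<in> fst ` J" if "a \<in> fst ` J" "b \<in> fst ` J" for a b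
  proof -
    from that obtain x y where "(a, x) \<in> J" "(b, y) \<in> J" by auto
    from j(4)[OF this] show ?thesis by (auto simp: self_module_simps A_simps intro!: image_eqI)
  qed
  show "r \<odot>\<^bsub>self_module R\<^esub> a \<in> fst ` J" if r: "r \<in> carrier R" "a \<in> fst ` J" for r a
  proof -
    from r obtain x where "(a, x) \<in> J" by auto
    then have "(r, \<zero>\<^bsub>M\<^esub>) \<otimes>\<^bsub>A\<^esub> (a, x) \<in> J" using r by (intro j(3)) (auto simp: A_simps)
    then show ?thesis by (auto simp: self_module_simps A_simps intro!: image_eqI)
  qed
qed

lemma vertical_submodule:
  assumes J: "submodule J A (self_module A)"
  shows "submodule {x. (\<zero>, x) \<in> J} R M"
proof (rule M.submodule_if_closed)
  note j = SA.submodule_carrier[OF J, unfolded self_module_simps] SA.submodule_zero[OF J, unfolded self_module_simps]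
    SA.submoduleE(4,5)[OF J, unfolded self_module_simps]
  show "{x. (\<zero>, x) \<in> J} \<subseteq> carrier M" using j(1) by (auto simp: A_simps)
  show "\<zero>\<^bsub>M\<^esub> \<in> {x. (\<zero>, x) \<in> J}" using j(2) by (auto simp: A_simps)
  show "a \<oplus>\<^bsub>M\<^esub> b \<in> {x. (\<zero>, x) \<in> J}" if "a \<in> {x. (\<zero>, x) \<in> J}" "b \<in> {x. (\<zero>, x) \<in> J}" for a b
    using j(4)[of "(\<zero>, a)" "(\<zero>, b)"] that by (auto simp: A_simps)
  show "r \<odot>\<^bsub>M\<^esub> a \<in> {x. (\<zero>, x) \<in> J}" if "r \<in> carrier R" "a \<in> {x. (\<zero>, x) \<in> J}" for r a
    using j(1)[of "(\<zero>, a)"] j(3)[of "(r, \<zero>\<^bsub>M\<^esub>)" "(\<zero>, a)"] that by (auto simp: A_simps)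
qed

text \<open>An ideal \<open>J\<close> is generated by lifts of generators of its projection to
  \<open>R\<close> together with generators of its part inside \<open>0 \<times> M\<close>. The
  former exist because \<open>R\<close> is Noetherian, the latter because \<open>M\<close> is
  finitely generated over it.\<close>

lemma A_noetherian: "noetherian_ring A"
proof (rule A.noetherian_ringI)
  fix J assume "ideal J A"
  then have J: "submodule J A (self_module A)" by (simp add: submodule_A_iff)
  note j = SA.submodule_carrier[OF J, unfolded self_module_simps] SA.submodule_zero[OF J, unfolded self_module_simps]
    SA.submoduleE(4,5)[OF J, unfolded self_module_simps]
  let ?K = "{x. (\<zero>, x) \<in> J}"
  obtain T where T: "finite T" "T \<subseteq> fst ` J" "submodule_span R (self_module R) T = fst ` J"
    using noeth_self[OF noeth, unfolded S.noeth_def, rule_format, OF fst_submodule[OF J]] by auto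
  obtain T' where T': "finite T'" "T' \<subseteq> J" "T = fst ` T'" using finite_subset_image[OF T(1,2)] by blast
  obtain U where U: "finite U" "U \<subseteq> ?K" "submodule_span R M U = ?K"
    using M.fin_gen_imp_noeth[OF noeth fg, unfolded M.noeth_def, rule_format, OF vertical_submodule[OF J]] by auto
  let ?G = "T' \<union> Pair \<zero> ` U"
  have GJ: "?G \<subseteq> J" using T' U by auto
  then have Gc: "?G \<subseteq> carrier A" using j(1) by auto
  let ?H = "submodule_span A (self_module A) ?G"
  have H: "submodule ?H A (self_module A)" using Gc by (intro SA.span_submodule) (simp add: self_module_simps)
  note h = SA.submodule_carrier[OF H, unfolded self_module_simps] SA.submoduleE(5)[OF H, unfolded self_module_simps]
  have up: "?G \<subseteq> ?H" by (rule SA.span_upper)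
  have HJ: "?H \<subseteq> J" using GJ by (intro SA.span_least[OF J])
  have "submodule_span R M U \<subseteq> {x. (\<zero>, x) \<in> ?H}" using up by (intro M.span_least[OF vertical_submodule[OF H]]) auto
  then have vert: "(\<zero>, x) \<in> ?H" if "(\<zero>, x) \<in> J" for x using that U(3) by auto
  have "submodule_span R (self_module R) T \<subseteq> fst ` ?H" using up T' by (intro S.span_least[OF fst_submodule[OF H]]) auto
  then have horiz: "fst ` J \<subseteq> fst ` ?H" using T(3) by simp
  have "J \<subseteq> ?H"
  proof
    fix z assume z: "z \<in> J"
    then obtain w where w: "w \<in> ?H" "fst w = fst z" using horiz by force
    have c: "z \<in> carrier A" "w \<in> carrier A" using z w(1) j(1) h(1) by auto
    have zw: "z \<ominus>\<^bsub>self_module A\<^esub> w \<in> J" using SA.submodule_minus[OF J z] w(1) HJ by blast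
    moreover have "z \<ominus>\<^bsub>self_module A\<^esub> w = (\<zero>, snd z \<ominus>\<^bsub>M\<^esub> snd w)"
    proof -
      obtain a x y where zw: "z = (a, x)" "w = (a, y)" using w(2) by (cases z; cases w) auto
      then have "a \<in> carrier R" "x \<in> carrier M" "y \<in> carrier M" using c by (auto simp: A_simps)
      then show ?thesis unfolding zw by (simp add: SA_minus) (simp add: a_minus_def SR_uminus self_module_simps r_neg)
    qed
    ultimately have "z \<ominus>\<^bsub>self_module A\<^esub> w \<in> ?H" using vert by auto
    from SA.submoduleE(5)[OF H this w(1)] show "z \<in> ?H"
      using SA.add_minus_cancel(2)[of z w] c by (simp add: self_module_simps)
  qed
  then have "J = Idl\<^bsub>A\<^esub> ?G" using HJ by (auto simp: A.span_self)
  then show "\<exists>G\<subseteq>carrier A. finite G \<and> J = Idl\<^bsub>A\<^esub> G" using Gc T'(1) U(1) by (intro exI[of _ ?G]) auto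
qed

lemma prime_times_carrier:
  assumes "primeideal P R" shows "primeideal (P \<times> carrier M) A"
proof (rule primeidealI[OF _ A_cring])
  interpret P: primeideal P R by fact
  have "submodule P R (self_module R)" using P.is_ideal by (simp add: submodule_self_iff)
  then show "ideal (P \<times> carrier M) A"
    using prod_submodule[OF _ M.carrier_is_submodule] P.a_subset by (auto simp: submodule_A_iff)
  show "carrier A \<noteq> P \<times> carrier M" using P.I_notcarr M.M.zero_closed by (auto simp: A_simps)
  show "z \<in> P \<times> carrier M \<or> w \<in> P \<times> carrier M" if "z \<in> carrier A" "w \<in> carrier A" "z \<otimes>\<^bsub>A\<^esub> w \<in> P \<times> carrier M" for z w
    using that P.I_prime[of "fst z" "fst w"] by (cases z; cases w) (auto simp: A_simps)
qed

text \<open>Elements \<open>(0, x)\<close> have square zero, so every prime contains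
  \<open>0 \<times> M\<close> and is the preimage of a prime of \<open>R\<close>.\<close>

lemma prime_of_A:
  assumes Q: "primeideal Q A"
  obtains P where "primeideal P R" "Q = P \<times> carrier M"
proof
  interpret Q: primeideal Q A by fact
  have Qs: "submodule Q A (self_module A)" using Q.is_ideal by (simp add: submodule_A_iff)
  have Qc: "Q \<subseteq> carrier R \<times> carrier M" using Q.a_subset by (simp add: A_simps)
  have nil: "(\<zero>, x) \<in> Q" if x: "x \<in> carrier M" for x
  proof -
    have "(\<zero>, x) \<otimes>\<^bsub>A\<^esub> (\<zero>, x) = \<zero>\<^bsub>A\<^esub>" using x by (simp add: A_simps)
    then have "(\<zero>, x) \<otimes>\<^bsub>A\<^esub> (\<zero>, x) \<in> Q" using Q.zero_closed by metis
    then show ?thesis using Q.I_prime[of "(\<zero>, x)" "(\<zero>, x)"] x by (auto simp: A_simps)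
  qed
  have mv: "(a, y) \<in> Q" if "(a, x) \<in> Q" "y \<in> carrier M" for a x y
  proof -
    have c: "a \<in> carrier R" "x \<in> carrier M" using that Qc by auto
    have "(a, x) \<oplus>\<^bsub>A\<^esub> (\<zero>, y \<ominus>\<^bsub>M\<^esub> x) \<in> Q" using that nil c by (intro Q.a_closed) auto
    then show ?thesis using c that M.add_minus_cancel(2)[of y x] by (simp add: A_simps M.M.a_comm)
  qed
  show eq: "Q = fst ` Q \<times> carrier M" using mv Qc by force
  show "primeideal (fst ` Q) R"
  proof (rule primeidealI[OF _ is_cring])
    show "ideal (fst ` Q) R" using fst_submodule[OF Qs] by (simp add: submodule_self_iff)
    show "carrier R \<noteq> fst ` Q" using Q.I_notcarr eq by (auto simp: A_simps)
    show "a \<in> fst ` Q \<or> b \<in> fst ` Q" if ab: "a \<in> carrier R" "b \<in> carrier R" "a \<otimes> b \<in> fst ` Q" for a b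
    proof -
      have "(a, \<zero>\<^bsub>M\<^esub>) \<otimes>\<^bsub>A\<^esub> (b, \<zero>\<^bsub>M\<^esub>) \<in> Q" using ab by (subst eq) (simp add: A_simps)
      then have "(a, \<zero>\<^bsub>M\<^esub>) \<in> Q \<or> (b, \<zero>\<^bsub>M\<^esub>) \<in> Q" using ab by (intro Q.I_prime) (auto simp: A_simps)
      then show ?thesis by force
    qed
  qed
qed

text \<open>The primes of the two rings correspond, with inclusions, under multiplying by the factor
  \<open>carrier M\<close>.\<close>

lemma krull_dim_A: "krull_dim A = krull_dim R"
proof (rule antisym)
  have ne: "carrier M \<noteq> {}" using M.M.zero_closed by blast
  have fst: "fst ` (P \<times> carrier M) = P" for P :: "'a set" using ne by force
  show "krull_dim A \<le> krull_dim R" unfolding krull_dim_eq_chain_len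
  proof (rule chain_len_mono_map[where \<phi> = "\<lambda>Q. fst ` Q"])
    show "primeideal (fst ` Q) R" if "primeideal Q A" for Q
      using prime_of_A[OF that] fst by metis
    show "fst ` Q \<subset> fst ` Q'" if Q: "primeideal Q A" and Q': "primeideal Q' A" and lt: "Q \<subset> Q'" for Q Q'
    proof -
      obtain P where P: "Q = P \<times> carrier M" by (rule prime_of_A[OF Q])
      obtain P' where P': "Q' = P' \<times> carrier M" by (rule prime_of_A[OF Q'])
      show ?thesis using lt unfolding P P' fst using ne by auto
    qed
  qed
  show "krull_dim R \<le> krull_dim A" unfolding krull_dim_eq_chain_len
  proof (rule chain_len_mono_map[where \<phi> = "\<lambda>P. P \<times> carrier M"])
    show "primeideal (P \<times> carrier M) A" if "primeideal P R" for P using prime_times_carrier[OF that] .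
    show "P \<times> carrier M \<subset> P' \<times> carrier M" if "P \<subset> P'" for P P' using that ne by auto
  qed
qed

lemma m_times_carrier_proper: "ideal (m \<times> carrier M) A" "m \<times> carrier M \<noteq> carrier A"
  using prime_times_carrier[OF m_prime] by (auto simp: primeideal_def primeideal_axioms_def)

text \<open>Every maximal ideal is prime, so it has the form \<open>P \<times> carrier M\<close> and
  lies in the proper ideal \<open>m \<times> carrier M\<close>, hence equals it. That this ideal is
  maximal follows since some maximal ideal exists.\<close>

lemma maximal_A_iff: "maximalideal n A \<longleftrightarrow> n = m \<times> carrier M"
proof -
  have only: "n = m \<times> carrier M" if n: "maximalideal n A" for n
  proof -
    obtain P where P: "primeideal P R" "n = P \<times> carrier M"
      by (rule prime_of_A[OF A.maximalideal_prime[OF n]])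
    then have "n \<subseteq> m \<times> carrier M" using prime_le_m[OF P(1)] by auto
    then show ?thesis
      using maximalideal.I_maximal[OF n m_times_carrier_proper(1)] m_times_carrier_proper
        A.idealD(1)[OF m_times_carrier_proper(1)] by auto
  qed
  obtain n where "maximalideal n A"
    using A.exists_maximalideal[OF A_noetherian m_times_carrier_proper] by auto
  then show ?thesis using only by metis
qed

lemma max_ideal_A: "the_max_ideal A = m \<times> carrier M"
  unfolding the_max_ideal_def maximal_A_iff by simp

section \<open>Regular sequences and the socle of the idealization\<close>

lemma add_mult_A:
  assumes I: "submodule I R (self_module R)" and K: "submodule K R M" and y: "y \<in> carrier R"
  shows "SA.add_mult (y, \<zero>\<^bsub>M\<^esub>) (I \<times> K) = S.add_mult y I \<times> M.add_mult y K"
proof -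
  have "z \<in> SA.add_mult (y, \<zero>\<^bsub>M\<^esub>) (I \<times> K) \<longleftrightarrow> z \<in> S.add_mult y I \<times> M.add_mult y K" for z
  proof (cases z)
    case (Pair a x)
    have cong: "cong_mod (self_module A) (I \<times> K) (a, x) ((y, \<zero>\<^bsub>M\<^esub>) \<odot>\<^bsub>self_module A\<^esub> (b, u)) \<longleftrightarrow>
        cong_mod (self_module R) I a (y \<odot>\<^bsub>self_module R\<^esub> b) \<and> cong_mod M K x (y \<odot>\<^bsub>M\<^esub> u)"
      if "a \<in> carrier R" "x \<in> carrier M" "b \<in> carrier R" "u \<in> carrier M" for b u
    proof -
      have "(y, \<zero>\<^bsub>M\<^esub>) \<odot>\<^bsub>self_module A\<^esub> (b, u) = (y \<otimes> b, y \<odot>\<^bsub>M\<^esub> u)"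
        using that y by (simp add: self_module_simps A_simps)
      then show ?thesis using that y SA_minus[of a x "y \<otimes> b" "y \<odot>\<^bsub>M\<^esub> u"]
        by (simp add: cong_mod_def self_module_simps A_simps)
    qed
    have "z \<in> SA.add_mult (y, \<zero>\<^bsub>M\<^esub>) (I \<times> K) \<longleftrightarrow> a \<in> carrier R \<and> x \<in> carrier M \<and>
        (\<exists>b\<in>carrier R. \<exists>u\<in>carrier M. cong_mod (self_module A) (I \<times> K) (a, x) ((y, \<zero>\<^bsub>M\<^esub>) \<odot>\<^bsub>self_module A\<^esub> (b, u)))"
      unfolding SA.add_mult_def Pair by (auto simp: self_module_simps(1) A_simps(1))
    also have "\<dots> \<longleftrightarrow> a \<in> carrier R \<and> x \<in> carrier M \<and>
        (\<exists>b\<in>carrier R. \<exists>u\<in>carrier M. cong_mod (self_module R) I a (y \<odot>\<^bsub>self_module R\<^esub> b) \<and> cong_mod M K x (y \<odot>\<^bsub>M\<^esub> u))"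
      using cong by (intro conj_cong refl bex_cong) auto
    also have "\<dots> \<longleftrightarrow> z \<in> S.add_mult y I \<times> M.add_mult y K"
      unfolding S.add_mult_def M.add_mult_def Pair by (auto simp: self_module_simps(1))
    finally show ?thesis .
  qed
  then show ?thesis by blast
qed

lemma regular_mod_A:
  assumes y: "y \<in> carrier R" and "S.regular_mod I y" "M.regular_mod K y"
  shows "SA.regular_mod (I \<times> K) (y, \<zero>\<^bsub>M\<^esub>)"
  using assms unfolding S.regular_mod_def M.regular_mod_def SA.regular_mod_def
  by (auto simp: self_module_simps A_simps)

text \<open>Multiplication by \<open>(y, 0)\<close> acts on the two components separately, so a
  sequence regular on \<open>R\<close> and on \<open>M\<close> gives one on \<open>A\<close>, and
  the submodule modulo which the socle is taken splits as a product.\<close>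

lemma weakly_regular_A:
  assumes ys: "set ys \<subseteq> carrier R" and I: "submodule I R (self_module R)" and K: "submodule K R M"
    and "S.weakly_regular I ys" "M.weakly_regular K ys"
  shows "SA.weakly_regular (I \<times> K) (map (\<lambda>y. (y, \<zero>\<^bsub>M\<^esub>)) ys) \<and>
    fold SA.add_mult (map (\<lambda>y. (y, \<zero>\<^bsub>M\<^esub>)) ys) (I \<times> K) = fold S.add_mult ys I \<times> fold M.add_mult ys K"
  using assms
proof (induction ys arbitrary: I K)
  case (Cons y ys)
  have y: "y \<in> carrier R" using Cons.prems by simp
  show ?case
    using Cons.IH[OF _ S.add_mult_submodule[OF Cons.prems(2) y] M.add_mult_submodule[OF Cons.prems(3) y]] Cons.prems
      add_mult_A[OF Cons.prems(2,3) y] regular_mod_A[OF y] by auto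
qed simp

text \<open>The socle of \<^term>\<open>A\<close> modulo \<^term>\<open>q \<times> K\<close> is \<^term>\<open>W \<times> M.colon_sub K m\<close>.\<close>

lemma rlen_A_socle:
  assumes q: "submodule q R (self_module R)" and K: "submodule K R M"
    and qK: "\<And>a x. a \<in> q \<Longrightarrow> x \<in> carrier M \<Longrightarrow> a \<odot>\<^bsub>M\<^esub> x \<in> K"
  defines "W \<equiv> {a \<in> S.colon_sub q m. \<forall>x\<in>carrier M. a \<odot>\<^bsub>M\<^esub> x \<in> K}"
  shows "rlen A (self_module A) (q \<times> K) (SA.colon_sub (q \<times> K) (m \<times> carrier M)) =
    rlen R (self_module R) q W + rlen R M K (M.colon_sub K m)"
    and "submodule W R (self_module R)" and "q \<subseteq> W"
proof -
  let ?C = "M.colon_sub K m"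
  note C = M.colon_sub_submodule[OF K m_simps(1)] and KC = M.colon_sub_upper[OF K m_simps(1)]
  note Cq = S.colon_sub_submodule[OF q m_simps(1)] and qC = S.colon_sub_upper[OF q m_simps(1)]
  note c = S.submodule_carrier[OF Cq, unfolded self_module_simps] S.submodule_zero[OF Cq, unfolded self_module_simps]
    S.submoduleE(4,5)[OF Cq, unfolded self_module_simps]
  note qc = S.submodule_carrier[OF q, unfolded self_module_simps] S.submodule_zero[OF q, unfolded self_module_simps]
  note k = M.submodule_carrier[OF K] M.submodule_zero[OF K] M.submoduleE(4,5)[OF K]
  show W: "submodule W R (self_module R)"
    by (rule S.submodule_if_closed) (use c k in \<open>auto simp: W_def self_module_simps M.smult_l_distr M.smult_assoc1\<close>)
  show qW: "q \<subseteq> W" using qC qK by (auto simp: W_def)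
  have WK: "a \<odot>\<^bsub>M\<^esub> x \<in> K" if "a \<in> W" "x \<in> carrier M" for a x using that by (auto simp: W_def)
  have Cc: "?C \<subseteq> carrier M" by (auto simp: M.colon_sub_def)
  have WC: "SA.colon_sub (q \<times> K) (m \<times> carrier M) = W \<times> ?C"
  proof -
    have "(a, u) \<in> SA.colon_sub (q \<times> K) (m \<times> carrier M) \<longleftrightarrow> (a, u) \<in> W \<times> ?C" for a u
    proof
      assume au: "(a, u) \<in> SA.colon_sub (q \<times> K) (m \<times> carrier M)"
      then have ac: "a \<in> carrier R" "u \<in> carrier M" by (auto simp: SA.colon_sub_def self_module_simps A_simps)
      have *: "b \<otimes> a \<in> q" "b \<odot>\<^bsub>M\<^esub> u \<oplus>\<^bsub>M\<^esub> a \<odot>\<^bsub>M\<^esub> z \<in> K" if "b \<in> m" "z \<in> carrier M" for b z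
        using au that by (auto simp: SA.colon_sub_def self_module_simps A_simps)
      \<comment> \<open>Testing against \<open>(b, 0)\<close> and \<open>(0, z)\<close> separates
        the two summands of the second entry.\<close>
      have "b \<odot>\<^bsub>M\<^esub> u \<in> K" if "b \<in> m" for b using *(2)[OF that M.M.zero_closed] m_simps(1) that ac by auto
      moreover have "a \<odot>\<^bsub>M\<^esub> z \<in> K" if "z \<in> carrier M" for z using *(2)[OF m_simps(2) that] that ac by auto
      moreover have "b \<otimes> a \<in> q" if "b \<in> m" for b using *(1)[OF that M.M.zero_closed] .
      ultimately show "(a, u) \<in> W \<times> ?C" using ac by (auto simp: W_def S.colon_sub_def M.colon_sub_def self_module_simps)
    next
      assume "(a, u) \<in> W \<times> ?C"
      then show "(a, u) \<in> SA.colon_sub (q \<times> K) (m \<times> carrier M)"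
        using k by (auto simp: W_def S.colon_sub_def M.colon_sub_def SA.colon_sub_def self_module_simps A_simps)
    qed
    then show ?thesis by auto
  qed
  have qKA: "submodule (q \<times> K) A (self_module A)" by (rule prod_submodule[OF q K qK])
  have qCA: "submodule (q \<times> ?C) A (self_module A)" using qK KC by (intro prod_submodule[OF q C]) auto
  have WCA: "submodule (W \<times> ?C) A (self_module A)" using WK KC by (intro prod_submodule[OF W C]) auto
  have "rlen A (self_module A) (q \<times> K) (W \<times> ?C) =
      rlen A (self_module A) (q \<times> K) (q \<times> ?C) + rlen A (self_module A) (q \<times> ?C) (W \<times> ?C)"
    using qW KC by (intro SA.rlen_additive[OF qKA qCA WCA]) auto
  \<comment> \<open>Lengths over two different rings are compared, so chains are carried over in
    both directions. Submodules between these bounds are determined by their fibre over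
    zero.\<close>
  also have "rlen A (self_module A) (q \<times> K) (q \<times> ?C) = rlen R M K ?C"
  proof (rule antisym)
    show "rlen A (self_module A) (q \<times> K) (q \<times> ?C) \<le> rlen R M K ?C"
      unfolding rlen_def
    proof (rule chain_len_mono_map[where \<phi> = "\<lambda>J. {x. (\<zero>, x) \<in> J}"])
      fix J assume "submodule J A (self_module A) \<and> q \<times> K \<subseteq> J \<and> J \<subseteq> q \<times> ?C"
      then show "submodule {x. (\<zero>, x) \<in> J} R M \<and> K \<subseteq> {x. (\<zero>, x) \<in> J} \<and> {x. (\<zero>, x) \<in> J} \<subseteq> ?C"
        using vertical_submodule[of J] qc(2) by auto
    next
      fix J J' assume J: "submodule J A (self_module A) \<and> q \<times> K \<subseteq> J \<and> J \<subseteq> q \<times> ?C"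
        and J': "submodule J' A (self_module A) \<and> q \<times> K \<subseteq> J' \<and> J' \<subseteq> q \<times> ?C" and lt: "J \<subset> J'"
      \<comment> \<open>\<open>q \<times> {0}\<close> lies in \<open>J\<close>, so the first entry
        can be changed freely within \<open>q\<close>.\<close>
      have mv: "(a, x) \<in> J \<longleftrightarrow> a \<in> q \<and> (\<zero>, x) \<in> J"
        if J: "submodule J A (self_module A) \<and> q \<times> K \<subseteq> J \<and> J \<subseteq> q \<times> ?C" for J a x
      proof -
        have Js: "submodule J A (self_module A)" using J by blast
        have e: "(b, x) \<in> J \<Longrightarrow> e \<in> q \<Longrightarrow> (e, x) \<in> J" for b e
        proof -
          assume bx: "(b, x) \<in> J" and e: "e \<in> q"
          then have c: "b \<in> q" "x \<in> carrier M" using J Cc by auto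
          then have "e \<ominus>\<^bsub>self_module R\<^esub> b \<in> q" using S.submodule_minus[OF q e] by simp
          then have "(e \<ominus>\<^bsub>self_module R\<^esub> b, \<zero>\<^bsub>M\<^esub>) \<in> J" using J k(2) by auto
          from SA.submoduleE(5)[OF Js this bx] show "(e, x) \<in> J"
            using S.add_minus_cancel(2)[of e b] c e qc by (simp add: self_module_simps A_simps)
        qed
        show ?thesis using e[of a \<zero>] e[of \<zero> a] J qc(2) by auto
      qed
      obtain a x where ax: "(a, x) \<in> J'" "(a, x) \<notin> J" using lt by auto
      have "x \<in> {x. (\<zero>, x) \<in> J'}" "x \<notin> {x. (\<zero>, x) \<in> J}"
        using mv[OF J', of a x] mv[OF J, of a x] ax by blast+
      then show "{x. (\<zero>, x) \<in> J} \<subset> {x. (\<zero>, x) \<in> J'}" using lt by auto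
    qed
    show "rlen R M K ?C \<le> rlen A (self_module A) (q \<times> K) (q \<times> ?C)"
      unfolding rlen_def
    proof (rule chain_len_mono_map[where \<phi> = "\<lambda>N. q \<times> N"])
      show "submodule (q \<times> N) A (self_module A) \<and> q \<times> K \<subseteq> q \<times> N \<and> q \<times> N \<subseteq> q \<times> ?C"
        if "submodule N R M \<and> K \<subseteq> N \<and> N \<subseteq> ?C" for N
        using that qK prod_submodule[OF q, of N] by auto
      show "q \<times> N \<subset> q \<times> N'" if "N \<subset> N'" for N N' using that qc(2) by auto
    qed
  qed
  \<comment> \<open>Here \<open>{0} \<times> ?C\<close> lies in all submodules of the interval, so
    each is determined by its projection to \<open>R\<close>.\<close>
  also have "rlen A (self_module A) (q \<times> ?C) (W \<times> ?C) = rlen R (self_module R) q W"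
  proof (rule antisym)
    have C0: "\<zero>\<^bsub>M\<^esub> \<in> ?C" using KC k(2) by auto
    have fst: "fst ` (B \<times> ?C) = B" for B :: "'a set" using C0 by force
    show "rlen A (self_module A) (q \<times> ?C) (W \<times> ?C) \<le> rlen R (self_module R) q W"
      unfolding rlen_def
    proof (rule chain_len_mono_map[where \<phi> = "\<lambda>J. fst ` J"])
      fix J assume J: "submodule J A (self_module A) \<and> q \<times> ?C \<subseteq> J \<and> J \<subseteq> W \<times> ?C"
      then have "fst ` (q \<times> ?C) \<subseteq> fst ` J" "fst ` J \<subseteq> fst ` (W \<times> ?C)" by (meson image_mono)+
      then show "submodule (fst ` J) R (self_module R) \<and> q \<subseteq> fst ` J \<and> fst ` J \<subseteq> W"
        using J fst_submodule[of J] unfolding fst by blast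
    next
      fix J J' assume J: "submodule J A (self_module A) \<and> q \<times> ?C \<subseteq> J \<and> J \<subseteq> W \<times> ?C"
        and J': "submodule J' A (self_module A) \<and> q \<times> ?C \<subseteq> J' \<and> J' \<subseteq> W \<times> ?C" and lt: "J \<subset> J'"
      have mv: "(a, y) \<in> J" if "(a, x) \<in> J" "y \<in> ?C" for a x y
      proof -
        have ac: "a \<in> carrier R" "x \<in> ?C" using that J S.submodule_carrier[OF W] by (auto simp: self_module_simps)
        have "y \<ominus>\<^bsub>M\<^esub> x \<in> ?C" using M.submodule_minus[OF C that(2) ac(2)] .
        then have "(\<zero>, y \<ominus>\<^bsub>M\<^esub> x) \<in> J" using J qc(2) by auto
        from SA.submoduleE(5)[of J, OF _ that(1) this] show ?thesis
          using J ac that(2) Cc M.add_minus_cancel(2)[of y x] M.M.a_comm[of x "y \<ominus>\<^bsub>M\<^esub> x"] by (auto simp: self_module_simps A_simps subset_iff)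
      qed
      obtain a x where ax: "(a, x) \<in> J'" "(a, x) \<notin> J" using lt by auto
      then have "x \<in> ?C" using J' by auto
      then have "a \<notin> fst ` J" using ax(2) mv by auto
      moreover have "a \<in> fst ` J'" using ax(1) by force
      moreover have "fst ` J \<subseteq> fst ` J'" using lt by auto
      ultimately show "fst ` J \<subset> fst ` J'" by auto
    qed
    show "rlen R (self_module R) q W \<le> rlen A (self_module A) (q \<times> ?C) (W \<times> ?C)"
      unfolding rlen_def
    proof (rule chain_len_mono_map[where \<phi> = "\<lambda>N. N \<times> ?C"])
      show "submodule (N \<times> ?C) A (self_module A) \<and> q \<times> ?C \<subseteq> N \<times> ?C \<and> N \<times> ?C \<subseteq> W \<times> ?C"
        if N: "submodule N R (self_module R) \<and> q \<subseteq> N \<and> N \<subseteq> W" for N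
      proof (intro conjI prod_submodule[OF _ C])
        show "a \<odot>\<^bsub>M\<^esub> x \<in> ?C" if "a \<in> N" "x \<in> carrier M" for a x
          using WK[of a x] that N KC by blast
      qed (use N in auto)
      show "N \<times> ?C \<subset> N' \<times> ?C" if "N \<subset> N'" for N N' using that C0 by auto
    qed
  qed
  finally show "rlen A (self_module A) (q \<times> K) (SA.colon_sub (q \<times> K) (m \<times> carrier M)) =
    rlen R (self_module R) q W + rlen R M K ?C" by (simp add: WC add.commute)
qed

end

section \<open>Reduction modulo a parameter ideal\<close>

text \<open>Neither the representative of the scalar nor that of the vector matters, since
  \<open>q\<close> carries \<open>M\<close> into the submodule divided out; the double union is a
  single coset.\<close>

lemma (in module) reduced_module_smult:
  assumes q: "ideal q R" and a: "a \<in> carrier R" and x: "x \<in> carrier M"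
  shows "(\<Union>a'\<in>q +>\<^bsub>R\<^esub> a. \<Union>x'\<in>ideal_times_module R q M +>\<^bsub>M\<^esub> x. ideal_times_module R q M +>\<^bsub>M\<^esub> (a' \<odot>\<^bsub>M\<^esub> x'))
    = ideal_times_module R q M +>\<^bsub>M\<^esub> (a \<odot>\<^bsub>M\<^esub> x)"
proof -
  let ?K = "ideal_times_module R q M"
  note qD = R.idealD[OF q]
  interpret q: ideal q R by (rule q)
  note K = ideal_times_submodule[OF qD(1)]
  interpret K: abelian_subgroup ?K M by (rule submodule_abelian_subgroup[OF K])
  have mem: "p \<odot>\<^bsub>M\<^esub> y \<in> ?K" if "p \<in> q" "y \<in> carrier M" for p y
    using that span_upper[of "{a \<odot>\<^bsub>M\<^esub> x | a x. a \<in> q \<and> x \<in> carrier M}"] unfolding ideal_times_module_def by blast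
  have "?K +>\<^bsub>M\<^esub> (a' \<odot>\<^bsub>M\<^esub> x') = ?K +>\<^bsub>M\<^esub> (a \<odot>\<^bsub>M\<^esub> x)" if a': "a' \<in> q +>\<^bsub>R\<^esub> a" and x': "x' \<in> ?K +>\<^bsub>M\<^esub> x" for a' x'
  proof -
    obtain p where p: "p \<in> q" "a' = p \<oplus> a" using a' by (auto simp: a_r_coset_def')
    have pc: "p \<in> carrier R" using p(1) qD(1) by auto
    have xc: "x' \<in> carrier M" using coset_mem_carrier[OF K x x'] .
    have "cong_mod M ?K x' x" using mem_coset_iff[OF K xc x] x' xc x by (simp add: cong_mod_def)
    then have 1: "cong_mod M ?K (a \<odot>\<^bsub>M\<^esub> x') (a \<odot>\<^bsub>M\<^esub> x)" by (rule cong_mod_smult[OF K a])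
    have "cong_mod M ?K (p \<odot>\<^bsub>M\<^esub> x') \<zero>\<^bsub>M\<^esub>" by (rule cong_mod_zero[OF mem[OF p(1) xc] K])
    from cong_mod_add[OF K this 1] have "cong_mod M ?K (a' \<odot>\<^bsub>M\<^esub> x') (a \<odot>\<^bsub>M\<^esub> x)"
      using p pc a x xc by (simp add: smult_l_distr)
    then show ?thesis using coset_eq_iff[OF K] by (auto simp: cong_mod_def)
  qed
  moreover have "a \<in> q +>\<^bsub>R\<^esub> a" "x \<in> ?K +>\<^bsub>M\<^esub> x" using q.a_rcos_self[OF a] K.a_rcos_self[OF x] .
  ultimately show ?thesis by blast
qed

text \<open>The reduced module always satisfies the module axioms over \<open>R Quot q\<close>, so
  faithfulness is a statement on the annihilator, whose preimage in \<open>R\<close> is the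
  displayed set.\<close>

lemma (in module) faithful_reduced_module_iff:
  assumes q: "ideal q R"
  shows "faithful_module (R Quot q) (reduced_module R q M) \<longleftrightarrow>
    {a \<in> carrier R. \<forall>x\<in>carrier M. a \<odot>\<^bsub>M\<^esub> x \<in> ideal_times_module R q M} = q"
proof -
  let ?K = "ideal_times_module R q M" and ?Q = "reduced_module R q M"
  note qD = R.idealD[OF q]
  interpret q: ideal q R by (rule q)
  note K = ideal_times_submodule[OF qD(1)]
  interpret K: abelian_subgroup ?K M by (rule submodule_abelian_subgroup[OF K])
  have mem: "p \<odot>\<^bsub>M\<^esub> y \<in> ?K" if "p \<in> q" "y \<in> carrier M" for p y
    using that span_upper[of "{a \<odot>\<^bsub>M\<^esub> x | a x. a \<in> q \<and> x \<in> carrier M}"] unfolding ideal_times_module_def by blast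
  have carr: "carrier ?Q = (\<lambda>x. ?K +>\<^bsub>M\<^esub> x) ` carrier M" "\<zero>\<^bsub>?Q\<^esub> = ?K"
    unfolding reduced_module_def Let_def A_RCOSETS_def RCOSETS_def a_r_coset_def by auto
  have Rcarr: "carrier (R Quot q) = (\<lambda>a. q +>\<^bsub>R\<^esub> a) ` carrier R" "\<zero>\<^bsub>R Quot q\<^esub> = q"
    unfolding FactRing_def A_RCOSETS_def RCOSETS_def a_r_coset_def by auto
  have smult: "(q +>\<^bsub>R\<^esub> a) \<odot>\<^bsub>?Q\<^esub> (?K +>\<^bsub>M\<^esub> x) = ?K +>\<^bsub>M\<^esub> (a \<odot>\<^bsub>M\<^esub> x)" if "a \<in> carrier R" "x \<in> carrier M" for a x
    using reduced_module_smult[OF q that] unfolding reduced_module_def Let_def by simp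
  have "module (R Quot q) ?Q"
  proof (rule module_image[OF module_axioms q.quotient_is_cring[OF R.is_cring], where h = "\<lambda>a. q +>\<^bsub>R\<^esub> a" and \<phi> = "\<lambda>x. ?K +>\<^bsub>M\<^esub> x"])
    show "(\<lambda>a. q +>\<^bsub>R\<^esub> a) ` carrier R = carrier (R Quot q)" using Rcarr(1) ..
    show "?K +>\<^bsub>M\<^esub> \<zero>\<^bsub>M\<^esub> = \<zero>\<^bsub>?Q\<^esub>" using coset_eq_self_iff[OF K, of "\<zero>\<^bsub>M\<^esub>"] submodule_zero[OF K] carr by simp
    show "(?K +>\<^bsub>M\<^esub> x) \<oplus>\<^bsub>?Q\<^esub> (?K +>\<^bsub>M\<^esub> y) = ?K +>\<^bsub>M\<^esub> (x \<oplus>\<^bsub>M\<^esub> y)" if "x \<in> carrier M" "y \<in> carrier M" for x y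
      using K.a_rcos_sum[OF that] by (simp add: reduced_module_def Let_def)
  qed (auto simp: carr smult FactRing_def q.a_rcos_sum q.rcoset_mult_add)
  moreover have "annihilator (R Quot q) ?Q = (\<lambda>a. q +>\<^bsub>R\<^esub> a) ` {a \<in> carrier R. \<forall>x\<in>carrier M. a \<odot>\<^bsub>M\<^esub> x \<in> ?K}"
  proof -
    have "(q +>\<^bsub>R\<^esub> a) \<odot>\<^bsub>?Q\<^esub> (?K +>\<^bsub>M\<^esub> x) = ?K \<longleftrightarrow> a \<odot>\<^bsub>M\<^esub> x \<in> ?K" if "a \<in> carrier R" "x \<in> carrier M" for a x
      using smult[OF that] coset_eq_self_iff[OF K smult_closed[OF that]] by simp
    then have "(\<forall>T\<in>carrier ?Q. (q +>\<^bsub>R\<^esub> a) \<odot>\<^bsub>?Q\<^esub> T = \<zero>\<^bsub>?Q\<^esub>) \<longleftrightarrow> (\<forall>x\<in>carrier M. a \<odot>\<^bsub>M\<^esub> x \<in> ?K)" if "a \<in> carrier R" for a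
      using that unfolding carr by (simp add: ball_simps)
    then show ?thesis unfolding annihilator_def Rcarr(1) by blast
  qed
  moreover have "(\<lambda>a. q +>\<^bsub>R\<^esub> a) ` {a \<in> carrier R. \<forall>x\<in>carrier M. a \<odot>\<^bsub>M\<^esub> x \<in> ?K} = {q} \<longleftrightarrow>
      {a \<in> carrier R. \<forall>x\<in>carrier M. a \<odot>\<^bsub>M\<^esub> x \<in> ?K} = q" (is "?f ` ?J = {q} \<longleftrightarrow> _")
  proof -
    have sub: "q \<subseteq> ?J" using qD(1) mem by auto
    have iff: "q +>\<^bsub>R\<^esub> a = q \<longleftrightarrow> a \<in> q" if "a \<in> carrier R" for a
      using q.rcos_const_imp_mem[OF that] R.a_rcos_zero[OF q] by auto
    have zero: "q +>\<^bsub>R\<^esub> \<zero>\<^bsub>R\<^esub> = q" "\<zero>\<^bsub>R\<^esub> \<in> ?J" using iff qD(2) sub by auto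
    show ?thesis
    proof
      assume "?f ` ?J = {q}"
      then have "a \<in> q" if "a \<in> ?J" for a using iff[of a] that by auto
      then show "?J = q" using sub by auto
    next
      assume J: "?J = q"
      then have "?f a = q" if "a \<in> ?J" for a using iff[of a] that qD(1) by auto
      then show "?f ` ?J = {q}" using zero by blast
    qed
  qed
  ultimately show ?thesis unfolding faithful_module_def Rcarr by simp
qed

text \<open>Modulo \<open>q\<close> every element of \<open>Z\<close> is nilpotent. Starting from an
  element of \<open>J\<close> outside \<open>q\<close>, multiply for each \<open>z\<close> by the
  highest power of \<open>z\<close> that does not carry it into \<open>q\<close>; products with the
  earlier members of \<open>Z\<close> remain in \<open>q\<close>.\<close>

lemma (in cring) exists_socle_element:
  assumes J: "ideal J R" and q: "ideal q R" "q \<subset> J" and Z: "finite Z" "Z \<subseteq> carrier R"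
    and nil: "\<And>z. z \<in> Z \<Longrightarrow> \<exists>k::nat. z [^] k \<in> q"
  shows "\<exists>w\<in>J - q. \<forall>z\<in>Z. z \<otimes> w \<in> q"
  using Z nil
proof (induction Z)
  case empty then show ?case using q(2) by auto
next
  case (insert z Z)
  then obtain w where w: "w \<in> J" "w \<notin> q" "\<forall>y\<in>Z. y \<otimes> w \<in> q" by auto
  have c: "w \<in> carrier R" "z \<in> carrier R" using w(1) idealD(1)[OF J] insert.prems by auto
  obtain k :: nat where "z [^] k \<in> q" using insert.prems by auto
  then have ex: "\<exists>k::nat. z [^] k \<otimes> w \<in> q" using idealD(5)[OF q(1)] c by blast
  \<comment> \<open>\<open>t\<close> is positive because \<open>w\<close> is outside
    \<open>q\<close>, so the exponent \<open>t - 1\<close> is available, and by minimality it keeps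
    the product outside \<open>q\<close>.\<close>
  define t where "t = (LEAST k::nat. z [^] k \<otimes> w \<in> q)"
  have t: "z [^] t \<otimes> w \<in> q" unfolding t_def using LeastI_ex[OF ex] .
  have "t \<noteq> 0" using t w(2) c by (metis nat_pow_0 l_one)
  then obtain s where s: "t = Suc s" by (cases t) auto
  have ns: "z [^] s \<otimes> w \<notin> q" using not_less_Least[of s "\<lambda>k. z [^] k \<otimes> w \<in> q"] s unfolding t_def by auto
  have "z \<otimes> (z [^] s \<otimes> w) = z [^] t \<otimes> w" using c s by (simp add: m_ac)
  moreover have "y \<otimes> (z [^] s \<otimes> w) \<in> q" if y: "y \<in> Z" for y
  proof -
    have yc: "y \<in> carrier R" using y insert.prems by auto
    then have "y \<otimes> (z [^] s \<otimes> w) = z [^] s \<otimes> (y \<otimes> w)" using c by (simp add: m_ac)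
    then show ?thesis using w(3) y idealD(4)[OF q(1), of "z [^] s"] c by auto
  qed
  ultimately show ?case using t ns idealD(4)[OF J, of "z [^] s" w] w(1) c by (intro bexI[of _ "z [^] s \<otimes> w"]) auto
qed

section \<open>Types as socle lengths, and their comparison\<close>

lemma cm_type_eq_socle:
  assumes R: "cring R" "noetherian_ring R" and I: "ideal I R" "the_max_ideal R = I" and M: "module R M"
    and xs: "set xs \<subseteq> I" "module.weakly_regular M {\<zero>\<^bsub>M\<^esub>} xs" "krull_dim R = enat (length xs)"
  shows "cm_type R M = rlen R M (fold (module.add_mult M) xs {\<zero>\<^bsub>M\<^esub>})
    (module.colon_sub M (fold (module.add_mult M) xs {\<zero>\<^bsub>M\<^esub>}) I)"
  using Ext_length_eq_socle[OF R I(1) M xs(1,2)] by (simp add: cm_type_def I(2) xs(3))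

context idealized
begin

lemma fin_gen_self: "fin_gen_module R (self_module R)"
  using noeth_self[OF noeth] S.carrier_is_submodule S.module_axioms
  unfolding S.noeth_def fin_gen_module_def by blast

lemma fold_self_eq:
  assumes "set xs \<subseteq> carrier R"
  shows "fold S.add_mult xs {\<zero>} = Idl (set xs)"
proof
  have z: "{\<zero>} = {\<zero>\<^bsub>self_module R\<^esub>}" by (simp add: self_module_simps)
  let ?L = "fold S.add_mult xs {\<zero>}"
  have L: "submodule ?L R (self_module R)" unfolding z by (rule S.fold_add_mult_submodule[OF assms S.zero_submodule])
  have I: "ideal (Idl (set xs)) R" by (rule genideal_ideal[OF assms])
  show "?L \<subseteq> Idl (set xs)"
  proof (rule S.fold_add_mult_least)
    show "y \<odot>\<^bsub>self_module R\<^esub> u \<in> Idl (set xs)" if "y \<in> set xs" "u \<in> carrier (self_module R)" for y u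
      using that genideal_self[OF assms] idealD(5)[OF I] by (auto simp: self_module_simps)
  qed (use I idealD(2)[OF I] in \<open>auto simp: submodule_self_iff\<close>)
  have "y \<in> ?L" if y: "y \<in> set xs" for y
    using S.smult_mem_fold_add_mult[OF S.zero_submodule assms y, of \<one>] y assms by (auto simp: self_module_simps)
  then show "Idl (set xs) \<subseteq> ?L" using L by (intro genideal_minimal) (auto simp: submodule_self_iff)
qed

lemma ideal_times_module_upper:
  "a \<in> I \<Longrightarrow> x \<in> carrier M \<Longrightarrow> a \<odot>\<^bsub>M\<^esub> x \<in> ideal_times_module R I M"
  using M.span_upper[of "{a \<odot>\<^bsub>M\<^esub> x | a x. a \<in> I \<and> x \<in> carrier M}"] unfolding ideal_times_module_def by blast

lemma ideal_times_module_le_iff: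
  assumes "submodule K R M"
  shows "ideal_times_module R I M \<subseteq> K \<longleftrightarrow> (\<forall>a\<in>I. \<forall>x\<in>carrier M. a \<odot>\<^bsub>M\<^esub> x \<in> K)"
  using ideal_times_module_upper M.span_least[OF assms, of "{a \<odot>\<^bsub>M\<^esub> x | a x. a \<in> I \<and> x \<in> carrier M}"]
  unfolding ideal_times_module_def by blast

text \<open>One system of parameters serves \<open>M\<close>, \<open>R\<close> and, in the form of
  pairs \<open>(y, 0)\<close>, also \<open>A\<close>.\<close>

lemma cm_types:
  assumes cm: "depth R (self_module R) = krull_dim R" "depth R M = krull_dim R"
    and xs: "system_of_parameters R xs"
  defines "q \<equiv> Idl (set xs)" and "K \<equiv> ideal_times_module R (Idl (set xs)) M"
  shows "cm_type R M = rlen R M K (M.colon_sub K m)"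
    and "ring_cm_type R = rlen R (self_module R) q (S.colon_sub q m)"
    and "ring_cm_type A = rlen A (self_module A) (q \<times> K) (SA.colon_sub (q \<times> K) (m \<times> carrier M))"
proof -
  have xm: "set xs \<subseteq> m" and len: "krull_dim R = enat (length xs)"
    using xs unfolding system_of_parameters_def m_def by auto
  have xc: "set xs \<subseteq> carrier R" using xm m_simps(1) by auto
  \<comment> \<open>Zero modules have infinite depth by convention, so finite depth makes both
    modules nonzero.\<close>
  have "depth R M \<noteq> \<infinity>" "depth R (self_module R) \<noteq> \<infinity>" using cm len by auto
  then have nz: "carrier M \<noteq> {\<zero>\<^bsub>M\<^esub>}" "carrier (self_module R) \<noteq> {\<zero>\<^bsub>self_module R\<^esub>}"
    by (auto simp: depth_def split: if_splits)
  have wM: "M.weakly_regular {\<zero>\<^bsub>M\<^esub>} xs" by (rule sop_weakly_regular[OF fg cm(2) len nz(1) xs])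
  have wR: "S.weakly_regular {\<zero>\<^bsub>self_module R\<^esub>} xs" by (rule sop_weakly_regular[OF fin_gen_self cm(1) len nz(2) xs])
  have K: "fold M.add_mult xs {\<zero>\<^bsub>M\<^esub>} = K" unfolding K_def by (rule M.fold_add_mult_eq_ideal_times[OF xc])
  have q: "fold S.add_mult xs {\<zero>\<^bsub>self_module R\<^esub>} = q"
    using fold_self_eq[OF xc] by (simp add: q_def self_module_simps)
  note R = is_cring noeth m_ideal m_def[symmetric]
  show "cm_type R M = rlen R M K (M.colon_sub K m)"
    using cm_type_eq_socle[OF R M.module_axioms xm wM len] by (simp add: K)
  show "ring_cm_type R = rlen R (self_module R) q (S.colon_sub q m)"
    using cm_type_eq_socle[OF R S.module_axioms xm wR len] by (simp add: q)
  let ?xs = "map (\<lambda>y. (y, \<zero>\<^bsub>M\<^esub>)) xs"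
  have z: "{\<zero>\<^bsub>self_module A\<^esub>} = {\<zero>\<^bsub>self_module R\<^esub>} \<times> {\<zero>\<^bsub>M\<^esub>}" by (auto simp: self_module_simps A_simps)
  have wA: "SA.weakly_regular {\<zero>\<^bsub>self_module A\<^esub>} ?xs" and fA: "fold SA.add_mult ?xs {\<zero>\<^bsub>self_module A\<^esub>} = q \<times> K"
    using weakly_regular_A[OF xc S.zero_submodule M.zero_submodule wR wM] unfolding z K q by auto
  have "set ?xs \<subseteq> m \<times> carrier M" "krull_dim A = enat (length ?xs)" using xm len krull_dim_A by auto
  from cm_type_eq_socle[OF A_cring A_noetherian m_times_carrier_proper(1) max_ideal_A SA.module_axioms this(1) wA this(2)]
  show "ring_cm_type A = rlen A (self_module A) (q \<times> K) (SA.colon_sub (q \<times> K) (m \<times> carrier M))" by (simp add: fA)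
qed

text \<open>Let \<open>T\<close> be the preimage of the socle of \<open>R/q\<close> and
  \<open>W\<close> its part annihilating \<open>M/qM\<close>. Then
  \<open>r(A) = l(W/q) + r(M)\<close> and \<open>r(R) = l(W/q) + l(T/W)\<close>, all of them finite.
  Equality at the lower end means \<open>W = q\<close>, at the upper end
  \<open>W = T\<close>.\<close>

lemma cm_types_compare:
  assumes cm: "depth R (self_module R) = krull_dim R" "depth R M = krull_dim R"
    and xs: "system_of_parameters R xs" and q: "q = Idl (set xs)"
  shows "cm_type R M \<le> ring_cm_type A" "ring_cm_type A \<le> ring_cm_type R + cm_type R M"
    and "ring_cm_type A = cm_type R M \<longleftrightarrow> faithful_module (R Quot q) (reduced_module R q M)"
    and "ring_cm_type A = ring_cm_type R + cm_type R M \<longleftrightarrow>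
      ideal_times_module R (colon_ideal R q m) M = ideal_times_module R q M"
proof -
  have xm: "set xs \<subseteq> m" and rad: "ideal_radical R q = m"
    using xs q unfolding system_of_parameters_def m_def by auto
  have xc: "set xs \<subseteq> carrier R" using xm m_simps(1) by auto
  have qi: "ideal q R" unfolding q by (rule genideal_ideal[OF xc])
  note qD = idealD[OF qi]
  have qs: "submodule q R (self_module R)" using qi by (simp add: submodule_self_iff)
  let ?K = "ideal_times_module R q M"
  note K = M.ideal_times_submodule[OF qD(1)] and qK = ideal_times_module_upper[of _ q]
  let ?T = "S.colon_sub q m"
  let ?W = "{a \<in> ?T. \<forall>x\<in>carrier M. a \<odot>\<^bsub>M\<^esub> x \<in> ?K}"
  note T = S.colon_sub_submodule[OF qs m_simps(1)] and qT = S.colon_sub_upper[OF qs m_simps(1)]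
  note socle = rlen_A_socle[OF qs K qK]
  note W = socle(2) and qW = socle(3)
  have WT: "?W \<subseteq> ?T" by auto
  note types = cm_types[OF cm xs, folded q]
  have rA: "ring_cm_type A = rlen R (self_module R) q ?W + cm_type R M"
    using socle(1) types by simp
  have rR: "ring_cm_type R = rlen R (self_module R) q ?W + rlen R (self_module R) ?W ?T"
    using S.rlen_additive[OF qs W T qW WT] types by simp
  \<comment> \<open>Finiteness allows the cancellations in \<open>enat\<close> that follow.\<close>
  have finM: "cm_type R M \<noteq> \<infinity>" unfolding types(1)
    using unit_iff
    by (intro M.noeth_rlen_finite[OF M.fin_gen_imp_noeth[OF noeth fg] K M.colon_sub_submodule[OF K m_simps(1)]
        M.colon_sub_upper[OF K m_simps(1)], of m]) (auto simp: M.colon_sub_def)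
  have finR: "ring_cm_type R \<noteq> \<infinity>" unfolding types(2)
    using unit_iff
    by (intro S.noeth_rlen_finite[OF noeth_self[OF noeth] qs T qT, of m]) (auto simp: S.colon_sub_def)
  obtain r where r: "cm_type R M = enat r" using finM by auto
  obtain s where s: "rlen R (self_module R) q ?W = enat s" using finR rR by (cases "rlen R (self_module R) q ?W") auto
  obtain t where t: "rlen R (self_module R) ?W ?T = enat t" using finR rR by (cases "rlen R (self_module R) ?W ?T") auto
  show "cm_type R M \<le> ring_cm_type A" unfolding rA by simp
  show "ring_cm_type A \<le> ring_cm_type R + cm_type R M" unfolding rA rR r s t by simp
  let ?J = "{a \<in> carrier R. \<forall>x\<in>carrier M. a \<odot>\<^bsub>M\<^esub> x \<in> ?K}"
  have "ring_cm_type A = cm_type R M \<longleftrightarrow> rlen R (self_module R) q ?W = 0"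
    unfolding rA r s by (simp add: zero_enat_def)
  also have "\<dots> \<longleftrightarrow> q = ?W" by (rule S.rlen_eq_0_iff[OF qs W qW])
  also have "\<dots> \<longleftrightarrow> ?J = q"
  proof
    assume "?J = q"
    then show "q = ?W" using qW S.submodule_carrier[OF T] by (auto simp: self_module_simps)
  next
    assume qeq: "q = ?W"
    have qJ: "q \<subseteq> ?J" using qD(1) qK by auto
    show "?J = q"
    proof (rule ccontr)
      assume "?J \<noteq> q"
      then have lt: "q \<subset> ?J" using qJ by auto
      have "submodule ?J R (self_module R)"
        by (rule S.submodule_if_closed)
          (auto simp: self_module_simps M.smult_l_distr M.smult_assoc1 intro: M.submodule_zero[OF K] M.submoduleE(4,5)[OF K])
      then have J: "ideal ?J R" by (simp add: submodule_self_iff)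
      obtain Z where Z: "Z \<subseteq> carrier R" "finite Z" "m = Idl Z"
        using noetherian_ring.finetely_gen[OF noeth m_ideal] by blast
      have nil: "\<exists>k::nat. z [^] k \<in> q" if "z \<in> Z" for z
        using rad that genideal_self[OF Z(1)] Z(3) by (auto simp: ideal_radical_def)
      obtain w where w: "w \<in> ?J" "w \<notin> q" "\<forall>z\<in>Z. z \<otimes> w \<in> q"
        using exists_socle_element[OF J qi lt Z(2,1) nil] by auto
      have wc: "w \<in> carrier R" using w(1) by simp
      \<comment> \<open>The scalars carrying \<open>w\<close> into \<open>q\<close> form an ideal;
        containing the generators \<open>Z\<close>, it contains \<open>m\<close>.\<close>
      have "submodule {b \<in> carrier R. b \<otimes> w \<in> q} R (self_module R)"
        by (rule S.submodule_if_closed) (use qD wc in \<open>auto simp: self_module_simps l_distr m_assoc\<close>)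
      then have "m \<subseteq> {b \<in> carrier R. b \<otimes> w \<in> q}"
        unfolding Z(3) using w(3) Z(1) by (intro genideal_minimal) (auto simp: submodule_self_iff)
      then have "w \<in> ?W" using w(1) wc by (auto simp: S.colon_sub_def self_module_simps)
      then show False using qeq w(2) by blast
    qed
  qed
  also have "\<dots> \<longleftrightarrow> faithful_module (R Quot q) (reduced_module R q M)"
    using M.faithful_reduced_module_iff[OF qi] by simp
  finally show "ring_cm_type A = cm_type R M \<longleftrightarrow> faithful_module (R Quot q) (reduced_module R q M)" .
  have Tq: "colon_ideal R q m = ?T"
    using m_simps(1) by (auto simp: colon_ideal_def S.colon_sub_def self_module_simps m_comm subset_iff)
  have "ring_cm_type A = ring_cm_type R + cm_type R M \<longleftrightarrow> rlen R (self_module R) ?W ?T = 0"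
    unfolding rA rR r s t by (simp add: zero_enat_def)
  also have "\<dots> \<longleftrightarrow> ?W = ?T" by (rule S.rlen_eq_0_iff[OF W T WT])
  \<comment> \<open>By definition of \<open>?W\<close>, equality with \<open>?T\<close> says that
    \<open>?T\<close> carries \<open>M\<close> into \<open>?K\<close>; the opposite inclusion of the
    products comes from \<open>q \<subseteq> ?T\<close>.\<close>
  also have "\<dots> \<longleftrightarrow> ideal_times_module R ?T M \<subseteq> ?K" unfolding ideal_times_module_le_iff[OF K] by blast
  also have "\<dots> \<longleftrightarrow> ideal_times_module R ?T M = ?K"
  proof -
    have "?T \<subseteq> carrier R" using S.submodule_carrier[OF T] by (auto simp: self_module_simps)
    then have "?K \<subseteq> ideal_times_module R ?T M"
      using qT ideal_times_module_upper[of _ ?T] by (subst ideal_times_module_le_iff[OF M.ideal_times_submodule]) auto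
    then show ?thesis by auto
  qed
  finally show "ring_cm_type A = ring_cm_type R + cm_type R M \<longleftrightarrow>
      ideal_times_module R (colon_ideal R q m) M = ?K" unfolding Tq .
qed

end

theorem theorem2p2:
  fixes R :: "('a, 'r) ring_scheme" and M :: "('a, 'b, 'm) module_scheme"
    and A :: "('a \<times> 'b) ring"
  assumes "cohen_macaulay_local R"
    and "maximal_cohen_macaulay R M"
    and "A = idealization R M"
  shows "cm_type R M \<le> ring_cm_type A \<and> ring_cm_type A \<le> ring_cm_type R + cm_type R M \<and>
    (\<forall>q. parameter_ideal R q \<longrightarrow>
       (ring_cm_type A = cm_type R M \<longleftrightarrow> faithful_module (R Quot q) (reduced_module R q M)) \<and>
       (ring_cm_type A = ring_cm_type R + cm_type R M \<longleftrightarrow>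
          ideal_times_module R (colon_ideal R q (the_max_ideal R)) M = ideal_times_module R q M))"
proof -
  have R: "local_ring R" "noetherian_ring R" "depth R (self_module R) = krull_dim R"
    using assms(1) by (auto simp: cohen_macaulay_local_def)
  have M: "fin_gen_module R M" "depth R M = krull_dim R"
    using assms(2) by (auto simp: maximal_cohen_macaulay_def)
  have "cring R" "module R M" using R M by (auto simp: local_ring_def fin_gen_module_def)
  then interpret I: idealized R M
    using R M by (auto intro!: idealized.intro noetherian_local.intro noetherian_local_axioms.intro idealized_axioms.intro)
  have A: "A = I.A" by (simp add: assms(3) I.A_def)
  note compare = I.cm_types_compare[OF R(3) M(2), folded A, unfolded I.m_def]
  \<comment> \<open>The two bounds mention no parameter ideal, so one is supplied here.\<close>
  obtain xs where "system_of_parameters R xs" using I.sop_exists[OF R(3)] ..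
  from compare(1,2)[OF this refl] compare(3,4) show ?thesis
    unfolding parameter_ideal_def by blast
qed

end
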